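(* Let $G$ be a Cayley graph of a group $\Gamma$ with respect to a finite generating set, let $\beta>0$, and consider the interchange process on $G$ up to time $\beta$, driven by the independent unit rate Poisson clocks $\psi=(\psi_e)_{e\in E(G)}$, with resulting random permutation $\pi_\beta$ of $V(G)$. Then the infinite cycles of $\pi_\beta$, together with the environment of the clocks $(\psi_e)$, are indistinguishable: for every component property $\mathscr A$ (of the pair consisting of the clocks $\psi$ and a vertex, the components being the cycles of $\pi_\beta$), the event $\{(\psi,o)\in\mathscr A\}$ has probability either $0$ or $1$ conditionally on the cycle of $o$ being infinite (if the latter event has positive probability).
   Context: **Cayley graph.** $\Gamma$ is identified with $V(G)$, with identity $o$; $G$ is the left Cayley graph (edges $\{x,sx\}$, $s$ a generator), and $\Gamma$ acts on $G$ by graph automorphisms $g\cdot x=xg^{-1}$. It acts correspondingly on labellings of vertices and edges. **Interchange process.** To every edge $e$ of $G$ assign an independent unit rate Poisson process $\psi_e$ of clock rings on $[0,\infty)$. At time $0$ there is one particle at each vertex. Each time a clock $\psi_e$ rings, the two particles at the endpoints of $e$ are swapped; stop at the fixed time $\beta>0$. The random permutation $\pi_\beta$ of $V(G)$ sends each vertex $v$ to the position at time $\beta$ of the particle that started at $v$. (This is almost surely well defined.) The cycle of a vertex $v$ is $\{\pi_\beta^n(v): n\in\mathbb Z\}$; the cycles partition $V(G)$. **Component property.** A measurable set $\mathscr A$ of pairs $(\psi,v)$ (a realization of the clocks and a vertex $v$) that is invariant under the diagonal action of $\Gamma$ and does not depend on the choice of the vertex within its cycle: if $v,w$ are in the same cycle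 of the permutation $\pi_\beta$ determined by $\psi$, then $(\psi,v)\in\mathscr A$ if and only if $(\psi,w)\in\mathscr A$. *)

theory Defs
  imports
    "HOL-Algebra.Generated_Groups"
    "HOL-Combinatorics.Permutations"
    "HOL-Probability.Probability"
begin

text \<open>Loops are discarded, so a generating set may contain the identity. A generator and its
  inverse give the same edge.\<close>

definition cayley_edges :: "('a, 'b) monoid_scheme \<Rightarrow> 'a set \<Rightarrow> 'a set set" where
  "cayley_edges G S =
     {{x, s \<otimes>\<^bsub>G\<^esub> x} | x s. x \<in> carrier G \<and> s \<in> S \<and> s \<otimes>\<^bsub>G\<^esub> x \<noteq> x}"

definition vertex_action :: "('a, 'b) monoid_scheme \<Rightarrow> 'a \<Rightarrow> 'a \<Rightarrow> 'a" where
  "vertex_action G g x = x \<otimes>\<^bsub>G\<^esub> inv\<^bsub>G\<^esub> g"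

text \<open>A realization of one clock is its set of ring times, a locally finite subset of
  \<open>[0, \<infinity>)\<close>, with the sigma-algebra generated by the counting variables.\<close>

definition ring_times :: "real set set" where
  "ring_times = {N. N \<subseteq> {0..} \<and> (\<forall>t. finite (N \<inter> {0..t}))}"

definition ring_space :: "real set measure" where
  "ring_space = sigma ring_times {{N \<in> ring_times. card (N \<inter> {0..t}) = k} | t k. 0 \<le> t}"

definition clock_space :: "('a, 'b) monoid_scheme \<Rightarrow> 'a set \<Rightarrow> ('a set \<Rightarrow> real set) measure" where
  "clock_space G S = (\<Pi>\<^sub>M e \<in> cayley_edges G S. ring_space)"

text \<open>The labelling moved by \<open>g\<close>: the edge \<open>e\<close> receives the label of \<open>g\<^sup>-\<^sup>1 \<cdot> e\<close>.\<close>

definition clock_action ::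
  "('a, 'b) monoid_scheme \<Rightarrow> 'a set \<Rightarrow> 'a \<Rightarrow> ('a set \<Rightarrow> real set) \<Rightarrow> ('a set \<Rightarrow> real set)" where
  "clock_action G S g \<psi> =
     (\<lambda>e \<in> cayley_edges G S. \<psi> (vertex_action G (inv\<^bsub>G\<^esub> g) ` e))"

text \<open>The half-open intervals \<open>[s, t)\<close> also control a possible ring at time \<open>0\<close>.\<close>

definition unit_poisson_process :: "'w measure \<Rightarrow> ('w \<Rightarrow> real set) \<Rightarrow> bool" where
  "unit_poisson_process M N \<longleftrightarrow>
     N \<in> M \<rightarrow>\<^sub>M ring_space \<and>
     (\<forall>s t. 0 \<le> s \<and> s < t \<longrightarrow>
        distr M (count_space UNIV) (\<lambda>\<omega>. card (N \<omega> \<inter> {s..<t})) = measure_pmf (poisson_pmf (t - s))) \<and>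
     (\<forall>\<tau> :: nat \<Rightarrow> real. 0 \<le> \<tau> 0 \<and> strict_mono \<tau> \<longrightarrow>
        prob_space.indep_vars M (\<lambda>_. count_space UNIV)
          (\<lambda>i \<omega>. card (N \<omega> \<inter> {\<tau> i..<\<tau> (Suc i)})) UNIV)"

definition poisson_clocks ::
  "'w measure \<Rightarrow> ('a, 'b) monoid_scheme \<Rightarrow> 'a set \<Rightarrow> ('w \<Rightarrow> 'a set \<Rightarrow> real set) \<Rightarrow> bool" where
  "poisson_clocks M G S \<psi> \<longleftrightarrow>
     \<psi> \<in> M \<rightarrow>\<^sub>M clock_space G S \<and>
     (\<forall>e \<in> cayley_edges G S. unit_poisson_process M (\<lambda>\<omega>. \<psi> \<omega> e)) \<and>
     prob_space.indep_vars M (\<lambda>_. ring_space) (\<lambda>e \<omega>. \<psi> \<omega> e) (cayley_edges G S)"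

text \<open>\<open>particle_moves G S \<psi> t s x z\<close>: the particle that is at \<open>x\<close> at time \<open>s\<close> (after any swap at
  time \<open>s\<close>) is at \<open>z\<close> at time \<open>t\<close>, after finitely many swaps. In rule \<open>swap\<close>, \<open>u\<close> is the first
  time after \<open>s\<close> at which a clock at \<open>x\<close> rings, and \<open>{x, y}\<close> is the only edge at \<open>x\<close> ringing then.\<close>

inductive particle_moves ::
  "('a, 'b) monoid_scheme \<Rightarrow> 'a set \<Rightarrow> ('a set \<Rightarrow> real set) \<Rightarrow> real \<Rightarrow> real \<Rightarrow> 'a \<Rightarrow> 'a \<Rightarrow> bool"
  for G S \<psi> t where
  stay: "\<lbrakk>s \<le> t; \<forall>e \<in> cayley_edges G S. x \<in> e \<longrightarrow> \<psi> e \<inter> {s<..t} = {}\<rbrakk>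
    \<Longrightarrow> particle_moves G S \<psi> t s x x"
| swap: "\<lbrakk>s < u; u \<le> t; {x, y} \<in> cayley_edges G S;
     \<forall>e \<in> cayley_edges G S. x \<in> e \<longrightarrow> \<psi> e \<inter> {s<..u} = (if e = {x, y} then {u} else {});
     particle_moves G S \<psi> t u y z\<rbrakk>
    \<Longrightarrow> particle_moves G S \<psi> t s x z"

definition is_interchange_perm ::
  "('a, 'b) monoid_scheme \<Rightarrow> 'a set \<Rightarrow> real \<Rightarrow> ('a set \<Rightarrow> real set) \<Rightarrow> ('a \<Rightarrow> 'a) \<Rightarrow> bool" where
  "is_interchange_perm G S \<beta> \<psi> f \<longleftrightarrow>
     f permutes carrier G \<and> (\<forall>v \<in> carrier G. particle_moves G S \<psi> \<beta> 0 v (f v))"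

text \<open>Almost surely there is exactly one such permutation. On the exceptional null set (explosion
  or simultaneous rings at a vertex) the identity is used. As \<open>permutes\<close> demands, the permutation
  is extended by the identity outside the carrier.\<close>

definition interchange_perm ::
  "('a, 'b) monoid_scheme \<Rightarrow> 'a set \<Rightarrow> real \<Rightarrow> ('a set \<Rightarrow> real set) \<Rightarrow> 'a \<Rightarrow> 'a" where
  "interchange_perm G S \<beta> \<psi> =
     (if \<exists>!f. is_interchange_perm G S \<beta> \<psi> f then THE f. is_interchange_perm G S \<beta> \<psi> f else id)"

text \<open>The two-sided orbit of \<open>v\<close>; \<open>orbit\<close> of the library only collects forward iterates.\<close>

definition perm_cycle :: "('a \<Rightarrow> 'a) \<Rightarrow> 'a \<Rightarrow> 'a set" where
  "perm_cycle f v = range (\<lambda>n. (f ^^ n) v) \<union> range (\<lambda>n. (inv_into UNIV f ^^ n) v)"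

definition component_property ::
  "('a, 'b) monoid_scheme \<Rightarrow> 'a set \<Rightarrow> real \<Rightarrow> (('a set \<Rightarrow> real set) \<times> 'a) set \<Rightarrow> bool" where
  "component_property G S \<beta> A \<longleftrightarrow>
     A \<in> sets (clock_space G S \<Otimes>\<^sub>M count_space (carrier G)) \<and>
     (\<forall>\<psi> \<in> space (clock_space G S). \<forall>v \<in> carrier G. \<forall>g \<in> carrier G.
        (clock_action G S g \<psi>, vertex_action G g v) \<in> A \<longleftrightarrow> (\<psi>, v) \<in> A) \<and>
     (\<forall>\<psi> \<in> space (clock_space G S). \<forall>v \<in> carrier G.
        \<forall>w \<in> perm_cycle (interchange_perm G S \<beta> \<psi>) v. (\<psi>, v) \<in> A \<longleftrightarrow> (\<psi>, w) \<in> A)"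

end

(*
The position of a cycle is tracked by the environment seen from it: by mass transport, the clocks
seen from the n-th image of a vertex under the interchange permutation have the law of the clocks
seen from the origin, for every integer n. Hence, if the property A of the cycle of the origin is
approximated in probability by a cylinder event Z, then Z, evaluated far along the future or the
past of a vertex on an infinite cycle, is a test for A with a small error, and the two tests agree
up to this error.

Suppose infinite cycles of both kinds occur. By mixing of the product measure there is a vertex y
such that with positive probability o and y lie on infinite cycles of different kinds. Write the
transposition of o and y as a product of swaps along edges and insert the corresponding rings just
before time beta, in a window where the finitely many clocks involved are otherwise silent. By
independence of the increments this changes probabilities only by a constant factor independent of
Z. The new permutation is (o y) composed with the old one, so that the past of o is now continued
by the future of y. The test along the past says A and the test along the future says not A, which
contradicts their agreement.
*)

theory Submission
  imports Defs
begin

section \<open>Unit rate Poisson processes\<close>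

text \<open>The obstacle is that \<open>A\<close> may depend on all clocks, so inserting rings can
  change it. Only a cylinder event is stable, and only at vertices from which it reads no altered
  clock. Infinite cycles provide such vertices: the past of o and the future of y leave every finite
  set, so for large n both tests are blind to the swaps. The error of a test is bounded uniformly in
  n and without conditioning, hence also on altered configurations. The order of choices matters:
  the window and the probability q of the prescribed rings are fixed first, then the error
  \<open>p * q / 8\<close> of the approximation, where p is the probability of a mixed pair with
  silent window, and only then n. Insertion is replaced by erasure: a configuration that carries the
  prescribed rings is compared with the one whose window is emptied. The latter is independent of
  the counts in the window, which is the source of the constant factor. All this takes place on a
  product space with a group action, to which a general probability space is reduced at the
  end.\<close>

lemma space_ring_space [simp]: "space ring_space = ring_times"
  unfolding ring_space_def by (rule space_measure_of) auto

lemma sets_ring_space: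
  "sets ring_space =
    sigma_sets ring_times {{N \<in> ring_times. card (N \<inter> {0..t}) = k} | t k. 0 \<le> t}"
  unfolding ring_space_def by (rule sets_measure_of) auto

lemma ring_times_finite_Icc: "N \<in> ring_times \<Longrightarrow> finite (N \<inter> {0..t})"
  by (simp add: ring_times_def)

lemma ring_times_finite_subset:
  "N \<in> ring_times \<Longrightarrow> B \<subseteq> {0..t} \<Longrightarrow> finite (N \<inter> B)"
  by (rule finite_subset[OF _ ring_times_finite_Icc]) auto

lemma ring_times_finite_Ico: "N \<in> ring_times \<Longrightarrow> 0 \<le> a \<Longrightarrow> finite (N \<inter> {a..<b})"
  by (rule ring_times_finite_subset[of _ _ b]) auto

lemma ring_times_finite_Ioc: "N \<in> ring_times \<Longrightarrow> 0 \<le> a \<Longrightarrow> finite (N \<inter> {a<..b})"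
  by (rule ring_times_finite_subset[of _ _ b]) auto

lemma ring_times_subset: "N \<in> ring_times \<Longrightarrow> N' \<subseteq> N \<Longrightarrow> N' \<in> ring_times"
proof -
  assume N: "N \<in> ring_times" and sub: "N' \<subseteq> N"
  have "finite (N' \<inter> {0..t})" for t
    by (rule finite_subset[OF _ ring_times_finite_Icc[OF N]]) (use sub in auto)
  then show ?thesis using N sub by (auto simp: ring_times_def)
qed

lemma ring_times_Diff: "N \<in> ring_times \<Longrightarrow> N - B \<in> ring_times"
  by (rule ring_times_subset) auto

section \<open>Measurability of counts of rings\<close>

lemma measurable_card_Icc:
  assumes "0 \<le> t"
  shows "(\<lambda>N. card (N \<inter> {0..t})) \<in> ring_space \<rightarrow>\<^sub>M count_space UNIV"
proof (subst measurable_count_space_eq2_countable, safe)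
  fix k :: nat
  have "(\<lambda>N. card (N \<inter> {0..t})) -` {k} \<inter> space ring_space = {N \<in> ring_times. card (N \<inter> {0..t}) = k}"
    by auto
  also have "\<dots> \<in> sets ring_space"
    unfolding sets_ring_space using assms by (intro sigma_sets.Basic) auto
  finally show "(\<lambda>N. card (N \<inter> {0..t})) -` {k} \<inter> space ring_space \<in> sets ring_space" .
qed auto

text \<open>Local finiteness leaves a gap between \<open>t\<close> and the last ring before
  \<open>t\<close>. Half-open counts are thus eventually constant limits of the closed counts that
  generate the sigma-algebra.\<close>

lemma eventually_ring_times_left:
  assumes N: "N \<in> ring_times" and t: "0 < t"
  shows "\<forall>\<^sub>F n in sequentially. N \<inter> {0..t - t / (1 + real n)} = N \<inter> {0..<t}"
proof -
  have fin: "finite (N \<inter> {0..<t})" using N by (simp add: ring_times_finite_Ico)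
  have "(\<lambda>n. t - t / (1 + real n)) \<longlonglongrightarrow> t" by real_asymp
  then have "\<forall>\<^sub>F n in sequentially. x < t - t / (1 + real n)" if "x < t" for x
    using that by (rule order_tendstoD(1))
  then have "\<forall>\<^sub>F n in sequentially. \<forall>x\<in>N \<inter> {0..<t}. x < t - t / (1 + real n)"
    using fin by (intro eventually_ball_finite) auto
  then show ?thesis
  proof eventually_elim
    case (elim n)
    have lt: "t - t / (1 + real n) < t" using t by simp
    show ?case
    proof (rule Set.set_eqI)
      fix x
      have "x \<in> N \<inter> {0..<t} \<longrightarrow> x < t - t / (1 + real n)" using elim by blast
      then show "x \<in> N \<inter> {0..t - t / (1 + real n)} \<longleftrightarrow> x \<in> N \<inter> {0..<t}" using lt by auto
    qed
  qed
qed

text \<open>The approximation in the other direction, by the gap after \<open>t\<close>; it recovers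
  closed counts from half-open ones.\<close>

lemma eventually_ring_times_right:
  assumes N: "N \<in> ring_times"
  shows "\<forall>\<^sub>F n in sequentially. N \<inter> {0..<t + 1 / (1 + real n)} = N \<inter> {0..t}"
proof -
  have fin: "finite (N \<inter> {0..t + 1})" using N by (simp add: ring_times_finite_Icc)
  have "(\<lambda>n. t + 1 / (1 + real n)) \<longlonglongrightarrow> t" by real_asymp
  then have "\<forall>\<^sub>F n in sequentially. t + 1 / (1 + real n) < x" if "t < x" for x
    using that by (rule order_tendstoD(2))
  then have "\<forall>\<^sub>F n in sequentially. \<forall>x\<in>N \<inter> {0..t + 1} - {0..t}. t + 1 / (1 + real n) < x"
    using fin by (intro eventually_ball_finite) auto
  then show ?thesis
  proof eventually_elim
    case (elim n)
    define d where "d = 1 / (1 + real n)"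
    have lt: "0 < d" "d \<le> 1" by (simp_all add: d_def)
    show ?case
      unfolding d_def[symmetric]
    proof (rule Set.set_eqI)
      fix x
      have "x \<in> N \<inter> {0..t + 1} - {0..t} \<longrightarrow> t + d < x" using elim unfolding d_def by blast
      then show "x \<in> N \<inter> {0..<t + d} \<longleftrightarrow> x \<in> N \<inter> {0..t}" using lt by auto
    qed
  qed
qed

text \<open>The event \<open>f x = k\<close> is the limit inferior of the events
  \<open>f' n x = k\<close>, a countable combination.\<close>

lemma measurable_eventually_const:
  fixes f :: "'x \<Rightarrow> nat"
  assumes f: "\<And>n. f' n \<in> M \<rightarrow>\<^sub>M count_space UNIV"
    and ev: "\<And>x. x \<in> space M \<Longrightarrow> \<forall>\<^sub>F n in sequentially. f' n x = f x"
  shows "f \<in> M \<rightarrow>\<^sub>M count_space UNIV"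
proof -
  note [measurable] = f
  have "{x \<in> space M. f x = k} \<in> sets M" for k
  proof -
    have "f x = k \<longleftrightarrow> (\<exists>m. \<forall>n\<ge>m. f' n x = k)" if "x \<in> space M" for x
      using ev[OF that] unfolding eventually_sequentially by (metis le_cases)
    then have "{x \<in> space M. f x = k} = {x \<in> space M. \<exists>m. \<forall>n\<ge>m. f' n x = k}" by auto
    also have "\<dots> \<in> sets M" by measurable
    finally show ?thesis .
  qed
  moreover have "f -` {k} \<inter> space M = {x \<in> space M. f x = k}" for k by auto
  ultimately show ?thesis by (subst measurable_count_space_eq2_countable) auto
qed

lemma measurable_card_Ico0:
  "(\<lambda>N. card (N \<inter> {0..<t})) \<in> ring_space \<rightarrow>\<^sub>M count_space UNIV"
proof (cases "0 < t")
  case True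
  show ?thesis
  proof (rule measurable_eventually_const)
    show "(\<lambda>N. card (N \<inter> {0..t - t / (1 + real n)})) \<in> ring_space \<rightarrow>\<^sub>M count_space UNIV" for n
      using True by (intro measurable_card_Icc) (simp add: field_simps)
    show "\<forall>\<^sub>F n in sequentially. card (N \<inter> {0..t - t / (1 + real n)}) = card (N \<inter> {0..<t})"
      if "N \<in> space ring_space" for N
      using eventually_ring_times_left[of N t] that True by (auto elim: eventually_mono)
  qed
qed simp

lemma measurable_card_Ico:
  assumes "0 \<le> s"
  shows "(\<lambda>N. card (N \<inter> {s..<t})) \<in> ring_space \<rightarrow>\<^sub>M count_space UNIV"
proof (cases "s \<le> t")
  case True
  have "card (N \<inter> {s..<t}) = card (N \<inter> {0..<t}) - card (N \<inter> {0..<s})"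
    if "N \<in> space ring_space" for N
  proof -
    have "N \<inter> {s..<t} = N \<inter> {0..<t} - N \<inter> {0..<s}" using True assms by auto
    moreover have "N \<inter> {0..<s} \<subseteq> N \<inter> {0..<t}" using True by auto
    ultimately show ?thesis using that by (simp add: ring_times_finite_Ico card_Diff_subset)
  qed
  moreover note [measurable] = measurable_card_Ico0
  have "(\<lambda>N. card (N \<inter> {0..<t}) - card (N \<inter> {0..<s})) \<in> ring_space \<rightarrow>\<^sub>M count_space UNIV" by measurable
  ultimately show ?thesis by (metis (no_types, lifting) measurable_cong)
qed simp

lemma measurable_card_Ioc:
  assumes "0 \<le> s"
  shows "(\<lambda>N. card (N \<inter> {s<..t})) \<in> ring_space \<rightarrow>\<^sub>M count_space UNIV"
proof (cases "s \<le> t")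
  case True
  note [measurable] = measurable_card_Icc[OF assms] measurable_card_Icc[OF order_trans[OF assms True]]
  have "card (N \<inter> {s<..t}) = card (N \<inter> {0..t}) - card (N \<inter> {0..s})"
    if "N \<in> space ring_space" for N
  proof -
    have "N \<inter> {s<..t} = N \<inter> {0..t} - N \<inter> {0..s}" using True assms by auto
    moreover have "N \<inter> {0..s} \<subseteq> N \<inter> {0..t}" using True by auto
    ultimately show ?thesis using that by (simp add: ring_times_finite_Icc card_Diff_subset)
  qed
  moreover have "(\<lambda>N. card (N \<inter> {0..t}) - card (N \<inter> {0..s})) \<in> ring_space \<rightarrow>\<^sub>M count_space UNIV" by measurable
  ultimately show ?thesis by (metis (no_types, lifting) measurable_cong)
qed simp

lemma measurable_Diff_Ico:
  assumes "0 \<le> a"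
  shows "(\<lambda>N. N - {a..<b}) \<in> ring_space \<rightarrow>\<^sub>M ring_space"
proof -
  have "(\<lambda>N. N - {a..<b}) \<in> measurable ring_space (sigma ring_times {{N \<in> ring_times. card (N \<inter> {0..t}) = k} | t k. 0 \<le> t})"
  proof (rule measurable_measure_of)
    show "(\<lambda>N. N - {a..<b}) \<in> space ring_space \<rightarrow> ring_times" by (auto simp: ring_times_Diff)
    fix Y assume "Y \<in> {{N \<in> ring_times. card (N \<inter> {0..t}) = k} | t k. 0 \<le> t}"
    then obtain t k where Y: "Y = {N \<in> ring_times. card (N \<inter> {0..t}) = k}" "0 \<le> t" by auto
    show "(\<lambda>N. N - {a..<b}) -` Y \<inter> space ring_space \<in> sets ring_space"
    proof -
      note [measurable] = measurable_card_Ico0[of a] measurable_card_Ico[OF assms, of b] measurable_card_Icc[OF Y(2)]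
      define f where "f N = (if t < a then card (N \<inter> {0..t}) else if t < b then card (N \<inter> {0..<a})
        else card (N \<inter> {0..t}) - card (N \<inter> {a..<b}))" for N
      have f: "card ((N - {a..<b}) \<inter> {0..t}) = f N" if N: "N \<in> ring_times" for N
      proof -
        consider "t < a" | "a \<le> t" "t < b" | "a \<le> t" "b \<le> t" by linarith
        then show ?thesis
        proof cases
          case 1
          then have "(N - {a..<b}) \<inter> {0..t} = N \<inter> {0..t}" by auto
          then show ?thesis using 1 by (simp add: f_def)
        next
          case 2
          then have "(N - {a..<b}) \<inter> {0..t} = N \<inter> {0..<a}" by auto
          then show ?thesis using 2 by (simp add: f_def)
        next
          case 3
          then have "(N - {a..<b}) \<inter> {0..t} = N \<inter> {0..t} - N \<inter> {a..<b}" by auto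
          moreover have "N \<inter> {a..<b} \<subseteq> N \<inter> {0..t}" using 3 assms by auto
          ultimately show ?thesis using 3 N assms
            by (simp add: f_def ring_times_finite_Ico card_Diff_subset)
        qed
      qed
      have "f \<in> ring_space \<rightarrow>\<^sub>M count_space UNIV" unfolding f_def by measurable
      then have "f -` {k} \<inter> space ring_space \<in> sets ring_space" by (rule measurable_sets) simp
      also have "f -` {k} \<inter> space ring_space = (\<lambda>N. N - {a..<b}) -` Y \<inter> space ring_space"
        using f Y by (auto simp: ring_times_Diff)
      finally show ?thesis .
    qed
  qed auto
  then show ?thesis by (simp add: ring_space_def)
qed

text \<open>Half-open counting events form a generator on which the increments determine everything.\<close>

definition count_event :: "(real \<times> nat) set \<Rightarrow> real set set" where
  "count_event P = {N \<in> ring_times. \<forall>(t, k)\<in>P. card (N \<inter> {0..<t}) = k}"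

definition count_events :: "real set set set" where
  "count_events = {count_event P | P. finite P}"

lemma count_events_Int: "count_event P \<inter> count_event Q = count_event (P \<union> Q)"
  unfolding count_event_def ball_Un by auto

lemma Int_stable_count_events: "Int_stable count_events"
  unfolding Int_stable_def count_events_def using count_events_Int by blast

text \<open>Closed and half-open counts are limits of each other. The half-open ones fit the
  increments over \<open>{s..<t}\<close> in \<open>unit_poisson_process\<close> and give a generator
  stable under intersections.\<close>

lemma sets_ring_space_count_events: "sets ring_space = sigma_sets ring_times count_events"
proof
  interpret sigma_algebra ring_times "sigma_sets ring_times count_events"
    by (rule sigma_algebra_sigma_sets) (auto simp: count_events_def count_event_def)
  let ?M = "sigma ring_times count_events"
  have sp: "space ?M = ring_times" "sets ?M = sigma_sets ring_times count_events"
    by (auto simp: count_events_def count_event_def intro!: space_measure_of sets_measure_of)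
  have Ico: "(\<lambda>N. card (N \<inter> {0..<t})) \<in> ?M \<rightarrow>\<^sub>M count_space UNIV" for t
  proof (subst measurable_count_space_eq2_countable, safe)
    fix k :: nat
    have "(\<lambda>N. card (N \<inter> {0..<t})) -` {k} \<inter> space ?M = count_event {(t, k)}"
      by (auto simp: sp count_event_def)
    also have "\<dots> \<in> sets ?M"
      unfolding sp by (rule sigma_sets.Basic) (auto simp: count_events_def)
    finally show "(\<lambda>N. card (N \<inter> {0..<t})) -` {k} \<inter> space ?M \<in> sets ?M" .
  qed auto
  have Icc: "(\<lambda>N. card (N \<inter> {0..t})) \<in> ?M \<rightarrow>\<^sub>M count_space UNIV" for t
  proof (rule measurable_eventually_const)
    show "\<forall>\<^sub>F n in sequentially. card (N \<inter> {0..<t + 1 / (1 + real n)}) = card (N \<inter> {0..t})"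
      if "N \<in> space ?M" for N
      using eventually_ring_times_right[of N t] that sp by (auto elim: eventually_mono)
  qed (rule Ico)
  show "sets ring_space \<subseteq> sigma_sets ring_times count_events"
    unfolding sets_ring_space
  proof (rule sigma_sets_mono, safe)
    fix t :: real and k :: nat
    have "{N \<in> ring_times. card (N \<inter> {0..t}) = k} = (\<lambda>N. card (N \<inter> {0..t})) -` {k} \<inter> space ?M"
      by (auto simp: sp)
    also have "\<dots> \<in> sets ?M" by (rule measurable_sets[OF Icc]) simp
    finally show "{N \<in> ring_times. card (N \<inter> {0..t}) = k} \<in> sigma_sets ring_times count_events"
      by (simp add: sp)
  qed
  show "sigma_sets ring_times count_events \<subseteq> sets ring_space"
  proof (subst space_ring_space[symmetric], rule sets.sigma_sets_subset, rule subsetI)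
    fix x assume "x \<in> count_events"
    then obtain P where P: "finite P" "x = count_event P" by (auto simp: count_events_def)
    note [measurable] = measurable_card_Ico0
    have "count_event P = {N \<in> space ring_space. \<forall>p\<in>P. card (N \<inter> {0..<fst p}) = snd p}"
      by (auto simp: count_event_def)
    also have "\<dots> \<in> sets ring_space" using P by measurable
    finally show "x \<in> sets ring_space" using P by simp
  qed
qed

text \<open>Independence of increments is given for infinite strictly increasing sequences only, so
  a finite set of times has to be embedded into one. Starting at 0 makes every count on
  \<open>{0..<t}\<close> a finite sum of cell counts.\<close>

lemma grid_exists:
  fixes T :: "real set"
  assumes "finite T" "T \<subseteq> {0..}"
  obtains \<tau> :: "nat \<Rightarrow> real" where "strict_mono \<tau>" "\<tau> 0 = 0" "T \<subseteq> range \<tau>"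
proof -
  define l where "l = sorted_list_of_set (insert 0 T)"
  \<comment> \<open>The values beyond the list only have to continue the sequence strictly
    increasingly.\<close>
  define \<tau> where "\<tau> i = (if i < length l then l ! i else last l + 1 + real i)" for i
  have l: "sorted l" "distinct l" "set l = insert 0 T" "l \<noteq> []"
    using assms unfolding l_def by (simp_all del: sorted_list_of_set_insert_remove)
  have "\<tau> i < \<tau> (Suc i)" for i
  proof (cases "Suc i < length l")
    case True
    have "sorted_wrt (<) l" using l by (simp add: strict_sorted_iff)
    from sorted_wrt_nth_less[OF this, of i "Suc i"] show ?thesis
      using True by (simp add: \<tau>_def)
  next
    case False
    have "last l = l ! (length l - 1)" using l by (simp add: last_conv_nth)
    moreover have "i = length l - 1" if "i < length l" using that False by simp
    ultimately show ?thesis using False by (simp add: \<tau>_def)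
  qed
  then have "strict_mono \<tau>" by (simp add: strict_mono_Suc_iff)
  moreover have "T \<subseteq> range \<tau>"
  proof
    fix t assume "t \<in> T"
    then obtain i where "i < length l" "t = l ! i" using l by (metis in_set_conv_nth insertCI)
    then show "t \<in> range \<tau>" by (auto simp: \<tau>_def intro!: image_eqI[where x = i])
  qed
  moreover have "\<tau> 0 = 0"
  proof -
    have "0 \<in> set l" using l by simp
    then obtain i where "i < length l" "l ! i = 0" by (metis in_set_conv_nth)
    then have "l ! 0 \<le> 0" using l sorted_nth_mono[of l 0 i] by simp
    moreover have "l ! 0 \<in> set l" using l(4) by (intro nth_mem) simp
    then have "0 \<le> l ! 0" using l assms by auto
    ultimately show ?thesis using l by (simp add: \<tau>_def)
  qed
  ultimately show ?thesis using that by blast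
qed

text \<open>A counting event may mention negative times; then \<open>{0..<t}\<close> is empty and
  the index 0 represents it, since \<open>\<tau> 0 = 0\<close>.\<close>

lemma grid_index:
  fixes \<tau> :: "nat \<Rightarrow> real"
  assumes "\<And>t. t \<in> T \<Longrightarrow> 0 \<le> t \<Longrightarrow> t \<in> range \<tau>" "\<tau> 0 = 0"
  shows "\<exists>r. \<forall>t\<in>T. {0..<t} = {0..<\<tau> (r t)}"
proof (rule bchoice, rule ballI)
  fix t assume t: "t \<in> T"
  show "\<exists>l. {0..<t} = {0..<\<tau> l}"
  proof (cases "0 \<le> t")
    case True
    then obtain l where "t = \<tau> l" using assms(1)[OF t] by (auto elim: rangeE)
    then show ?thesis by (metis refl)
  next
    case False
    then have "{0..<t} = {0..<\<tau> 0}" using assms by simp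
    then show ?thesis ..
  qed
qed

lemma strict_mono_cell_unique:
  fixes \<tau> :: "nat \<Rightarrow> real"
  assumes "strict_mono \<tau>" "x \<in> {\<tau> i..<\<tau> (Suc i)}" "x \<in> {\<tau> j..<\<tau> (Suc j)}"
  shows "i = j"
proof -
  have "\<not> i < j" "\<not> j < i"
    using assms strict_mono_less_eq[OF assms(1), of "Suc i" j] strict_mono_less_eq[OF assms(1), of "Suc j" i]
    by auto
  then show ?thesis by simp
qed

lemma strict_mono_cells:
  fixes \<tau> :: "nat \<Rightarrow> real"
  assumes "strict_mono \<tau>" "i \<le> j"
  shows "{\<tau> i..<\<tau> j} = (\<Union>l\<in>{i..<j}. {\<tau> l..<\<tau> (Suc l)})"
  using assms(2)
proof (induction j rule: dec_induct)
  case (step n)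
  have "\<tau> i \<le> \<tau> n" "\<tau> n \<le> \<tau> (Suc n)" using assms step by (simp_all add: strict_mono_less_eq)
  then have "{\<tau> i..<\<tau> (Suc n)} = {\<tau> i..<\<tau> n} \<union> {\<tau> n..<\<tau> (Suc n)}" by auto
  then show ?case using step by (auto simp: atLeastLessThanSuc)
qed simp

lemma card_cells:
  fixes \<tau> :: "nat \<Rightarrow> real"
  assumes "strict_mono \<tau>" "0 \<le> \<tau> 0" "finite I" "N \<in> ring_times"
  shows "card (N \<inter> (\<Union>i\<in>I. {\<tau> i..<\<tau> (Suc i)})) = (\<Sum>i\<in>I. card (N \<inter> {\<tau> i..<\<tau> (Suc i)}))"
proof -
  have "0 \<le> \<tau> i" for i using assms strict_mono_less_eq[OF assms(1), of 0 i] by simp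
  then have fin: "finite (N \<inter> {\<tau> i..<\<tau> (Suc i)})" for i
    using assms by (intro ring_times_finite_Ico) auto
  have "card (\<Union>i\<in>I. N \<inter> {\<tau> i..<\<tau> (Suc i)}) = (\<Sum>i\<in>I. card (N \<inter> {\<tau> i..<\<tau> (Suc i)}))"
  proof (rule card_UN_disjoint)
    show "\<forall>i\<in>I. \<forall>j\<in>I. i \<noteq> j \<longrightarrow> N \<inter> {\<tau> i..<\<tau> (Suc i)} \<inter> (N \<inter> {\<tau> j..<\<tau> (Suc j)}) = {}"
    proof (intro ballI impI equals0I)
      fix i j x assume "i \<noteq> j" "x \<in> N \<inter> {\<tau> i..<\<tau> (Suc i)} \<inter> (N \<inter> {\<tau> j..<\<tau> (Suc j)})"
      then show False using strict_mono_cell_unique[OF assms(1), of x i j] by blast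
    qed
    show "\<forall>i\<in>I. finite (N \<inter> {\<tau> i..<\<tau> (Suc i)})" using fin by blast
  qed fact
  moreover have "N \<inter> (\<Union>i\<in>I. {\<tau> i..<\<tau> (Suc i)}) = (\<Union>i\<in>I. N \<inter> {\<tau> i..<\<tau> (Suc i)})" by blast
  ultimately show ?thesis by (simp only:)
qed

section \<open>The law of a single clock\<close>

locale poisson_law = prob_space \<nu> for \<nu> :: "real set measure" +
  assumes sets_law [measurable_cong]: "sets \<nu> = sets ring_space"
    and poisson: "unit_poisson_process \<nu> (\<lambda>N. N)"
begin

lemma space_law: "space \<nu> = ring_times"
  using sets_eq_imp_space_eq[OF sets_law] by simp

lemma measurable_law: "f \<in> ring_space \<rightarrow>\<^sub>M M' \<Longrightarrow> f \<in> \<nu> \<rightarrow>\<^sub>M M'"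
  using measurable_cong_sets[OF sets_law refl] by blast

lemma prob_count:
  assumes "0 \<le> s" "s < t"
  shows "prob {N \<in> space \<nu>. card (N \<inter> {s..<t}) = k} = pmf (poisson_pmf (t - s)) k"
proof -
  have "pmf (poisson_pmf (t - s)) k =
      measure (distr \<nu> (count_space UNIV) (\<lambda>N. card (N \<inter> {s..<t}))) {k}"
    using poisson assms by (simp add: unit_poisson_process_def pmf.rep_eq)
  also have "\<dots> = prob ((\<lambda>N. card (N \<inter> {s..<t})) -` {k} \<inter> space \<nu>)"
    using assms by (intro measure_distr measurable_law measurable_card_Ico) auto
  also have "(\<lambda>N. card (N \<inter> {s..<t})) -` {k} \<inter> space \<nu> = {N \<in> space \<nu>. card (N \<inter> {s..<t}) = k}"
    by auto
  finally show ?thesis by simp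
qed

lemma indep_increments:
  assumes "strict_mono \<tau>" "0 \<le> \<tau> 0"
  shows "indep_vars (\<lambda>_. count_space UNIV) (\<lambda>i N. card (N \<inter> {\<tau> i..<\<tau> (Suc i)})) UNIV"
  using poisson assms by (simp add: unit_poisson_process_def)

lemma prob_counts:
  assumes \<tau>: "strict_mono \<tau>" "0 \<le> \<tau> 0" and I: "finite I"
  shows "prob {N \<in> space \<nu>. \<forall>i\<in>I. card (N \<inter> {\<tau> i..<\<tau> (Suc i)}) = k i} =
    (\<Prod>i\<in>I. pmf (poisson_pmf (\<tau> (Suc i) - \<tau> i)) (k i))"
proof (cases "I = {}")
  case True
  then show ?thesis using prob_space by simp
next
  case False
  have nn: "0 \<le> \<tau> i" "\<tau> i < \<tau> (Suc i)" for i
    using \<tau> strict_mono_less_eq[OF \<tau>(1), of 0 i] by (auto simp: strict_mono_less)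
  have "prob (\<Inter>i\<in>I. (\<lambda>N. card (N \<inter> {\<tau> i..<\<tau> (Suc i)})) -` {k i} \<inter> space \<nu>) =
      (\<Prod>i\<in>I. prob ((\<lambda>N. card (N \<inter> {\<tau> i..<\<tau> (Suc i)})) -` {k i} \<inter> space \<nu>))"
    using False I by (intro indep_varsD[OF indep_increments[OF \<tau>]]) auto
  moreover have "(\<lambda>N. card (N \<inter> {\<tau> i..<\<tau> (Suc i)})) -` {k i} \<inter> space \<nu> =
      {N \<in> space \<nu>. card (N \<inter> {\<tau> i..<\<tau> (Suc i)}) = k i}" for i by auto
  moreover have "(\<Inter>i\<in>I. {N \<in> space \<nu>. card (N \<inter> {\<tau> i..<\<tau> (Suc i)}) = k i}) =
      {N \<in> space \<nu>. \<forall>i\<in>I. card (N \<inter> {\<tau> i..<\<tau> (Suc i)}) = k i}" using False by auto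
  ultimately show ?thesis using prob_count[OF nn] by simp
qed

text \<open>Poisson weights are positive and multiply over disjoint cells. Hence any prescribed
  pattern of rings is available at positive cost.\<close>

lemma prob_counts_pos:
  assumes \<tau>: "strict_mono \<tau>" "0 \<le> \<tau> 0" and I: "finite I"
  shows "0 < prob {N \<in> space \<nu>. \<forall>i\<in>I. card (N \<inter> {\<tau> i..<\<tau> (Suc i)}) = k i}"
proof -
  have "0 < \<tau> (Suc i) - \<tau> i" for i using \<tau> by (simp add: strict_mono_less)
  then have "0 < pmf (poisson_pmf (\<tau> (Suc i) - \<tau> i)) (k i)" for i
    by (simp add: less_imp_le)
  then show ?thesis unfolding prob_counts[OF assms] by (intro prod_pos) auto
qed

text \<open>From 1 - exp (-x) \<le> x. A bound linear in the length makes a short window silent with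
  probability close to 1.\<close>

lemma prob_ring_Ico_le:
  assumes "0 \<le> s" "s < t"
  shows "prob {N \<in> space \<nu>. N \<inter> {s..<t} \<noteq> {}} \<le> t - s"
proof -
  note [measurable] = measurable_law[OF measurable_card_Ico[OF assms(1), of t]]
  have "{N \<in> space \<nu>. N \<inter> {s..<t} \<noteq> {}} = space \<nu> - {N \<in> space \<nu>. card (N \<inter> {s..<t}) = 0}"
  proof -
    have "N \<inter> {s..<t} \<noteq> {} \<longleftrightarrow> card (N \<inter> {s..<t}) \<noteq> 0" if "N \<in> space \<nu>" for N
      using that ring_times_finite_Ico[of N s t] assms(1) by (simp add: space_law card_eq_0_iff)
    then show ?thesis by blast
  qed
  moreover have "{N \<in> space \<nu>. card (N \<inter> {s..<t}) = 0} \<in> sets \<nu>" by measurable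
  ultimately have "prob {N \<in> space \<nu>. N \<inter> {s..<t} \<noteq> {}} = 1 - pmf (poisson_pmf (t - s)) 0"
    using prob_count[OF assms] by (simp add: prob_compl)
  also have "\<dots> = 1 - exp (- (t - s))" using assms by simp
  also have "\<dots> \<le> t - s" using exp_ge_add_one_self[of "s - t"] by (simp add: algebra_simps)
  finally show ?thesis .
qed

lemma grid_counts:
  assumes \<tau>: "strict_mono \<tau>" "\<tau> 0 = 0" and N: "N \<in> ring_times"
  shows "card (N \<inter> {0..<\<tau> j}) = (\<Sum>i<j. card (N \<inter> {\<tau> i..<\<tau> (Suc i)}))"
  using card_cells[OF \<tau>(1) _ _ N, of "{..<j}"] strict_mono_cells[OF \<tau>(1), of 0 j] \<tau>(2)
  by (simp add: lessThan_atLeast0)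

text \<open>On a grid that refines \<open>c\<close> and contains the times of a counting event, the
  erased configuration depends on the cells outside the window and \<open>H\<close> on those inside,
  and the two families are independent. Both sides are finite measures in \<open>A\<close>, so
  agreement on counting events suffices.\<close>

lemma prob_Diff_counts:
  fixes k :: "nat \<Rightarrow> nat" and m :: nat
  assumes c: "strict_mono c" "0 \<le> c 0" and A: "A \<in> sets ring_space"
  defines "H \<equiv> {N \<in> space \<nu>. \<forall>i\<le>m. card (N \<inter> {c i..<c (Suc i)}) = k i}"
    and "f \<equiv> \<lambda>N. N - {c 0..<c (Suc m)}"
  shows "prob ({N \<in> space \<nu>. f N \<in> A} \<inter> H) = prob {N \<in> space \<nu>. f N \<in> A} * prob H"
proof -
  have c0: "0 \<le> c i" for i using c strict_mono_less_eq[OF c(1), of 0 i] by simp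
  have cm: "c i \<le> c j" if "i \<le> j" for i j using that c by (simp add: strict_mono_less_eq)
  have [measurable]: "f \<in> \<nu> \<rightarrow>\<^sub>M ring_space"
    unfolding f_def by (intro measurable_law measurable_Diff_Ico c)
  note [measurable] = measurable_law[OF measurable_card_Ico[OF c0]]
  have H [measurable]: "H \<in> sets \<nu>" unfolding H_def by measurable
  have gen: "prob ({N \<in> space \<nu>. f N \<in> count_event P} \<inter> H) =
      prob {N \<in> space \<nu>. f N \<in> count_event P} * prob H" if P: "finite P" for P
  proof -
    have "finite ({t \<in> fst ` P. 0 \<le> t} \<union> c ` {..Suc m})" using P by simp
    moreover have "{t \<in> fst ` P. 0 \<le> t} \<union> c ` {..Suc m} \<subseteq> {0..}" using c0 by auto
    ultimately obtain \<tau> :: "nat \<Rightarrow> real" where \<tau>: "strict_mono \<tau>" "\<tau> 0 = 0"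
      and range: "{t \<in> fst ` P. 0 \<le> t} \<union> c ` {..Suc m} \<subseteq> range \<tau>"
      by (rule grid_exists)
    have "\<exists>j. \<forall>i\<le>Suc m. c i = \<tau> (j i)"
    proof -
      have "\<forall>i. \<exists>l. i \<le> Suc m \<longrightarrow> c i = \<tau> l" using range by auto
      then show ?thesis by metis
    qed
    then obtain j where j: "\<And>i. i \<le> Suc m \<Longrightarrow> c i = \<tau> (j i)" by auto
    have "\<exists>r. \<forall>t\<in>fst ` P. {0..<t} = {0..<\<tau> (r t)}"
      by (rule grid_index[of _ \<tau>, OF _ \<tau>(2)], rule subsetD[OF range]) simp
    then obtain r where r: "\<And>t. t \<in> fst ` P \<Longrightarrow> {0..<t} = {0..<\<tau> (r t)}" by auto
    \<comment> \<open>The indices of the cells of the refined grid that make up the window.\<close>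
    define I where "I = {j 0..<j (Suc m)}"
    define X where "X i N = card (N \<inter> {\<tau> i..<\<tau> (Suc i)})" for i and N :: "real set"
    have jm: "j i \<le> j i'" if "i \<le> i'" "i' \<le> Suc m" for i i'
      using cm[OF that(1)] j that strict_mono_less_eq[OF \<tau>(1)] by simp
    have cell_in: "{\<tau> i..<\<tau> (Suc i)} \<subseteq> {c 0..<c (Suc m)}" if "i \<in> I" for i
    proof -
      have "\<tau> (j 0) \<le> \<tau> i" "\<tau> (Suc i) \<le> \<tau> (j (Suc m))"
        using that strict_mono_less_eq[OF \<tau>(1)] by (auto simp: I_def)
      then show ?thesis using j[of 0] j[of "Suc m"] by auto
    qed
    have cell_out: "{\<tau> i..<\<tau> (Suc i)} \<inter> {c 0..<c (Suc m)} = {}" if "i \<notin> I" for i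
    proof -
      have "\<tau> (Suc i) \<le> \<tau> (j 0) \<or> \<tau> (j (Suc m)) \<le> \<tau> i"
        using that strict_mono_less_eq[OF \<tau>(1)] by (auto simp: I_def)
      then show ?thesis using j[of 0] j[of "Suc m"] by auto
    qed
    have "indep_vars (\<lambda>_. count_space UNIV) X UNIV"
      unfolding X_def using \<tau> by (intro indep_increments) auto
    then have ind: "indep_var (PiM (- I) (\<lambda>_. count_space UNIV)) (\<lambda>N. \<lambda>i\<in>- I. X i N)
        (PiM I (\<lambda>_. count_space UNIV)) (\<lambda>N. \<lambda>i\<in>I. X i N)"
      by (rule indep_var_restrict) auto
    \<comment> \<open>\<open>B\<close> and \<open>C\<close> express the two events through the cell
      counts with indices in \<open>- I\<close> and in \<open>I\<close>.\<close>
    define B where "B = {x \<in> space (PiM (- I) (\<lambda>_. count_space UNIV)).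
        \<forall>p\<in>P. (\<Sum>i\<in>{..<r (fst p)} - I. x i) = snd p}"
    define C where "C = {x \<in> space (PiM I (\<lambda>_. count_space UNIV)).
        \<forall>i\<le>m. (\<Sum>l\<in>{j i..<j (Suc i)}. x l) = k i}"
    have B: "B \<in> sets (PiM (- I) (\<lambda>_. count_space UNIV))"
    proof -
      have "(\<lambda>x. \<Sum>i\<in>{..<r (fst p)} - I. x i) \<in> PiM (- I) (\<lambda>_. count_space UNIV) \<rightarrow>\<^sub>M (count_space UNIV :: nat measure)" for p
        by (intro measurable_sum_nat measurable_component_singleton) auto
      note [measurable] = this
      show ?thesis unfolding B_def using P by measurable
    qed
    have C: "C \<in> sets (PiM I (\<lambda>_. count_space UNIV))"
    proof -
      have "(\<lambda>x. \<Sum>l\<in>{j i..<j (Suc i)}. x l) \<in> PiM I (\<lambda>_. count_space UNIV) \<rightarrow>\<^sub>M (count_space UNIV :: nat measure)" if "i \<le> m" for i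
        using jm[of 0 i] jm[of "Suc i" "Suc m"] that
        by (intro measurable_sum_nat measurable_component_singleton) (auto simp: I_def)
      note [measurable] = this
      show ?thesis unfolding C_def by measurable
    qed
    have 1: "{N \<in> space \<nu>. f N \<in> count_event P} = (\<lambda>N. \<lambda>i\<in>- I. X i N) -` B \<inter> space \<nu>"
    proof -
      have "card (f N \<inter> {0..<fst p}) = (\<Sum>i\<in>{..<r (fst p)} - I. X i N)"
        if N: "N \<in> ring_times" and p: "p \<in> P" for N p
      proof -
        let ?r = "r (fst p)"
        have "{0..<fst p} = {\<tau> 0..<\<tau> ?r}" using r[of "fst p"] p \<tau> by simp
        also have "\<dots> = (\<Union>l\<in>{0..<?r}. {\<tau> l..<\<tau> (Suc l)})" by (rule strict_mono_cells[OF \<tau>(1)]) simp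
        finally have "{0..<fst p} - {c 0..<c (Suc m)} =
            (\<Union>l\<in>{0..<?r}. {\<tau> l..<\<tau> (Suc l)}) - {c 0..<c (Suc m)}" by simp
        also have "\<dots> = (\<Union>l\<in>{..<?r} - I. {\<tau> l..<\<tau> (Suc l)})"
        proof (rule Set.set_eqI)
          fix x
          show "x \<in> (\<Union>l\<in>{0..<?r}. {\<tau> l..<\<tau> (Suc l)}) - {c 0..<c (Suc m)} \<longleftrightarrow>
              x \<in> (\<Union>l\<in>{..<?r} - I. {\<tau> l..<\<tau> (Suc l)})"
            using cell_in cell_out unfolding lessThan_atLeast0 by blast
        qed
        finally have "f N \<inter> {0..<fst p} = N \<inter> (\<Union>l\<in>{..<?r} - I. {\<tau> l..<\<tau> (Suc l)})"
          unfolding f_def by blast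
        then show ?thesis using card_cells[OF \<tau>(1) _ _ N] \<tau>(2) by (simp add: X_def)
      qed
      then show ?thesis
        by (auto simp: B_def count_event_def space_law space_PiM f_def ring_times_Diff split_beta)
    qed
    have 2: "H = (\<lambda>N. \<lambda>i\<in>I. X i N) -` C \<inter> space \<nu>"
    proof -
      have "card (N \<inter> {c i..<c (Suc i)}) = (\<Sum>l\<in>{j i..<j (Suc i)}. (\<lambda>i\<in>I. X i N) l)"
        if N: "N \<in> ring_times" and i: "i \<le> m" for N i
      proof -
        have "{c i..<c (Suc i)} = (\<Union>l\<in>{j i..<j (Suc i)}. {\<tau> l..<\<tau> (Suc l)})"
          using j[of i] j[of "Suc i"] i strict_mono_cells[OF \<tau>(1) jm[of i "Suc i"]] by simp
        then have "card (N \<inter> {c i..<c (Suc i)}) = (\<Sum>l\<in>{j i..<j (Suc i)}. X l N)"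
          using card_cells[OF \<tau>(1) _ _ N] \<tau>(2) by (simp add: X_def)
        also have "\<dots> = (\<Sum>l\<in>{j i..<j (Suc i)}. (\<lambda>i\<in>I. X i N) l)"
          using i jm[of 0 i] jm[of "Suc i" "Suc m"] by (intro sum.cong) (auto simp: I_def)
        finally show ?thesis .
      qed
      then show ?thesis by (auto simp: C_def H_def space_law space_PiM)
    qed
    have "(\<lambda>N. (\<lambda>i\<in>- I. X i N, \<lambda>i\<in>I. X i N)) -` (B \<times> C) \<inter> space \<nu> =
        ((\<lambda>N. \<lambda>i\<in>- I. X i N) -` B \<inter> space \<nu>) \<inter> ((\<lambda>N. \<lambda>i\<in>I. X i N) -` C \<inter> space \<nu>)"
      by auto
    then show ?thesis unfolding 1 2 using indep_varD[OF ind B C] by simp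
  qed
  \<comment> \<open>As functions of \<open>A\<close>, the two sides are the image under
    \<open>f\<close> of \<nu> restricted to \<open>H\<close>, and a multiple of the image of
    \<nu>.\<close>
  define M1 where "M1 = distr (density \<nu> (indicator H)) ring_space f"
  define M2 where "M2 = scale_measure (prob H) (distr \<nu> ring_space f)"
  have e1: "emeasure M1 Y = prob ({N \<in> space \<nu>. f N \<in> Y} \<inter> H)" if "Y \<in> sets ring_space" for Y
  proof -
    have "emeasure M1 Y = emeasure (density \<nu> (indicator H)) (f -` Y \<inter> space \<nu>)"
      using that unfolding M1_def by (subst emeasure_distr) auto
    also have "\<dots> = emeasure \<nu> (H \<inter> (f -` Y \<inter> space \<nu>))"
      using that by (intro emeasure_restricted) measurable
    also have "H \<inter> (f -` Y \<inter> space \<nu>) = {N \<in> space \<nu>. f N \<in> Y} \<inter> H" by auto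
    finally show ?thesis by (simp add: emeasure_eq_measure)
  qed
  have e2: "emeasure M2 Y = prob {N \<in> space \<nu>. f N \<in> Y} * prob H" if "Y \<in> sets ring_space" for Y
  proof -
    have "emeasure M2 Y = prob H * emeasure \<nu> (f -` Y \<inter> space \<nu>)"
      using that unfolding M2_def by (simp add: emeasure_distr)
    also have "f -` Y \<inter> space \<nu> = {N \<in> space \<nu>. f N \<in> Y}" by auto
    finally show ?thesis by (simp add: emeasure_eq_measure ennreal_mult mult.commute)
  qed
  have "M1 = M2"
  proof (rule measure_eqI_generator_eq[where A = "\<lambda>_. ring_times", OF Int_stable_count_events])
    show "count_events \<subseteq> Pow ring_times" by (auto simp: count_events_def count_event_def)
    show "sets M1 = sigma_sets ring_times count_events" "sets M2 = sigma_sets ring_times count_events"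
      by (simp_all add: M1_def M2_def sets_ring_space_count_events)
    have "count_event {} = ring_times" by (simp add: count_event_def)
    then show "range (\<lambda>_. ring_times) \<subseteq> count_events" by (auto simp: count_events_def)
    fix Y assume "Y \<in> count_events"
    moreover then have "Y \<in> sets ring_space" by (simp add: sets_ring_space_count_events)
    ultimately show "emeasure M1 Y = emeasure M2 Y" using e1 e2 gen by (auto simp: count_events_def)
  next
    show "emeasure M1 ring_times \<noteq> \<infinity>"
      using e1[OF sets.top[of ring_space, simplified]] by simp
  qed auto
  then show ?thesis using e1[OF A] e2[OF A] by (simp add: ennreal_inj measure_nonneg)
qed

end

text \<open>The cell counts along a grid are independent Poisson variables, which fixes the
  probability of every counting event. Uniqueness gives all clocks one common law, so that the group
  merely permutes identical factors of a product.\<close>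

lemma poisson_law_unique:
  assumes "poisson_law \<nu>" "poisson_law \<nu>'"
  shows "\<nu> = \<nu>'"
proof -
  interpret P: poisson_law \<nu> by fact
  interpret Q: poisson_law \<nu>' by fact
  show ?thesis
  proof (rule measure_eqI_generator_eq[where A = "\<lambda>_. ring_times", OF Int_stable_count_events])
    show "count_events \<subseteq> Pow ring_times" by (auto simp: count_events_def count_event_def)
    show "sets \<nu> = sigma_sets ring_times count_events" "sets \<nu>' = sigma_sets ring_times count_events"
      by (simp_all add: P.sets_law Q.sets_law sets_ring_space_count_events)
    have "count_event {} = ring_times" by (simp add: count_event_def)
    then show "range (\<lambda>_. ring_times) \<subseteq> count_events" by (auto simp: count_events_def)
    fix Y assume Y: "Y \<in> count_events"
    then have sets: "Y \<in> sets ring_space" by (simp add: sets_ring_space_count_events)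
    from Y obtain P where P: "finite P" "Y = count_event P" by (auto simp: count_events_def)
    have "finite {t \<in> fst ` P. 0 \<le> t}" using P by simp
    then obtain \<tau> :: "nat \<Rightarrow> real" where \<tau>: "strict_mono \<tau>" "\<tau> 0 = 0"
      and range: "{t \<in> fst ` P. 0 \<le> t} \<subseteq> range \<tau>"
      by (rule grid_exists) auto
    have "\<exists>r. \<forall>t\<in>fst ` P. {0..<t} = {0..<\<tau> (r t)}"
      by (rule grid_index[of _ \<tau>, OF _ \<tau>(2)], rule subsetD[OF range]) simp
    then obtain r where r: "\<And>t. t \<in> fst ` P \<Longrightarrow> {0..<t} = {0..<\<tau> (r t)}" by auto
    define X where "X i N = card (N \<inter> {\<tau> i..<\<tau> (Suc i)})" for i and N :: "real set"
    define B where "B = {x \<in> space (PiM UNIV (\<lambda>_. count_space UNIV)).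
        \<forall>p\<in>P. (\<Sum>i<r (fst p). x i) = snd p}"
    have B: "B \<in> sets (PiM UNIV (\<lambda>_. count_space UNIV))"
    proof -
      have "(\<lambda>x. \<Sum>i<r (fst p). x i) \<in> PiM UNIV (\<lambda>_. count_space UNIV) \<rightarrow>\<^sub>M (count_space UNIV :: nat measure)" for p
        by (intro measurable_sum_nat measurable_component_singleton) auto
      note [measurable] = this
      show ?thesis unfolding B_def using P by measurable
    qed
    have Yeq: "Y = {N \<in> ring_times. (\<lambda>i. X i N) \<in> B}"
    proof -
      have "card (N \<inter> {0..<fst p}) = (\<Sum>i<r (fst p). X i N)" if "N \<in> ring_times" "p \<in> P" for N p
        using P.grid_counts[OF \<tau> that(1), of "r (fst p)"] r[of "fst p"] that by (simp add: X_def)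
      then show ?thesis by (auto simp: P B_def count_event_def space_PiM split_beta)
    qed
    have law: "emeasure \<kappa> Y =
        emeasure (PiM UNIV (\<lambda>i. measure_pmf (poisson_pmf (\<tau> (Suc i) - \<tau> i)))) B"
      if "poisson_law \<kappa>" for \<kappa>
    proof -
      interpret K: poisson_law \<kappa> by fact
      have nn: "0 \<le> \<tau> i" "\<tau> i < \<tau> (Suc i)" for i
        using \<tau> strict_mono_less_eq[OF \<tau>(1), of 0 i] by (auto simp: strict_mono_less)
      have rv: "X i \<in> \<kappa> \<rightarrow>\<^sub>M count_space UNIV" for i
        unfolding X_def by (intro K.measurable_law measurable_card_Ico nn)
      have "K.indep_vars (\<lambda>_. count_space UNIV) X UNIV"
        unfolding X_def using \<tau> by (intro K.indep_increments) auto
      then have "distr \<kappa> (PiM UNIV (\<lambda>_. count_space UNIV)) (\<lambda>N. \<lambda>i\<in>UNIV. X i N) =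
          PiM UNIV (\<lambda>i. distr \<kappa> (count_space UNIV) (X i))"
        using K.indep_vars_iff_distr_eq_PiM[where I = UNIV and M' = "\<lambda>_. count_space UNIV" and X = X] rv by simp
      also have "\<dots> = PiM UNIV (\<lambda>i. measure_pmf (poisson_pmf (\<tau> (Suc i) - \<tau> i)))"
        using K.poisson nn by (simp add: unit_poisson_process_def X_def[abs_def])
      finally have d: "distr \<kappa> (PiM UNIV (\<lambda>_. count_space UNIV)) (\<lambda>N i. X i N) = \<dots>"
        by (simp add: restrict_def)
      have "emeasure (distr \<kappa> (PiM UNIV (\<lambda>_. count_space UNIV)) (\<lambda>N i. X i N)) B =
          emeasure \<kappa> ((\<lambda>N i. X i N) -` B \<inter> space \<kappa>)"
        using rv B by (intro emeasure_distr measurable_PiM_single') (auto simp: space_PiM)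
      also have "(\<lambda>N i. X i N) -` B \<inter> space \<kappa> = Y" by (auto simp: Yeq K.space_law)
      finally show ?thesis using d by simp
    qed
    show "emeasure \<nu> Y = emeasure \<nu>' Y" using law[OF assms(1)] law[OF assms(2)] by simp
  next
    show "emeasure \<nu> ring_times \<noteq> \<infinity>" by simp
  qed auto
qed

section \<open>Products of clocks\<close>

context product_prob_space
begin

abbreviation \<mu> :: "('i \<Rightarrow> 'a) measure" where "\<mu> \<equiv> Pi\<^sub>M I M"

definition cylinder_approximable :: "('i \<Rightarrow> 'a) set \<Rightarrow> bool" where
  "cylinder_approximable X \<longleftrightarrow> (\<forall>\<epsilon>>0. \<exists>F Y. finite F \<and> F \<subseteq> I \<and> Y \<in> sets (Pi\<^sub>M F M) \<and>
     measure \<mu> (sym_diff X (emb I F Y)) < \<epsilon>)"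

lemma cylinder_approximableE:
  assumes "cylinder_approximable X" "0 < \<epsilon>"
  obtains F Y where "finite F" "F \<subseteq> I" "Y \<in> sets (Pi\<^sub>M F M)"
    "measure \<mu> (sym_diff X (emb I F Y)) < \<epsilon>"
  using assms unfolding cylinder_approximable_def by metis

lemma emb_restrict:
  assumes "F \<subseteq> I" "x \<in> space \<mu>"
  shows "x \<in> emb I F Y \<longleftrightarrow> restrict x F \<in> Y"
  using assms by (auto simp: prod_emb_iff space_PiM PiE_iff)

lemma sets_emb: "F \<subseteq> I \<Longrightarrow> Y \<in> sets (Pi\<^sub>M F M) \<Longrightarrow> emb I F Y \<in> sets \<mu>"
  by (rule measurable_prod_emb)

lemma cylinder_approximable_Compl:
  assumes "X \<in> sets \<mu>" "cylinder_approximable X"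
  shows "cylinder_approximable (space \<mu> - X)"
  unfolding cylinder_approximable_def
proof (intro allI impI)
  fix \<epsilon> :: real assume "0 < \<epsilon>"
  then obtain F Y where F: "finite F" "F \<subseteq> I" "Y \<in> sets (Pi\<^sub>M F M)"
    "measure \<mu> (sym_diff X (emb I F Y)) < \<epsilon>"
    using assms by (auto elim: cylinder_approximableE)
  have "x \<in> emb I F (space (Pi\<^sub>M F M) - Y) \<longleftrightarrow> x \<in> space \<mu> \<and> x \<notin> emb I F Y" for x
    using F(2) by (auto simp: prod_emb_iff space_PiM PiE_iff)
  moreover have "X \<subseteq> space \<mu>" "emb I F Y \<subseteq> space \<mu>"
    using sets.sets_into_space[OF assms(1)] sets.sets_into_space[OF sets_emb[OF F(2,3)]] by auto
  ultimately have "sym_diff (space \<mu> - X) (emb I F (space (Pi\<^sub>M F M) - Y)) = sym_diff X (emb I F Y)"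
    by blast
  then show "\<exists>F Y. finite F \<and> F \<subseteq> I \<and> Y \<in> sets (Pi\<^sub>M F M) \<and>
      measure \<mu> (sym_diff (space \<mu> - X) (emb I F Y)) < \<epsilon>"
    using F by (intro exI[of _ F] exI[of _ "space (Pi\<^sub>M F M) - Y"]) auto
qed

lemma cylinder_approximable_UN:
  fixes A :: "nat \<Rightarrow> ('i \<Rightarrow> 'a) set"
  assumes A: "\<And>i. A i \<in> sets \<mu>" and approx: "\<And>i. cylinder_approximable (A i)"
  shows "cylinder_approximable (\<Union>i. A i)"
  unfolding cylinder_approximable_def
proof (intro allI impI)
  fix \<epsilon> :: real assume \<epsilon>: "0 < \<epsilon>"
  \<comment> \<open>The union is cut off at an index n after which it gains less than
    \<open>\<epsilon> / 2\<close>; the other half of \<epsilon> is shared by the n + 1 remaining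
    sets.\<close>
  have "(\<lambda>n. measure \<mu> (\<Union>i\<le>n. A i)) \<longlonglongrightarrow> measure \<mu> (\<Union>n. \<Union>i\<le>n. A i)"
    using A by (intro P.finite_Lim_measure_incseq) (auto simp: incseq_def, force)
  also have "(\<Union>n. \<Union>i\<le>n. A i) = (\<Union>i. A i)" by auto
  finally have "\<forall>\<^sub>F n in sequentially. measure \<mu> (\<Union>i. A i) - \<epsilon> / 2 < measure \<mu> (\<Union>i\<le>n. A i)"
    using \<epsilon> by (intro order_tendstoD(1)) auto
  then obtain n where n: "measure \<mu> (\<Union>i. A i) - \<epsilon> / 2 < measure \<mu> (\<Union>i\<le>n. A i)"
    by (auto simp: eventually_sequentially)
  have "measure \<mu> ((\<Union>i. A i) - (\<Union>i\<le>n. A i)) = measure \<mu> (\<Union>i. A i) - measure \<mu> (\<Union>i\<le>n. A i)"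
    using A by (intro P.finite_measure_Diff) auto
  then have tail: "measure \<mu> ((\<Union>i. A i) - (\<Union>i\<le>n. A i)) < \<epsilon> / 2" using n by simp
  have pos: "0 < \<epsilon> / (2 * (real n + 1))" using \<epsilon> by simp
  have "\<forall>i. \<exists>F Y. finite F \<and> F \<subseteq> I \<and> Y \<in> sets (Pi\<^sub>M F M) \<and>
      measure \<mu> (sym_diff (A i) (emb I F Y)) < \<epsilon> / (2 * (real n + 1))"
    using approx pos unfolding cylinder_approximable_def by blast
  then obtain F Y where F: "\<And>i. finite (F i)" "\<And>i. F i \<subseteq> I" "\<And>i. Y i \<in> sets (Pi\<^sub>M (F i) M)"
    and small: "\<And>i. measure \<mu> (sym_diff (A i) (emb I (F i) (Y i))) < \<epsilon> / (2 * (real n + 1))"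
    by metis
  \<comment> \<open>A common finite index set, over which the union of the n + 1 cylinders is again
    a cylinder.\<close>
  define F' where "F' = (\<Union>i\<le>n. F i)"
  define Y' where "Y' = (\<Union>i\<le>n. emb F' (F i) (Y i))"
  have F': "finite F'" "F' \<subseteq> I" using F by (auto simp: F'_def)
  have Y': "Y' \<in> sets (Pi\<^sub>M F' M)"
    unfolding Y'_def using F by (intro sets.finite_UN measurable_prod_emb) (auto simp: F'_def)
  have "emb I F' Y' = (\<Union>i\<le>n. emb I F' (emb F' (F i) (Y i)))"
    by (auto simp: Y'_def prod_emb_def)
  also have "\<dots> = (\<Union>i\<le>n. emb I (F i) (Y i))"
    using F' by (intro SUP_cong refl prod_emb_trans) (auto simp: F'_def)
  finally have emb: "emb I F' Y' = (\<Union>i\<le>n. emb I (F i) (Y i))" .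
  have meas: "emb I (F i) (Y i) \<in> sets \<mu>" for i using F by (intro sets_emb)
  have "measure \<mu> (sym_diff (\<Union>i. A i) (emb I F' Y')) \<le>
      measure \<mu> (((\<Union>i. A i) - (\<Union>i\<le>n. A i)) \<union> (\<Union>i\<le>n. sym_diff (A i) (emb I (F i) (Y i))))"
    unfolding emb using A meas by (intro P.finite_measure_mono) auto
  also have "\<dots> \<le> measure \<mu> ((\<Union>i. A i) - (\<Union>i\<le>n. A i)) +
      measure \<mu> (\<Union>i\<le>n. sym_diff (A i) (emb I (F i) (Y i)))"
    using A meas by (intro measure_Un_le) auto
  also have "measure \<mu> (\<Union>i\<le>n. sym_diff (A i) (emb I (F i) (Y i))) \<le>
      (\<Sum>i\<le>n. measure \<mu> (sym_diff (A i) (emb I (F i) (Y i))))"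
    using A meas by (intro measure_UNION_le) auto
  also have "\<dots> \<le> (\<Sum>i\<le>n. \<epsilon> / (2 * (real n + 1)))"
    using small by (intro sum_mono less_imp_le)
  also have "\<dots> = \<epsilon> / 2" by (simp add: field_simps)
  finally have "measure \<mu> (sym_diff (\<Union>i. A i) (emb I F' Y')) < \<epsilon>" using tail by simp
  then show "\<exists>F Y. finite F \<and> F \<subseteq> I \<and> Y \<in> sets (Pi\<^sub>M F M) \<and>
      measure \<mu> (sym_diff (\<Union>i. A i) (emb I F Y)) < \<epsilon>"
    using F' Y' by blast
qed

text \<open>The approximable events contain the generating boxes and are closed under complements
  and countable unions.\<close>

lemma cylinder_approximable_sets: "X \<in> sets \<mu> \<Longrightarrow> cylinder_approximable X"
proof -
  assume "X \<in> sets \<mu>"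
  then have "X \<in> sigma_sets (\<Pi>\<^sub>E i\<in>I. space (M i)) (prod_algebra I M)" by (simp add: sets_PiM)
  then show ?thesis
  proof induction
    case (Basic a)
    then obtain J E where J: "a = emb I J (Pi\<^sub>E J E)" "finite J" "J \<subseteq> I" "\<And>i. i \<in> J \<Longrightarrow> E i \<in> sets (M i)"
      by (rule prod_algebraE) blast
    then have "Pi\<^sub>E J E \<in> sets (Pi\<^sub>M J M)" by (intro sets_PiM_I_finite) auto
    with J show ?case unfolding cylinder_approximable_def
      by (intro allI impI exI[of _ J] exI[of _ "Pi\<^sub>E J E"]) auto
  next
    case Empty
    show ?case unfolding cylinder_approximable_def
      by (intro allI impI exI[of _ "{}"]) (auto intro!: exI[of _ "{}"])
  next
    case (Compl a)
    then show ?case using cylinder_approximable_Compl[of a] by (simp add: sets_PiM space_PiM)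
  next
    case (Union a)
    then show ?case by (intro cylinder_approximable_UN) (auto simp: sets_PiM)
  qed
qed

text \<open>Coordinates are independent under a product measure, hence so are two disjoint groups of
  them.\<close>

lemma prob_emb_disjoint:
  assumes I: "I \<noteq> {}" and F: "F \<subseteq> I" "F' \<subseteq> I" "F \<inter> F' = {}"
    and Y: "Y \<in> sets (Pi\<^sub>M F M)" "Y' \<in> sets (Pi\<^sub>M F' M)"
  shows "measure \<mu> (emb I F Y \<inter> emb I F' Y') = measure \<mu> (emb I F Y) * measure \<mu> (emb I F' Y')"
proof -
  have "distr \<mu> \<mu> (\<lambda>x. \<lambda>i\<in>I. x i) = distr \<mu> \<mu> (\<lambda>x. x)"
    by (intro distr_cong refl) (auto simp: space_PiM PiE_iff extensional_restrict)
  also have "\<dots> = \<mu>" by (rule distr_id)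
  also have "\<dots> = Pi\<^sub>M I (\<lambda>i. distr \<mu> (M i) (\<lambda>x. x i))"
    by (intro PiM_cong refl PiM_component[symmetric])
  finally have "P.indep_vars M (\<lambda>i x. x i) I"
    using I by (subst P.indep_vars_iff_distr_eq_PiM') auto
  from P.indep_var_restrict[OF this F(3,1,2)]
  have ind: "P.indep_var (Pi\<^sub>M F M) (\<lambda>x. \<lambda>i\<in>F. x i) (Pi\<^sub>M F' M) (\<lambda>x. \<lambda>i\<in>F'. x i)" .
  have emb: "emb I J Z = (\<lambda>x. \<lambda>i\<in>J. x i) -` Z \<inter> space \<mu>" for J Z
    by (simp add: prod_emb_def space_PiM)
  have "(\<lambda>x. (\<lambda>i\<in>F. x i, \<lambda>i\<in>F'. x i)) -` (Y \<times> Y') \<inter> space \<mu> = emb I F Y \<inter> emb I F' Y'"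
    by (auto simp: emb)
  then show ?thesis using P.indep_varD[OF ind Y] by (simp add: emb)
qed

end

text \<open>Insertion tolerance of the clocks, in the form of erasure: the configuration with
  emptied window is independent of the counts in the window, so prescribing these costs a factor
  \<open>measure \<mu> H\<close> that is the same for all \<open>X\<close>. On boxes this splits
  into the statement for one clock, and boxes determine a finite measure.\<close>

lemma prob_erase_counts:
  fixes E :: "'e set" and k :: "'e \<Rightarrow> nat \<Rightarrow> nat" and m :: nat
  assumes "poisson_law \<nu>" and K: "finite K" "K \<subseteq> E"
    and c: "strict_mono c" "0 \<le> c 0" and X: "X \<in> sets (Pi\<^sub>M E (\<lambda>_. ring_space))"
  defines "\<mu> \<equiv> Pi\<^sub>M E (\<lambda>_. \<nu>)"
    and "H \<equiv> {\<psi> \<in> space (Pi\<^sub>M E (\<lambda>_. \<nu>)). \<forall>e\<in>K. \<forall>i\<le>m. card (\<psi> e \<inter> {c i..<c (Suc i)}) = k e i}"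
    and "R \<equiv> \<lambda>\<psi>. \<lambda>e\<in>E. if e \<in> K then \<psi> e - {c 0..<c (Suc m)} else \<psi> e"
  shows "measure \<mu> ({\<psi> \<in> space \<mu>. R \<psi> \<in> X} \<inter> H) = measure \<mu> {\<psi> \<in> space \<mu>. R \<psi> \<in> X} * measure \<mu> H"
    and "0 < measure \<mu> H" and "H \<in> sets \<mu>"
    and "R \<in> \<mu> \<rightarrow>\<^sub>M \<mu>"
proof -
  interpret N: poisson_law \<nu> by fact
  interpret product_prob_space "\<lambda>_. \<nu>" E by unfold_locales
  have c0: "0 \<le> c i" for i using c strict_mono_less_eq[OF c(1), of 0 i] by simp
  note [measurable] = N.measurable_law[OF measurable_card_Ico[OF c0]]
  have diff [measurable]: "(\<lambda>N. N - {c 0..<c (Suc m)}) \<in> \<nu> \<rightarrow>\<^sub>M \<nu>"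
    using N.measurable_law[OF measurable_Diff_Ico[OF c(2)]] measurable_cong_sets[OF refl N.sets_law] by blast
  define He where "He e = {N \<in> space \<nu>. \<forall>i\<le>m. card (N \<inter> {c i..<c (Suc i)}) = k e i}" for e
  have He [measurable]: "He e \<in> sets \<nu>" for e unfolding He_def by measurable
  have H_alt: "H = {\<psi> \<in> space \<mu>. \<forall>e\<in>K. \<psi> e \<in> He e}"
    using K(2) by (auto simp: H_def He_def \<mu>_def space_PiM)
  have prob_H: "measure \<mu> {\<psi> \<in> space \<mu>. \<forall>e\<in>J. \<psi> e \<in> B e} = (\<Prod>e\<in>J. measure \<nu> (B e))"
    if "finite J" "J \<subseteq> E" "\<And>e. e \<in> J \<Longrightarrow> B e \<in> sets \<nu>" for J B
  proof -
    have "{\<psi> \<in> space \<mu>. \<forall>e\<in>J. \<psi> e \<in> B e} = prod_emb E (\<lambda>_. \<nu>) J (Pi\<^sub>E J B)"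
      unfolding prod_emb_def \<mu>_def using that by (auto simp: space_PiM Pi_iff)
    then show ?thesis using measure_PiM_emb[OF that(2,1), of B] that(3) by (simp add: \<mu>_def)
  qed
  show H: "H \<in> sets \<mu>"
    unfolding H_alt \<mu>_def using K by (intro sets.sets_Collect_finite_All sets_Collect_single') auto
  have pos: "0 < measure \<nu> (He e)" for e
    unfolding He_def using N.prob_counts_pos[OF c, of "{..m}" "k e"] by (simp add: Ball_def)
  show "0 < measure \<mu> H"
    unfolding H_alt using K prob_H[of K He] He pos by (simp add: prod_pos)
  show R: "R \<in> \<mu> \<rightarrow>\<^sub>M \<mu>"
    unfolding R_def \<mu>_def
  proof (rule measurable_restrict)
    fix e assume "e \<in> E"
    then show "(\<lambda>\<psi>. if e \<in> K then \<psi> e - {c 0..<c (Suc m)} else \<psi> e) \<in> Pi\<^sub>M E (\<lambda>_. \<nu>) \<rightarrow>\<^sub>M \<nu>"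
      using measurable_compose[OF measurable_component_singleton[of e E "\<lambda>_. \<nu>"] diff]
      by (cases "e \<in> K") (auto intro: measurable_component_singleton)
  qed
  define M1 where "M1 = distr (density \<mu> (indicator H)) \<mu> R"
  define M2 where "M2 = scale_measure (measure \<mu> H) (distr \<mu> \<mu> R)"
  have em: "emeasure \<mu> Z = ennreal (measure \<mu> Z)" for Z
    unfolding \<mu>_def by (rule P.emeasure_eq_measure)
  have e1: "emeasure M1 Y = measure \<mu> ({\<psi> \<in> space \<mu>. R \<psi> \<in> Y} \<inter> H)" if Y: "Y \<in> sets \<mu>" for Y
  proof -
    have RY: "R -` Y \<inter> space \<mu> \<in> sets \<mu>" using measurable_sets[OF R Y] .
    have "emeasure M1 Y = emeasure (density \<mu> (indicator H)) (R -` Y \<inter> space \<mu>)"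
      using Y R unfolding M1_def by (subst emeasure_distr) auto
    also have "\<dots> = emeasure \<mu> (H \<inter> (R -` Y \<inter> space \<mu>))"
      using RY H by (intro emeasure_restricted)
    also have "H \<inter> (R -` Y \<inter> space \<mu>) = {\<psi> \<in> space \<mu>. R \<psi> \<in> Y} \<inter> H" by auto
    finally show ?thesis by (simp add: em)
  qed
  have e2: "emeasure M2 Y = measure \<mu> {\<psi> \<in> space \<mu>. R \<psi> \<in> Y} * measure \<mu> H" if Y: "Y \<in> sets \<mu>" for Y
  proof -
    have "emeasure M2 Y = measure \<mu> H * emeasure \<mu> (R -` Y \<inter> space \<mu>)"
      using Y R unfolding M2_def by (simp add: emeasure_distr)
    also have "R -` Y \<inter> space \<mu> = {\<psi> \<in> space \<mu>. R \<psi> \<in> Y}" by auto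
    finally show ?thesis by (simp add: em ennreal_mult mult.commute)
  qed
  have "M1 = M2"
  proof (rule measure_eqI_PiM_infinite)
    show "sets M1 = sets (Pi\<^sub>M E (\<lambda>_. \<nu>))" "sets M2 = sets (Pi\<^sub>M E (\<lambda>_. \<nu>))"
      by (simp_all add: M1_def M2_def \<mu>_def)
    show "finite_measure M1"
    proof
      have "space M1 = space \<mu>" by (simp add: M1_def)
      then show "emeasure M1 (space M1) \<noteq> \<infinity>" using e1[of "space \<mu>"] by simp
    qed
    fix A J assume J: "finite J" "J \<subseteq> E" and A: "\<And>e. e \<in> J \<Longrightarrow> A e \<in> sets \<nu>"
    let ?box = "prod_emb E (\<lambda>_. \<nu>) J (Pi\<^sub>E J A)"
    have box: "?box \<in> sets \<mu>" unfolding \<mu>_def using J A by (intro sets_PiM_I) auto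
    \<comment> \<open>What the box demands of a single clock before erasure. For edges outside
      \<open>J\<close> the demand is void, so that both events are boxes over
      \<open>J \<union> K\<close>.\<close>
    define Q where "Q e = {N \<in> space \<nu>. e \<in> J \<longrightarrow> (if e \<in> K then N - {c 0..<c (Suc m)} \<in> A e else N \<in> A e)}" for e
    have Q: "Q e \<in> sets \<nu>" for e
    proof (cases "e \<in> J")
      case True
      note [measurable] = A[OF True]
      show ?thesis unfolding Q_def by measurable
    qed (simp add: Q_def)
    have Rbox: "{\<psi> \<in> space \<mu>. R \<psi> \<in> ?box} = {\<psi> \<in> space \<mu>. \<forall>e\<in>J \<union> K. \<psi> e \<in> Q e}"
    proof -
      have "R \<psi> \<in> ?box \<longleftrightarrow> (\<forall>e\<in>J \<union> K. \<psi> e \<in> Q e)" if \<psi>: "\<psi> \<in> space \<mu>" for \<psi>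
      proof -
        have "R \<psi> \<in> space \<mu>" using measurable_space[OF R \<psi>] .
        then have "R \<psi> \<in> ?box \<longleftrightarrow> (\<forall>e\<in>J. R \<psi> e \<in> A e)"
          using J by (auto simp: \<mu>_def prod_emb_iff space_PiM PiE_iff)
        also have "\<dots> \<longleftrightarrow> (\<forall>e\<in>J \<union> K. \<psi> e \<in> Q e)"
          using J K \<psi> by (auto simp: Q_def R_def \<mu>_def space_PiM PiE_iff)
        finally show ?thesis .
      qed
      then show ?thesis by blast
    qed
    have "{\<psi> \<in> space \<mu>. R \<psi> \<in> ?box} \<inter> H =
        {\<psi> \<in> space \<mu>. \<forall>e\<in>J \<union> K. \<psi> e \<in> (if e \<in> K then Q e \<inter> He e else Q e)}"
      unfolding Rbox H_alt by (auto split: if_splits)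
    then have "measure \<mu> ({\<psi> \<in> space \<mu>. R \<psi> \<in> ?box} \<inter> H) =
        (\<Prod>e\<in>J \<union> K. measure \<nu> (if e \<in> K then Q e \<inter> He e else Q e))"
      using prob_H[of "J \<union> K" "\<lambda>e. if e \<in> K then Q e \<inter> He e else Q e"] J K Q He by simp
    also have "\<dots> = (\<Prod>e\<in>J \<union> K. measure \<nu> (Q e) * (if e \<in> K then measure \<nu> (He e) else 1))"
    proof (intro prod.cong refl)
      fix e
      show "measure \<nu> (if e \<in> K then Q e \<inter> He e else Q e) =
          measure \<nu> (Q e) * (if e \<in> K then measure \<nu> (He e) else 1)"
      proof (cases "e \<in> K")
        case True
        show ?thesis
        proof (cases "e \<in> J")
          case True
          have "A e \<in> sets ring_space" using A[OF True] N.sets_law by simp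
          from N.prob_Diff_counts[OF c this, of m "k e"] show ?thesis
            using True \<open>e \<in> K\<close> by (simp add: Q_def He_def)
        next
          case False
          then have "Q e = space \<nu>" by (simp add: Q_def)
          then show ?thesis using True sets.Int_space_eq1[OF He[of e]] N.prob_space by simp
        qed
      qed simp
    qed
    also have "\<dots> = (\<Prod>e\<in>J \<union> K. measure \<nu> (Q e)) * (\<Prod>e\<in>J \<union> K. if e \<in> K then measure \<nu> (He e) else 1)"
      by (rule prod.distrib)
    also have "(\<Prod>e\<in>J \<union> K. if e \<in> K then measure \<nu> (He e) else 1) = (\<Prod>e\<in>K. measure \<nu> (He e))"
      using J K by (subst prod.inter_restrict[symmetric]) (auto simp: Int_absorb1)
    also have "(\<Prod>e\<in>J \<union> K. measure \<nu> (Q e)) = measure \<mu> {\<psi> \<in> space \<mu>. R \<psi> \<in> ?box}"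
      unfolding Rbox using prob_H[of "J \<union> K" Q] J K Q by simp
    also have "(\<Prod>e\<in>K. measure \<nu> (He e)) = measure \<mu> H"
      unfolding H_alt using prob_H[of K He] K He by simp
    finally show "emeasure M1 ?box = emeasure M2 ?box" using e1[OF box] e2[OF box] by simp
  qed
  moreover have "X \<in> sets \<mu>"
    using X sets_PiM_cong[OF refl N.sets_law, of E] by (simp add: \<mu>_def)
  ultimately show "measure \<mu> ({\<psi> \<in> space \<mu>. R \<psi> \<in> X} \<inter> H) = measure \<mu> {\<psi> \<in> space \<mu>. R \<psi> \<in> X} * measure \<mu> H"
    using e1[of X] e2[of X] by (simp add: ennreal_inj measure_nonneg)
qed

section \<open>The action on clocks and the interchange permutation\<close>

context group
begin

lemma vertex_action_closed [simp]:
  "g \<in> carrier G \<Longrightarrow> x \<in> carrier G \<Longrightarrow> vertex_action G g x \<in> carrier G"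
  by (simp add: vertex_action_def)

lemma vertex_action_inv [simp]:
  assumes "g \<in> carrier G" "x \<in> carrier G"
  shows "vertex_action G (inv g) (vertex_action G g x) = x"
    and "vertex_action G g (vertex_action G (inv g) x) = x"
  using assms by (simp_all add: vertex_action_def m_assoc)

lemma vertex_action_inj:
  "g \<in> carrier G \<Longrightarrow> x \<in> carrier G \<Longrightarrow> y \<in> carrier G \<Longrightarrow>
    vertex_action G g x = vertex_action G g y \<longleftrightarrow> x = y"
  by (metis vertex_action_inv(1))

end

locale cayley_graph = group G for G :: "('a, 'b) monoid_scheme" (structure) +
  fixes S :: "'a set"
  assumes finite_S: "finite S"
    and S_subset: "S \<subseteq> carrier G"
    and generate_S: "generate G S = carrier G"
begin

abbreviation E :: "'a set set" where "E \<equiv> cayley_edges G S"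

abbreviation \<theta> :: "'a \<Rightarrow> ('a set \<Rightarrow> real set) \<Rightarrow> ('a set \<Rightarrow> real set)" where
  "\<theta> \<equiv> clock_action G S"

lemma edge_carrier: "e \<in> E \<Longrightarrow> x \<in> e \<Longrightarrow> x \<in> carrier G"
  using S_subset by (auto simp: cayley_edges_def)

lemma finite_edge: "e \<in> E \<Longrightarrow> finite e"
  by (auto simp: cayley_edges_def)

lemma finite_edges_at: "finite {e \<in> E. x \<in> e}"
proof (rule finite_subset)
  show "{e \<in> E. x \<in> e} \<subseteq> (\<lambda>s. {x, s \<otimes> x}) ` S \<union> (\<lambda>s. {inv s \<otimes> x, x}) ` S"
  proof
    fix e assume "e \<in> {e \<in> E. x \<in> e}"
    then obtain z s where e: "e = {z, s \<otimes> z}" "z \<in> carrier G" "s \<in> S" "x \<in> e"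
      by (auto simp: cayley_edges_def)
    have s: "s \<in> carrier G" using e S_subset by auto
    have "inv s \<otimes> (s \<otimes> z) = z" using s e by (simp add: m_assoc [symmetric])
    then have "e = {inv s \<otimes> x, x}" if "x = s \<otimes> z" using e that by simp
    moreover have "e = {x, s \<otimes> x}" if "x = z" using e that by simp
    moreover have "x = z \<or> x = s \<otimes> z" using e by simp
    ultimately show "e \<in> (\<lambda>s. {x, s \<otimes> x}) ` S \<union> (\<lambda>s. {inv s \<otimes> x, x}) ` S"
      using e(3) by blast
  qed
  show "finite ((\<lambda>s. {x, s \<otimes> x}) ` S \<union> (\<lambda>s. {inv s \<otimes> x, x}) ` S)"
    using finite_S by auto
qed

text \<open>Right multiplication by \<open>inv g\<close> commutes with left multiplication by a
  generator.\<close>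

lemma vertex_action_edge: "g \<in> carrier G \<Longrightarrow> e \<in> E \<Longrightarrow> vertex_action G g ` e \<in> E"
proof -
  assume g: "g \<in> carrier G" and "e \<in> E"
  then obtain z s where e: "e = {z, s \<otimes> z}" "z \<in> carrier G" "s \<in> S" "s \<otimes> z \<noteq> z"
    by (auto simp: cayley_edges_def)
  have s: "s \<in> carrier G" using e S_subset by auto
  have "vertex_action G g ` e = {vertex_action G g z, s \<otimes> vertex_action G g z}"
    using e s g by (simp add: vertex_action_def m_assoc)
  moreover have "s \<otimes> vertex_action G g z \<noteq> vertex_action G g z"
    using e s g by (simp add: vertex_action_def m_assoc [symmetric])
  ultimately show ?thesis
    unfolding cayley_edges_def mem_Collect_eq using e(2,3) g vertex_action_closed by metis
qed

lemma vertex_action_image_inv [simp]: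
  assumes "g \<in> carrier G" "e \<in> E"
  shows "vertex_action G (inv g) ` vertex_action G g ` e = e"
    and "vertex_action G g ` vertex_action G (inv g) ` e = e"
proof -
  have "\<And>x. x \<in> e \<Longrightarrow> x \<in> carrier G" using assms edge_carrier by blast
  then show "vertex_action G (inv g) ` vertex_action G g ` e = e"
    and "vertex_action G g ` vertex_action G (inv g) ` e = e"
    using assms by (simp_all add: image_image)
qed

lemma clock_action_image:
  "g \<in> carrier G \<Longrightarrow> e \<in> E \<Longrightarrow> \<theta> g \<psi> (vertex_action G g ` e) = \<psi> e"
  by (simp add: clock_action_def vertex_action_edge)

lemma clock_action_inv:
  "g \<in> carrier G \<Longrightarrow> \<psi> \<in> extensional E \<Longrightarrow> \<theta> (inv g) (\<theta> g \<psi>) = \<psi>"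
  by (rule extensionalityI[of _ E]) (simp_all add: clock_action_def vertex_action_edge)

section \<open>Trajectories of particles and their equivariance\<close>

lemma ring_at_swap:
  assumes "{x, y} \<in> E"
    and "\<forall>e\<in>E. x \<in> e \<longrightarrow> \<psi> e \<inter> {s<..u} = (if e = {x, y} then {u} else {})"
  shows "u \<in> \<psi> {x, y}"
proof -
  have "\<psi> {x, y} \<inter> {s<..u} = {u}" using assms by simp
  then show ?thesis by blast
qed

text \<open>The rules are deterministic: two derivations agree on the first ring at
  \<open>x\<close>, hence on the edge that rings, and the induction continues from the new
  position.\<close>

lemma particle_moves_unique:
  "particle_moves G S \<psi> t s x z \<Longrightarrow> particle_moves G S \<psi> t s x z' \<Longrightarrow> z = z'"
proof (induction arbitrary: z' rule: particle_moves.induct)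
  case (stay s x)
  from stay(3) show ?case
  proof cases
    case (swap u y)
    then have "u \<in> \<psi> {x, y} \<inter> {s<..t}" using ring_at_swap[OF swap(3,4)] by simp
    with swap(3) stay(2) have False by blast
    then show ?thesis ..
  qed auto
next
  case (swap s u x y z)
  note E = swap(3) and rings = swap(4) and IH = swap(6)
  have u: "u \<in> \<psi> {x, y}" "s < u" "u \<le> t" using ring_at_swap[OF E rings] swap by auto
  from swap(7) show ?case
  proof cases
    case stay
    then have "\<psi> {x, y} \<inter> {s<..t} = {}" using E by simp
    with u show ?thesis by auto
  next
    case (swap u' y')
    have u': "u' \<in> \<psi> {x, y'}" by (rule ring_at_swap[OF swap(3,4)])
    \<comment> \<open>If the times differed, the earlier ring would lie strictly inside the interval
      of the other rule application, whose only ring at \<open>x\<close> is at its right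
      end.\<close>
    have uu: "u = u'"
    proof (rule linorder_cases)
      assume "u < u'"
      with u have "u \<in> \<psi> {x, y} \<inter> {s<..u'}" by auto
      with swap(4) E \<open>u < u'\<close> show ?thesis by (simp split: if_splits)
    next
      assume "u' < u"
      with u' swap(1) have "u' \<in> \<psi> {x, y'} \<inter> {s<..u}" by auto
      with rings swap(3) \<open>u' < u\<close> show ?thesis by (simp split: if_splits)
    qed
    have "u' \<in> \<psi> {x, y'} \<inter> {s<..u}" using u u' uu by auto
    then have "{x, y'} = {x, y}" using rings swap(3) by (metis empty_iff insertI1)
    then have "y = y'" by (auto simp: doubleton_eq_iff)
    with swap uu IH show ?thesis by auto
  qed
qed

lemma particle_moves_carrier:
  "particle_moves G S \<psi> t s x z \<Longrightarrow> x \<in> carrier G \<Longrightarrow> z \<in> carrier G"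
  by (induction rule: particle_moves.induct) (auto intro: edge_carrier)

text \<open>Uniqueness of trajectories settles one half of the condition in
  \<open>interchange_perm\<close>; only the existence of a permutation is at stake.\<close>

lemma is_interchange_perm_unique:
  assumes "is_interchange_perm G S t \<psi> f" "is_interchange_perm G S t \<psi> f'"
  shows "f = f'"
proof
  fix v show "f v = f' v"
    using assms particle_moves_unique
    by (cases "v \<in> carrier G") (auto simp: is_interchange_perm_def permutes_def)
qed

lemma interchange_perm_eq: "is_interchange_perm G S t \<psi> f \<Longrightarrow> interchange_perm G S t \<psi> = f"
  unfolding interchange_perm_def
  by (rule trans[OF if_P the_equality]) (blast dest: is_interchange_perm_unique)+

lemma interchange_perm_id:
  "\<nexists>f. is_interchange_perm G S t \<psi> f \<Longrightarrow> interchange_perm G S t \<psi> = id"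
  unfolding interchange_perm_def by auto

lemma interchange_perm_permutes: "interchange_perm G S t \<psi> permutes carrier G"
  by (metis interchange_perm_eq interchange_perm_id is_interchange_perm_def permutes_id)

lemma edge_at_vertex_action:
  assumes g: "g \<in> carrier G" and x: "x \<in> carrier G" and e: "e \<in> E" "vertex_action G g x \<in> e"
  obtains e' where "e' \<in> E" "x \<in> e'" "e = vertex_action G g ` e'"
proof
  let ?e = "vertex_action G (inv g) ` e"
  show "?e \<in> E" using g e by (simp add: vertex_action_edge)
  show "x \<in> ?e" using e g x by (force intro: image_eqI[where x = "vertex_action G g x"])
  show "e = vertex_action G g ` ?e" using g e by simp
qed

lemma particle_moves_clock_action:
  "particle_moves G S \<psi> t s x z \<Longrightarrow> g \<in> carrier G \<Longrightarrow> x \<in> carrier G \<Longrightarrow>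
    particle_moves G S (\<theta> g \<psi>) t s (vertex_action G g x) (vertex_action G g z)"
proof (induction rule: particle_moves.induct)
  case (stay s x)
  show ?case
  proof (rule particle_moves.stay)
    show "\<forall>e\<in>E. vertex_action G g x \<in> e \<longrightarrow> \<theta> g \<psi> e \<inter> {s<..t} = {}"
      using stay by (metis clock_action_image edge_at_vertex_action)
  qed fact
next
  case (swap s u x y z)
  have y: "y \<in> carrier G" using swap by (auto intro: edge_carrier)
  show ?case
  proof (rule particle_moves.swap)
    show "{vertex_action G g x, vertex_action G g y} \<in> E"
      using vertex_action_edge[OF swap.prems(1) swap(3)] by simp
    show "\<forall>e\<in>E. vertex_action G g x \<in> e \<longrightarrow> \<theta> g \<psi> e \<inter> {s<..u} =
        (if e = {vertex_action G g x, vertex_action G g y} then {u} else {})"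
    proof (intro ballI impI)
      fix e assume "e \<in> E" "vertex_action G g x \<in> e"
      then obtain e' where e': "e' \<in> E" "x \<in> e'" "e = vertex_action G g ` e'"
        using edge_at_vertex_action swap.prems by blast
      have "e = {vertex_action G g x, vertex_action G g y} \<longleftrightarrow> e' = {x, y}"
      proof
        assume "e = {vertex_action G g x, vertex_action G g y}"
        then have "vertex_action G (inv g) ` vertex_action G g ` e' = {x, y}"
          using e' swap.prems y by simp
        then show "e' = {x, y}" using e' swap.prems by simp
      qed (use e' in simp)
      then show "\<theta> g \<psi> e \<inter> {s<..u} =
        (if e = {vertex_action G g x, vertex_action G g y} then {u} else {})"
        using e' swap by (simp add: clock_action_image)
    qed
    show "particle_moves G S (\<theta> g \<psi>) t u (vertex_action G g y) (vertex_action G g z)"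
      using swap y by auto
  qed fact+
qed

lemma is_interchange_perm_clock_action:
  assumes f: "is_interchange_perm G S t \<psi> f" and g: "g \<in> carrier G"
  defines "f' \<equiv> \<lambda>v. if v \<in> carrier G then vertex_action G g (f (vertex_action G (inv g) v)) else v"
  shows "is_interchange_perm G S t (\<theta> g \<psi>) f'"
proof -
  have p: "f permutes carrier G" using f by (simp add: is_interchange_perm_def)
  have "bij_betw (vertex_action G g) (carrier G) (carrier G)"
    using g by (intro bij_betwI[where g = "vertex_action G (inv g)"]) auto
  moreover have "bij_betw (vertex_action G (inv g)) (carrier G) (carrier G)"
    using g by (intro bij_betwI[where g = "vertex_action G g"]) auto
  moreover have "bij_betw f (carrier G) (carrier G)" using p by (rule permutes_imp_bij)
  ultimately have "bij_betw (vertex_action G g \<circ> (f \<circ> vertex_action G (inv g))) (carrier G) (carrier G)"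
    by (meson bij_betw_trans)
  then have "bij_betw f' (carrier G) (carrier G)"
    by (rule bij_betw_cong[THEN iffD1, rotated]) (simp add: f'_def)
  then have "f' permutes carrier G"
    by (rule bij_imp_permutes) (simp add: f'_def)
  moreover have "particle_moves G S (\<theta> g \<psi>) t 0 v (f' v)" if v: "v \<in> carrier G" for v
  proof -
    have "particle_moves G S \<psi> t 0 (vertex_action G (inv g) v) (f (vertex_action G (inv g) v))"
      using f g v by (simp add: is_interchange_perm_def)
    from particle_moves_clock_action[OF this g] show ?thesis
      using g v by (simp add: f'_def)
  qed
  ultimately show ?thesis by (simp add: is_interchange_perm_def)
qed

text \<open>If no permutation exists for \<psi>, then none exists for
  \<open>\<theta> g \<psi>\<close>, as the action of \<open>inv g\<close> shows, and the default
  \<open>id\<close> is equivariant too. So there is no exceptional null set to carry along.\<close>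

lemma interchange_perm_clock_action:
  assumes g: "g \<in> carrier G" and v: "v \<in> carrier G" and \<psi>: "\<psi> \<in> extensional E"
  shows "interchange_perm G S t (\<theta> g \<psi>) (vertex_action G g v) =
    vertex_action G g (interchange_perm G S t \<psi> v)"
proof (cases "\<exists>f. is_interchange_perm G S t \<psi> f")
  case True
  then obtain f where f: "is_interchange_perm G S t \<psi> f" by auto
  show ?thesis
    using interchange_perm_eq[OF f] interchange_perm_eq[OF is_interchange_perm_clock_action[OF f g]] g v
    by simp
next
  case False
  have "\<nexists>f. is_interchange_perm G S t (\<theta> g \<psi>) f"
    using False is_interchange_perm_clock_action[of t "\<theta> g \<psi>" _ "inv g"] g clock_action_inv[OF g \<psi>]
    by auto
  then show ?thesis using False interchange_perm_id by auto
qed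

end

section \<open>Inserting swaps\<close>

text \<open>The head of the list acts first, in the temporal order of the rings.\<close>

definition apply_swaps :: "('a \<times> 'a) list \<Rightarrow> 'a \<Rightarrow> 'a" where
  "apply_swaps L = fold (\<lambda>(p, q). Transposition.transpose p q) L"

lemma apply_swaps_simps [simp]:
  "apply_swaps [] x = x"
  "apply_swaps ((p, q) # L) x = apply_swaps L (Transposition.transpose p q x)"
  "apply_swaps (L @ L') x = apply_swaps L' (apply_swaps L x)"
  by (simp_all add: apply_swaps_def)

context cayley_graph
begin

definition swap_vertices :: "('a \<times> 'a) list \<Rightarrow> 'a set" where
  "swap_vertices L = fst ` set L \<union> snd ` set L"

lemma apply_swaps_outside: "x \<notin> swap_vertices L \<Longrightarrow> apply_swaps L x = x"
proof (induction L)
  case (Cons a L)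
  obtain p q where a: "a = (p, q)" by (cases a) auto
  with Cons.prems have "x \<noteq> p" "x \<noteq> q" by (auto simp: swap_vertices_def)
  then show ?case using Cons a by (auto simp: swap_vertices_def)
qed simp

lemma apply_swaps_carrier:
  "(\<And>p q. (p, q) \<in> set L \<Longrightarrow> {p, q} \<in> E) \<Longrightarrow> apply_swaps L permutes carrier G"
proof (induction L)
  case Nil
  have "apply_swaps [] = id" by (auto simp: fun_eq_iff)
  then show ?case by (metis permutes_id)
next
  case (Cons a L)
  obtain p q where a: "a = (p, q)" by (cases a) auto
  have "apply_swaps (a # L) = apply_swaps L \<circ> Transposition.transpose p q"
    by (simp add: a fun_eq_iff)
  moreover have "Transposition.transpose p q permutes carrier G"
    using Cons.prems a by (intro permutes_swap_id) (auto intro: edge_carrier)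
  moreover have "apply_swaps L permutes carrier G" using Cons by simp
  ultimately show ?case by (metis permutes_compose)
qed

text \<open>Conjugating the transposition of \<open>y\<close> and \<open>z\<close> by that of
  \<open>x\<close> and \<open>y\<close> renames \<open>y\<close> to \<open>x\<close>.\<close>

lemma transpose_conjugate:
  "x \<noteq> z \<Longrightarrow> y \<noteq> z \<Longrightarrow> Transposition.transpose x y (Transposition.transpose y z (Transposition.transpose x y v)) = Transposition.transpose x z v"
  by (auto simp: Transposition.transpose_def)

definition swap_path :: "'a \<Rightarrow> 'a \<Rightarrow> ('a \<times> 'a) list \<Rightarrow> bool" where
  "swap_path x y L \<longleftrightarrow> (\<forall>(p, q) \<in> set L. {p, q} \<in> E) \<and> apply_swaps L = Transposition.transpose x y"

text \<open>By conjugation, \<open>L\<close>, then \<open>L'\<close>, then \<open>L\<close> again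
  gives the transposition of \<open>x\<close> and \<open>z\<close>. The conjugation formula fails
  for \<open>x = z\<close> and for \<open>y = z\<close>; there the empty list and \<open>L\<close>
  serve.\<close>

lemma swap_path_trans:
  assumes "swap_path x y L" "swap_path y z L'"
  shows "\<exists>L''. swap_path x z L''"
proof (cases "x = z \<or> y = z")
  case True
  have "swap_path x x []" by (simp add: swap_path_def fun_eq_iff)
  with True assms show ?thesis by metis
next
  case False
  have "swap_path x z (L @ L' @ L)"
    using assms False by (auto simp: swap_path_def fun_eq_iff transpose_conjugate)
  then show ?thesis ..
qed

text \<open>Induction over the generated group, for all base vertices at once: a generator gives an
  edge or a loop, an inverse uses the edge at \<open>inv h \<otimes> x\<close> backwards, and
  products are joined by \<open>swap_path_trans\<close>.\<close>

lemma swap_path_exists: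
  assumes "x \<in> carrier G" "y \<in> carrier G"
  shows "\<exists>L. swap_path x y L"
proof -
  have nil: "swap_path x x []" for x by (simp add: swap_path_def fun_eq_iff)
  have gen: "\<exists>L. swap_path x (s \<otimes> x) L" if "s \<in> S" "x \<in> carrier G" for s x
  proof (cases "s \<otimes> x = x")
    case False
    with that have "{x, s \<otimes> x} \<in> E" by (auto simp: cayley_edges_def)
    then have "swap_path x (s \<otimes> x) [(x, s \<otimes> x)]" by (simp add: swap_path_def fun_eq_iff)
    then show ?thesis ..
  qed (metis nil)
  have sym: "swap_path y x L" if "swap_path x y L" for x y L
    using that by (simp add: swap_path_def Transposition.transpose_commute)
  have "\<forall>x\<in>carrier G. \<exists>L. swap_path x (g \<otimes> x) L" if "g \<in> generate G S" for g
    using that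
  proof induction
    case one
    then show ?case using nil by (metis l_one)
  next
    case (incl h)
    then show ?case using gen by simp
  next
    case (inv h)
    show ?case
    proof
      fix x assume x: "x \<in> carrier G"
      have h: "h \<in> carrier G" using inv S_subset by auto
      have "\<exists>L. swap_path (inv h \<otimes> x) (h \<otimes> (inv h \<otimes> x)) L"
        using inv gen h x by simp
      then show "\<exists>L. swap_path x (inv h \<otimes> x) L"
        using sym h x by (metis inv_closed l_one m_assoc r_inv)
    qed
  next
    case (eng h1 h2)
    show ?case
    proof
      fix x assume x: "x \<in> carrier G"
      have c: "h1 \<in> carrier G" "h2 \<in> carrier G" using eng generate_S by auto
      have "\<exists>L. swap_path x (h2 \<otimes> x) L" "\<exists>L. swap_path (h2 \<otimes> x) (h1 \<otimes> (h2 \<otimes> x)) L"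
        using eng.IH x c by simp_all
      then show "\<exists>L. swap_path x (h1 \<otimes> h2 \<otimes> x) L"
        using swap_path_trans c x by (metis m_assoc)
    qed
  qed
  moreover have "y \<otimes> inv x \<in> generate G S" using assms generate_S by simp
  ultimately have "\<exists>L. swap_path x (y \<otimes> inv x \<otimes> x) L" using assms by blast
  then show ?thesis using assms by (simp add: m_assoc)
qed

definition silence :: "'a set set \<Rightarrow> real \<Rightarrow> real \<Rightarrow> ('a set \<Rightarrow> real set) \<Rightarrow> ('a set \<Rightarrow> real set)" where
  "silence K a b \<psi> = (\<lambda>e\<in>E. if e \<in> K then \<psi> e - {a..<b} else \<psi> e)"

text \<open>The extra cell of index \<open>length L\<close> is silent. In use it starts at the end
  time of the process; as cells are open on the right, only this cell excludes a ring at the end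
  time itself.\<close>

definition swap_pattern ::
  "'a set set \<Rightarrow> (nat \<Rightarrow> real) \<Rightarrow> ('a \<times> 'a) list \<Rightarrow> ('a set \<Rightarrow> real set) \<Rightarrow> bool" where
  "swap_pattern K c L \<psi> \<longleftrightarrow> (\<forall>e\<in>K. \<forall>i\<le>length L. card (\<psi> e \<inter> {c i..<c (Suc i)}) =
     (if i < length L \<and> e = {fst (L ! i), snd (L ! i)} then 1 else 0))"

text \<open>The rule \<open>swap\<close> looks at every clock at the moving particle, so all edges
  at the endpoints of the swaps have to be controlled, and not only the swap edges.\<close>

definition edges_touching :: "'a set \<Rightarrow> 'a set set" where
  "edges_touching V = {e \<in> E. e \<inter> V \<noteq> {}}"

lemma finite_edges_touching: "finite V \<Longrightarrow> finite (edges_touching V)"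
proof -
  assume "finite V"
  moreover have "edges_touching V = (\<Union>x\<in>V. {e \<in> E. x \<in> e})"
    by (auto simp: edges_touching_def)
  ultimately show ?thesis using finite_edges_at by simp
qed

section \<open>Effect of the inserted rings on trajectories\<close>

context
  fixes \<psi> :: "'a set \<Rightarrow> real set" and L :: "('a \<times> 'a) list" and c :: "nat \<Rightarrow> real"
  assumes \<psi>: "\<And>e. e \<in> E \<Longrightarrow> \<psi> e \<in> ring_times"
    and L: "\<And>p q. (p, q) \<in> set L \<Longrightarrow> {p, q} \<in> E"
    and c: "strict_mono c" "0 < c 0"
    and pattern: "swap_pattern (edges_touching (swap_vertices L)) c L \<psi>"
begin

abbreviation "V\<^sub>L \<equiv> swap_vertices L"
abbreviation "K\<^sub>L \<equiv> edges_touching V\<^sub>L"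
abbreviation "m \<equiv> length L"
abbreviation "\<psi>\<^sub>0 \<equiv> silence K\<^sub>L (c 0) (c (Suc m)) \<psi>"

lemma c_mono: "i \<le> j \<Longrightarrow> c i \<le> c j"
  using c(1) by (simp add: strict_mono_less_eq)

lemma c_pos: "0 < c i"
  using c_mono[of 0 i] c(2) by simp

lemma in_K: "e \<in> E \<Longrightarrow> x \<in> e \<Longrightarrow> x \<in> V\<^sub>L \<Longrightarrow> e \<in> K\<^sub>L"
  by (auto simp: edges_touching_def)

lemma pattern_silent:
  assumes "e \<in> K\<^sub>L" "i \<le> m" "i < m \<Longrightarrow> e \<noteq> {fst (L ! i), snd (L ! i)}"
  shows "\<psi> e \<inter> {c i..<c (Suc i)} = {}"
proof -
  have "e \<in> E" using assms by (simp add: edges_touching_def)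
  then have "finite (\<psi> e \<inter> {c i..<c (Suc i)})"
    using \<psi> c_pos less_imp_le by (blast intro: ring_times_finite_Ico)
  moreover have "card (\<psi> e \<inter> {c i..<c (Suc i)}) = 0"
    using pattern assms by (auto simp: swap_pattern_def)
  ultimately show ?thesis by simp
qed

lemma pattern_ring:
  assumes "{fst (L ! i), snd (L ! i)} \<in> K\<^sub>L" "i < m"
  obtains u where "\<psi> {fst (L ! i), snd (L ! i)} \<inter> {c i..<c (Suc i)} = {u}"
proof -
  have "card (\<psi> {fst (L ! i), snd (L ! i)} \<inter> {c i..<c (Suc i)}) = 1"
    using pattern assms by (auto simp: swap_pattern_def)
  then show ?thesis using that by (auto simp: card_1_singleton_iff)
qed

text \<open>Downward induction from the end time: a particle at rest up to cell i is moved in this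
  cell by the i-th swap or not at all, and is then at rest up to the next cell. The interval in the
  hypothesis is open because a cell contains its left end.\<close>

lemma swaps_move:
  assumes "i \<le> m" "x \<in> V\<^sub>L" "s < c i"
    and "\<And>e. e \<in> E \<Longrightarrow> x \<in> e \<Longrightarrow> \<psi> e \<inter> {s<..<c i} = {}"
  shows "particle_moves G S \<psi> (c m) s x (apply_swaps (drop i L) x)"
  using assms
proof (induction i arbitrary: x s rule: inc_induct)
  case base
  show ?case
  proof (simp, rule particle_moves.stay)
    show "\<forall>e\<in>E. x \<in> e \<longrightarrow> \<psi> e \<inter> {s<..c m} = {}"
    proof (intro ballI impI)
      fix e assume e: "e \<in> E" "x \<in> e"
      \<comment> \<open>The silent extra cell excludes a ring at the end time
        \<open>c m\<close>.\<close>
      have "\<psi> e \<inter> {c m..<c (Suc m)} = {}"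
        using pattern_silent[of e m] in_K e base by simp
      moreover have "c m < c (Suc m)" using c(1) by (simp add: strict_mono_less)
      then have "{s<..c m} \<subseteq> {s<..<c m} \<union> {c m..<c (Suc m)}" by auto
      ultimately show "\<psi> e \<inter> {s<..c m} = {}" using base(3)[OF e] by blast
    qed
  qed (use base in simp)
next
  case (step i)
  obtain p q where pq: "L ! i = (p, q)" by (cases "L ! i") auto
  have i: "i < m" by fact
  then have mem: "(p, q) \<in> set L" using pq nth_mem by metis
  have E: "{p, q} \<in> E" using L mem by simp
  have V: "p \<in> V\<^sub>L" "q \<in> V\<^sub>L" using mem by (force simp: swap_vertices_def)+
  have drop: "drop i L = (p, q) # drop (Suc i) L"
    using i pq Cons_nth_drop_Suc by metis
  have lt: "c i < c (Suc i)" using c(1) by (simp add: strict_mono_less)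
  have split: "{s<..<c (Suc i)} \<subseteq> {s<..<c i} \<union> {c i..<c (Suc i)}" by auto
  show ?case
  proof (cases "x \<in> {p, q}")
    case False
    have "\<psi> e \<inter> {s<..<c (Suc i)} = {}" if "e \<in> E" "x \<in> e" for e
    proof -
      have "\<psi> e \<inter> {c i..<c (Suc i)} = {}"
        using False that i pq by (intro pattern_silent in_K[of e x] step) auto
      then show ?thesis using step.prems(3)[OF that] split by blast
    qed
    then have "particle_moves G S \<psi> (c m) s x (apply_swaps (drop (Suc i) L) x)"
      using step lt by (intro step.IH) auto
    then show ?thesis using False by (simp add: drop Transposition.transpose_def)
  next
    case True
    define y where "y = Transposition.transpose p q x"
    have xy: "{p, q} = {x, y}" using True by (auto simp: y_def)
    have y: "y \<in> V\<^sub>L" using V True by (auto simp: y_def)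
    have "{p, q} \<in> K\<^sub>L" using E V by (auto intro: in_K)
    then obtain u where u: "\<psi> {x, y} \<inter> {c i..<c (Suc i)} = {u}"
      using pattern_ring[of i] i pq xy by auto
    have u': "c i \<le> u" "u < c (Suc i)" using u by auto
    show ?thesis
    proof (rule particle_moves.swap)
      show "s < u" using step u' by simp
      show "u \<le> c m" using u' c_mono[of "Suc i" m] i by simp
      show "{x, y} \<in> E" using E xy by simp
      show "\<forall>e\<in>E. x \<in> e \<longrightarrow> \<psi> e \<inter> {s<..u} = (if e = {x, y} then {u} else {})"
      proof (intro ballI impI)
        fix e assume e: "e \<in> E" "x \<in> e"
        have 1: "\<psi> e \<inter> {s<..<c i} = {}" using step.prems(3)[OF e] .
        have 2: "{s<..u} \<subseteq> {s<..<c i} \<union> {c i..<c (Suc i)}" using u' by auto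
        show "\<psi> e \<inter> {s<..u} = (if e = {x, y} then {u} else {})"
        proof (cases "e = {x, y}")
          case True
          have "\<psi> e \<inter> {s<..u} \<subseteq> {u}" using 1 2 u True by blast
          moreover have "u \<in> \<psi> e \<inter> {s<..u}" using u True \<open>s < u\<close> by auto
          ultimately show ?thesis using True by auto
        next
          case False
          have "\<psi> e \<inter> {c i..<c (Suc i)} = {}"
            using e False i pq xy step.prems by (intro pattern_silent in_K[of e x]) auto
          then show ?thesis using False 1 2 by auto
        qed
      qed
      have "\<psi> e \<inter> {u<..<c (Suc i)} = {}" if e: "e \<in> E" "y \<in> e" for e
      proof (cases "e = {x, y}")
        case True
        then have "\<psi> e \<inter> {u<..<c (Suc i)} \<subseteq> \<psi> {x, y} \<inter> {c i..<c (Suc i)} - {u}"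
          using u'(1) by auto
        then show ?thesis unfolding u by simp
      next
        case False
        have "\<psi> e \<inter> {c i..<c (Suc i)} = {}"
          using e y False i pq xy by (intro pattern_silent in_K[of e y]) auto
        moreover have "{u<..<c (Suc i)} \<subseteq> {c i..<c (Suc i)}" using u' by auto
        ultimately show ?thesis by blast
      qed
      then have "particle_moves G S \<psi> (c m) u y (apply_swaps (drop (Suc i) L) y)"
        using u' y by (intro step.IH) auto
      then show "particle_moves G S \<psi> (c m) u y (apply_swaps (drop i L) x)"
        by (simp add: drop y_def)
    qed
  qed
qed

text \<open>An edge with an endpoint off the path is not among the swaps, so the pattern keeps it
  silent in every cell and erasure removes nothing.\<close>

lemma silenced_outside:
  assumes "e \<in> E" "x \<in> e" "x \<notin> V\<^sub>L"
  shows "\<psi>\<^sub>0 e = \<psi> e"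
proof (cases "e \<in> K\<^sub>L")
  case True
  have "\<psi> e \<inter> {c i..<c (Suc i)} = {}" if i: "i \<le> m" for i
  proof (rule pattern_silent[OF True i])
    assume "i < m"
    then have "L ! i \<in> set L" by simp
    then show "e \<noteq> {fst (L ! i), snd (L ! i)}"
      using assms by (auto simp: swap_vertices_def)
  qed
  moreover have "\<exists>i\<le>m. t \<in> {c i..<c (Suc i)}" if t: "c 0 \<le> t" "t < c (Suc m)" for t
  proof -
    \<comment> \<open>The first cell that ends after \<open>t\<close> is the one that contains
      \<open>t\<close>.\<close>
    define i where "i = (LEAST i. t < c (Suc i))"
    have 1: "t < c (Suc i)" "i \<le> m"
      using t(2) unfolding i_def by (auto intro: LeastI Least_le)
    have "c i \<le> t"
    proof (cases i)
      case (Suc j)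
      then show ?thesis using not_less_Least[of j "\<lambda>i. t < c (Suc i)"] i_def by auto
    qed (use t in simp)
    with 1 show ?thesis by auto
  qed
  ultimately have "\<psi> e \<inter> {c 0..<c (Suc m)} = {}" by fastforce
  then show ?thesis using assms by (auto simp: silence_def)
qed (use assms in \<open>simp add: silence_def\<close>)

lemma silenced_before:
  assumes "e \<in> E" "u < c 0"
  shows "\<psi>\<^sub>0 e \<inter> {s<..u} = \<psi> e \<inter> {s<..u}"
  using assms by (auto simp: silence_def)

text \<open>After silencing, no swap in the window involves a vertex of \<open>V\<^sub>L\<close>. A
  particle thus rests in \<open>V\<^sub>L\<close> during the window, where the inserted swaps act on
  it, or stays outside, where the clocks have not changed. The side condition is the invariant that
  no particle enters \<open>V\<^sub>L\<close> within the window.\<close>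

lemma particle_moves_insert_swaps:
  assumes "particle_moves G S \<psi>\<^sub>0 (c m) s x z" "s < c 0 \<or> x \<notin> V\<^sub>L"
  shows "particle_moves G S \<psi> (c m) s x (apply_swaps L z)"
  using assms
proof (induction rule: particle_moves.induct)
  case (stay s x)
  show ?case
  proof (cases "x \<in> V\<^sub>L")
    case False
    have "\<forall>e\<in>E. x \<in> e \<longrightarrow> \<psi> e \<inter> {s<..c m} = {}"
      using stay silenced_outside False by metis
    then show ?thesis using False stay by (simp add: apply_swaps_outside particle_moves.stay)
  next
    case True
    have "\<psi> e \<inter> {s<..<c 0} = {}" if e: "e \<in> E" "x \<in> e" for e
    proof -
      have "\<psi>\<^sub>0 e \<inter> {s<..c m} = {}" using stay e by simp
      moreover have "{s<..<c 0} \<subseteq> {s<..c m}" using c_mono[of 0 m] by auto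
      ultimately show ?thesis using e by (auto simp: silence_def split: if_splits)
    qed
    then show ?thesis using swaps_move[of 0 x s] stay True by simp
  qed
next
  case (swap s u x y z)
  have u: "u \<in> \<psi>\<^sub>0 {x, y}" by (rule ring_at_swap[OF swap(3,4)])
  \<comment> \<open>Such a swap uses an edge of \<open>K\<^sub>L\<close>, whose rings in the window
    are erased, and the window extends beyond the end time \<open>c m\<close>.\<close>
  have early: "u < c 0" if "x \<in> V\<^sub>L \<or> y \<in> V\<^sub>L"
  proof (rule ccontr)
    assume "\<not> u < c 0"
    moreover have "u < c (Suc m)" using swap(2) c(1) strict_mono_less[of c m "Suc m"] by simp
    moreover have "{x, y} \<in> K\<^sub>L" using that swap(3) by (auto intro: in_K)
    ultimately show False using u swap(3) by (simp add: silence_def)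
  qed
  have agree: "\<psi>\<^sub>0 e \<inter> {s<..u} = \<psi> e \<inter> {s<..u}" if "e \<in> E" "x \<in> e" for e
    using silenced_outside[OF that] silenced_before[OF that(1), of u s] early by metis
  have "\<forall>e\<in>E. x \<in> e \<longrightarrow> \<psi> e \<inter> {s<..u} = (if e = {x, y} then {u} else {})"
  proof (intro ballI impI)
    fix e assume e: "e \<in> E" "x \<in> e"
    show "\<psi> e \<inter> {s<..u} = (if e = {x, y} then {u} else {})"
      using swap(4)[rule_format, OF e] unfolding agree[OF e] .
  qed
  moreover have "particle_moves G S \<psi> (c m) u y (apply_swaps L z)"
    using early by (intro swap.IH) auto
  ultimately show ?case by (rule particle_moves.swap[OF swap(1-3)])
qed

lemma is_interchange_perm_insert_swaps:
  assumes "is_interchange_perm G S (c m) \<psi>\<^sub>0 f"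
  shows "is_interchange_perm G S (c m) \<psi> (apply_swaps L \<circ> f)"
proof -
  have "apply_swaps L permutes carrier G" by (rule apply_swaps_carrier) (rule L)
  then show ?thesis
    using assms particle_moves_insert_swaps c(2)
    by (auto simp: is_interchange_perm_def intro: permutes_compose)
qed

end

end

section \<open>Measurability of the interchange permutation\<close>

lemma pred_const: "Measurable.pred M (\<lambda>_. c)"
  by simp

lemma pred_Ball_countable:
  assumes "countable X" "\<And>i. i \<in> X \<Longrightarrow> Measurable.pred M (\<lambda>x. P i x)"
  shows "Measurable.pred M (\<lambda>x. \<forall>i\<in>X. P i x)"
proof (cases "X = {}")
  case False
  have "(\<forall>i\<in>X. P i x) \<longleftrightarrow> (\<forall>n. P (from_nat_into X n) x)" for x
    using assms(1) False by (metis from_nat_into from_nat_into_surj)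
  moreover have "Measurable.pred M (\<lambda>x. \<forall>n. P (from_nat_into X n) x)"
    by (intro pred_intros_countable assms(2) from_nat_into False)
  ultimately show ?thesis by simp
qed simp

lemma pred_Bex_countable:
  assumes "countable X" "\<And>i. i \<in> X \<Longrightarrow> Measurable.pred M (\<lambda>x. P i x)"
  shows "Measurable.pred M (\<lambda>x. \<exists>i\<in>X. P i x)"
proof -
  have "Measurable.pred M (\<lambda>x. \<not> (\<forall>i\<in>X. \<not> P i x))"
    by (intro pred_intros_logic pred_Ball_countable assms)
  then show ?thesis by simp
qed

lemmas pred_intros = pred_const pred_intros_logic(2-5) pred_Ball_countable pred_Bex_countable

section \<open>Trajectories observed at countably many times\<close>

context cayley_graph
begin

text \<open>Every element is a finite word in the generators and their inverses.\<close>

lemma countable_carrier: "countable (carrier G)"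
proof -
  define W where "W = S \<union> (\<lambda>s. inv s) ` S"
  have W: "W \<subseteq> carrier G" "countable W"
    using S_subset finite_S by (auto simp: W_def countable_finite)
  have prod: "foldr (\<otimes>) l \<one> \<in> carrier G" if "l \<in> lists W" for l
    using that W by (induction l) auto
  have app: "foldr (\<otimes>) (l @ l') \<one> = foldr (\<otimes>) l \<one> \<otimes> foldr (\<otimes>) l' \<one>"
    if "l \<in> lists W" "l' \<in> lists W" for l l'
    using that(1)
  proof (induction l)
    case (Cons a l)
    then have "a \<in> carrier G" "foldr (\<otimes>) l \<one> \<in> carrier G" using W prod by auto
    then show ?case using Cons prod[OF that(2)] by (simp add: m_assoc)
  qed (use prod that in simp)
  have "\<exists>l\<in>lists W. g = foldr (\<otimes>) l \<one>" if "g \<in> generate G S" for g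
    using that
  proof induction
    case one
    show ?case by (rule bexI[of _ "[]"]) auto
  next
    case (incl h)
    then show ?case using S_subset by (intro bexI[of _ "[h]"]) (auto simp: W_def)
  next
    case (inv h)
    then show ?case using S_subset by (intro bexI[of _ "[inv h]"]) (auto simp: W_def)
  next
    case (eng h1 h2)
    then show ?case using app by (metis append_in_lists_conv)
  qed
  then have "carrier G \<subseteq> (\<lambda>l. foldr (\<otimes>) l \<one>) ` lists W" using generate_S by blast
  moreover have "countable (lists W)" using W by (intro countable_lists)
  ultimately show ?thesis by (meson countable_image countable_subset)
qed

lemma countable_edges: "countable E"
proof -
  have "E = (\<lambda>(x, s). {x, s \<otimes> x}) ` {(x, s) \<in> carrier G \<times> S. s \<otimes> x \<noteq> x}"
    by (auto simp: cayley_edges_def)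
  moreover have "countable {(x, s) \<in> carrier G \<times> S. s \<otimes> x \<noteq> x}"
    by (rule countable_subset[of _ "carrier G \<times> S"])
      (auto intro: countable_SIGMA countable_carrier countable_finite finite_S)
  ultimately show ?thesis by (simp only: countable_image)
qed

text \<open>The end time is added to the rationals because a ring at time \<open>t\<close> can only
  be enclosed by a window that ends at \<open>t\<close>.\<close>

definition checkpoints :: "real \<Rightarrow> real set" where
  "checkpoints t = insert t {q \<in> \<rat>. 0 \<le> q}"

lemma countable_checkpoints: "countable (checkpoints t)"
  unfolding checkpoints_def by (rule countable_insert, rule countable_subset[OF _ countable_rat]) auto

text \<open>A description of \<open>particle_moves\<close> with countably many times only: the step of \<open>x\<close> at the
  random time \<open>u\<close> is detected in a window \<open>(s, q]\<close>, and the third condition says that no other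
  clock at \<open>y\<close> rings in \<open>(u, q]\<close>, although one may ring at \<open>u\<close> itself.\<close>

primrec moves_via :: "nat \<Rightarrow> real \<Rightarrow> ('a set \<Rightarrow> real set) \<Rightarrow> real \<Rightarrow> 'a \<Rightarrow> 'a \<Rightarrow> bool" where
  "moves_via 0 t \<psi> s x z \<longleftrightarrow> z = x \<and> s \<le> t \<and> (\<forall>e\<in>E. x \<in> e \<longrightarrow> card (\<psi> e \<inter> {s<..t}) = 0)"
| "moves_via (Suc n) t \<psi> s x z \<longleftrightarrow> (\<exists>q\<in>checkpoints t. \<exists>y\<in>carrier G. s < q \<and> q \<le> t \<and> {x, y} \<in> E \<and>
     (\<forall>e\<in>E. x \<in> e \<longrightarrow> card (\<psi> e \<inter> {s<..q}) = (if e = {x, y} then 1 else 0)) \<and>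
     (\<forall>e\<in>E. y \<in> e \<longrightarrow> (\<forall>r\<in>checkpoints t. s \<le> r \<and> card (\<psi> {x, y} \<inter> {r<..q}) = 0 \<longrightarrow>
        card (\<psi> e \<inter> {r<..q}) = 0)) \<and>
     moves_via n t \<psi> q y z)"

text \<open>If the clocks at \<open>y\<close> are silent in (u, q], the first ring after
  \<open>u\<close> is the first ring after \<open>q\<close>. This moves the start from a checkpoint
  back to the actual time of the swap.\<close>

lemma particle_moves_earlier:
  assumes "particle_moves G S \<psi> t q y z" "u \<le> q"
    and "\<And>e. e \<in> E \<Longrightarrow> y \<in> e \<Longrightarrow> \<psi> e \<inter> {u<..q} = {}"
  shows "particle_moves G S \<psi> t u y z"
  using assms(1)
proof cases
  case stay
  have "{u<..t} = {u<..q} \<union> {q<..t}" using stay assms(2) by auto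
  then have "\<forall>e\<in>E. y \<in> e \<longrightarrow> \<psi> e \<inter> {u<..t} = {}"
    using stay assms(3) by (metis Int_Un_distrib Un_empty)
  then show ?thesis using stay assms(2) by (auto intro: particle_moves.stay)
next
  case (swap w y')
  have "{u<..w} = {u<..q} \<union> {q<..w}" using swap assms(2) by auto
  then have "\<psi> e \<inter> {u<..w} = \<psi> e \<inter> {q<..w}" if "e \<in> E" "y \<in> e" for e
    using assms(3)[OF that] by (simp add: Int_Un_distrib)
  then have "\<forall>e\<in>E. y \<in> e \<longrightarrow> \<psi> e \<inter> {u<..w} = (if e = {y, y'} then {w} else {})"
    using swap(4) by simp
  then show ?thesis using swap assms(2) by (intro particle_moves.swap[of u w]) auto
qed

context
  fixes \<psi> :: "'a set \<Rightarrow> real set" and t :: real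
  assumes \<psi>: "\<And>e. e \<in> E \<Longrightarrow> \<psi> e \<in> ring_times"
begin

lemma card_ring_0_iff: "e \<in> E \<Longrightarrow> 0 \<le> s \<Longrightarrow> card (\<psi> e \<inter> {s<..q}) = 0 \<longleftrightarrow> \<psi> e \<inter> {s<..q} = {}"
  using ring_times_finite_Ioc[OF \<psi>] by (simp only: card_eq_0_iff) blast

lemma moves_via_imp_particle_moves:
  "moves_via n t \<psi> s x z \<Longrightarrow> 0 \<le> s \<Longrightarrow> particle_moves G S \<psi> t s x z"
proof (induction n arbitrary: s x)
  case 0
  then have "\<forall>e\<in>E. x \<in> e \<longrightarrow> \<psi> e \<inter> {s<..t} = {}" using card_ring_0_iff by simp
  with 0 show ?case by (auto intro: particle_moves.stay)
next
  case (Suc n)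
  from Suc.prems(1)[unfolded moves_via.simps]
  obtain q y where q: "q \<in> checkpoints t" "s < q" "q \<le> t" "{x, y} \<in> E"
    and "\<forall>e\<in>E. x \<in> e \<longrightarrow> card (\<psi> e \<inter> {s<..q}) = (if e = {x, y} then 1 else 0)"
    and "\<forall>e\<in>E. y \<in> e \<longrightarrow> (\<forall>r\<in>checkpoints t. s \<le> r \<and> card (\<psi> {x, y} \<inter> {r<..q}) = 0 \<longrightarrow>
        card (\<psi> e \<inter> {r<..q}) = 0)"
    and moves: "moves_via n t \<psi> q y z"
    by (elim bexE conjE)
  note x = this(5)[rule_format] and y = this(6)[rule_format]
  have "card (\<psi> {x, y} \<inter> {s<..q}) = 1" using x[OF q(4)] by simp
  then obtain u where u: "\<psi> {x, y} \<inter> {s<..q} = {u}" by (auto simp: card_1_singleton_iff)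
  then have su: "s < u" "u \<le> q" by auto
  show ?case
  proof (rule particle_moves.swap[OF su(1) _ q(4)])
    show "u \<le> t" using su q by simp
    show "\<forall>e\<in>E. x \<in> e \<longrightarrow> \<psi> e \<inter> {s<..u} = (if e = {x, y} then {u} else {})"
    proof (intro ballI impI)
      fix e assume e: "e \<in> E" "x \<in> e"
      have sub: "{s<..u} \<subseteq> {s<..q}" using su by auto
      show "\<psi> e \<inter> {s<..u} = (if e = {x, y} then {u} else {})"
      proof (cases "e = {x, y}")
        case True
        have "\<psi> e \<inter> {s<..u} = (\<psi> {x, y} \<inter> {s<..q}) \<inter> {s<..u}" using sub True by blast
        also have "\<dots> = {u}" unfolding u using su by auto
        finally show ?thesis using True by simp
      next
        case False
        then have "\<psi> e \<inter> {s<..q} = {}" using x[OF e] card_ring_0_iff[OF e(1) Suc.prems(2)] by simp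
        then show ?thesis using sub False by auto
      qed
    qed
    show "particle_moves G S \<psi> t u y z"
    proof (rule particle_moves_earlier[OF Suc.IH[OF moves] su(2)])
      show "0 \<le> q" using q Suc.prems by simp
      fix e assume e: "e \<in> E" "y \<in> e"
      show "\<psi> e \<inter> {u<..q} = {}"
      proof (rule equals0I)
        fix w assume w: "w \<in> \<psi> e \<inter> {u<..q}"
        \<comment> \<open>The edge {x, y} is silent after \<open>u\<close>, hence in (r, q]; the
          third condition of \<open>moves_via\<close> then silences \<open>e\<close> there, which
          contradicts the ring \<open>w\<close>.\<close>
        then obtain r where r: "r \<in> \<rat>" "u < r" "r < w" using Rats_dense_in_real[of u w] by auto
        have r0: "0 \<le> r" "s \<le> r" using r su Suc.prems by auto
        then have "r \<in> checkpoints t" using r by (simp add: checkpoints_def)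
        moreover have "\<psi> {x, y} \<inter> {r<..q} \<subseteq> \<psi> {x, y} \<inter> {s<..q} - {u}" using r su by auto
        then have "\<psi> {x, y} \<inter> {r<..q} = {}" unfolding u by simp
        ultimately have "card (\<psi> e \<inter> {r<..q}) = 0" using y[OF e, of r] r0(2) by simp
        then have "\<psi> e \<inter> {r<..q} = {}" using card_ring_0_iff[OF e(1) r0(1)] by simp
        then show False using w r by auto
      qed
    qed
  qed
qed

text \<open>By local finiteness the finitely many clocks at \<open>V\<close> are silent for a while
  after \<open>u\<close>, long enough to contain a rational; for \<open>u = t\<close> the checkpoint
  is \<open>t\<close> itself.\<close>

lemma silent_checkpoint:
  assumes "finite V" "0 \<le> u" "u \<le> t"
  obtains q where "q \<in> checkpoints t" "u \<le> q" "q \<le> t" "u = t \<or> u < q"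
    "\<And>e. e \<in> edges_touching V \<Longrightarrow> \<psi> e \<inter> {u<..q} = {}"
proof (cases "u = t")
  case True
  then show ?thesis using that[of t] by (simp add: checkpoints_def)
next
  case False
  then have ut: "u < t" using assms by simp
  define F where "F = insert t (\<Union>e\<in>edges_touching V. \<psi> e \<inter> {u<..t})"
  have "finite F"
    unfolding F_def using assms \<psi>
    by (intro finite.insertI finite_UN_I finite_edges_touching ring_times_finite_Ioc)
      (auto simp: edges_touching_def)
  moreover have "u < f" if "f \<in> F" for f using that ut by (auto simp: F_def)
  moreover have "F \<noteq> {}" by (simp add: F_def)
  ultimately have "u < Min F" by simp
  then obtain q where q: "q \<in> \<rat>" "u < q" "q < Min F" using Rats_dense_in_real by auto
  have less: "q < f" if "f \<in> F" for f
    using q(3) Min_le[OF \<open>finite F\<close> that] by (rule less_le_trans)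
  have "q < t" using less[of t] by (simp add: F_def)
  moreover have "\<psi> e \<inter> {u<..q} = {}" if "e \<in> edges_touching V" for e
  proof (rule equals0I)
    fix w assume "w \<in> \<psi> e \<inter> {u<..q}"
    then have "w \<in> F" "w \<le> q" using that \<open>q < t\<close> by (auto simp: F_def)
    then show False using less by force
  qed
  ultimately show ?thesis using that[of q] q assms by (auto simp: checkpoints_def)
qed

text \<open>Swap times are in general no checkpoints. The induction therefore lets the description
  start at any checkpoint \<open>q\<close> up to which the particle has rested since
  \<open>s\<close>.\<close>

lemma particle_moves_imp_moves_via:
  assumes "particle_moves G S \<psi> t s x z" "0 \<le> s" "q \<in> checkpoints t" "s \<le> q" "q \<le> t"
    and "\<And>e. e \<in> E \<Longrightarrow> x \<in> e \<Longrightarrow> \<psi> e \<inter> {s<..q} = {}"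
  shows "\<exists>n. moves_via n t \<psi> q x z"
  using assms
proof (induction arbitrary: q rule: particle_moves.induct)
  case (stay s x)
  have "\<psi> e \<inter> {q<..t} = {}" if "e \<in> E" "x \<in> e" for e
  proof -
    have "{q<..t} \<subseteq> {s<..t}" using stay by auto
    then show ?thesis using stay(2) that by blast
  qed
  then have "moves_via 0 t \<psi> q x x" using stay card_ring_0_iff[of _ q] by simp
  then show ?case ..
next
  case (swap s u x y z)
  note rings = swap.hyps(4)
  have u: "u \<in> \<psi> {x, y}" by (rule ring_at_swap[OF swap.hyps(3,4)])
  have qu: "q < u"
  proof (rule ccontr)
    assume "\<not> q < u"
    then have "u \<in> \<psi> {x, y} \<inter> {s<..q}" using u swap.hyps by auto
    then show False using swap.prems(5)[of "{x, y}"] swap.hyps(3) by auto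
  qed
  have q0: "0 \<le> q" using swap.prems by simp
  have yC: "y \<in> carrier G" using swap.hyps(3) by (auto intro: edge_carrier)
  obtain q' where q': "q' \<in> checkpoints t" "u \<le> q'" "q' \<le> t"
    and silent: "\<And>e. e \<in> edges_touching {x, y} \<Longrightarrow> \<psi> e \<inter> {u<..q'} = {}"
    by (rule silent_checkpoint[of "{x, y}" u]) (use swap.hyps qu q0 in auto)
  have "\<exists>n. moves_via n t \<psi> q' y z"
    using q' qu q0 silent by (intro swap.IH) (auto simp: edges_touching_def)
  then obtain n where n: "moves_via n t \<psi> q' y z" ..
  have "moves_via (Suc n) t \<psi> q x z"
    unfolding moves_via.simps
  proof (intro bexI[of _ q'] bexI[of _ y] conjI)
    show "q < q'" using qu q' by simp
    show "\<forall>e\<in>E. x \<in> e \<longrightarrow> card (\<psi> e \<inter> {q<..q'}) = (if e = {x, y} then 1 else 0)"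
    proof (intro ballI impI)
      fix e assume e: "e \<in> E" "x \<in> e"
      have "{q<..q'} = {q<..u} \<union> {u<..q'}" using qu q' by auto
      moreover have "\<psi> e \<inter> {u<..q'} = {}" using silent e by (auto simp: edges_touching_def)
      ultimately have 1: "\<psi> e \<inter> {q<..q'} = \<psi> e \<inter> {q<..u}" by (simp add: Int_Un_distrib)
      have "\<psi> e \<inter> {q<..u} = (\<psi> e \<inter> {s<..u}) \<inter> {q<..u}" using swap.prems by auto
      also have "\<dots> = (if e = {x, y} then {u} else {})"
        using rings e qu by auto
      finally show "card (\<psi> e \<inter> {q<..q'}) = (if e = {x, y} then 1 else 0)"
        unfolding 1 by simp
    qed
    show "\<forall>e\<in>E. y \<in> e \<longrightarrow> (\<forall>r\<in>checkpoints t. q \<le> r \<and> card (\<psi> {x, y} \<inter> {r<..q'}) = 0 \<longrightarrow>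
        card (\<psi> e \<inter> {r<..q'}) = 0)"
    proof (intro ballI impI)
      fix e r assume e: "e \<in> E" "y \<in> e" and r: "r \<in> checkpoints t"
        "q \<le> r \<and> card (\<psi> {x, y} \<inter> {r<..q'}) = 0"
      have "\<psi> {x, y} \<inter> {r<..q'} = {}"
        using r q0 card_ring_0_iff[OF swap.hyps(3), of r q'] by auto
      \<comment> \<open>The ring \<open>u\<close> of {x, y} is not in (r, q'], so \<open>r\<close>
        is not before \<open>u\<close>; and after \<open>u\<close> all clocks at \<open>y\<close>
        are silent up to \<open>q'\<close>.\<close>
      then have "u \<le> r" using u q' by (meson IntI disjoint_iff greaterThanAtMost_iff not_le)
      then have "{r<..q'} \<subseteq> {u<..q'}" by auto
      moreover have "\<psi> e \<inter> {u<..q'} = {}" using silent e by (auto simp: edges_touching_def)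
      ultimately have "\<psi> e \<inter> {r<..q'} = {}" by blast
      then show "card (\<psi> e \<inter> {r<..q'}) = 0" by simp
    qed
  qed (use q' n yC swap.hyps in auto)
  then show ?case ..
qed

lemma particle_moves_iff_moves_via:
  assumes "0 \<le> t"
  shows "particle_moves G S \<psi> t 0 x z \<longleftrightarrow> (\<exists>n. moves_via n t \<psi> 0 x z)"
proof
  assume "particle_moves G S \<psi> t 0 x z"
  then show "\<exists>n. moves_via n t \<psi> 0 x z"
    by (rule particle_moves_imp_moves_via) (use assms in \<open>auto simp: checkpoints_def\<close>)
qed (auto intro: moves_via_imp_particle_moves)

text \<open>There may be uncountably many permutations. As trajectories are unique, existence
  amounts to totality, injectivity and surjectivity of a relation, with quantifiers over the
  countable carrier only.\<close>

lemma exists_interchange_perm_iff: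
  "(\<exists>f. is_interchange_perm G S t \<psi> f) \<longleftrightarrow>
    (\<forall>v\<in>carrier G. \<exists>z\<in>carrier G. particle_moves G S \<psi> t 0 v z) \<and>
    (\<forall>v\<in>carrier G. \<forall>w\<in>carrier G. \<forall>z\<in>carrier G.
       particle_moves G S \<psi> t 0 v z \<and> particle_moves G S \<psi> t 0 w z \<longrightarrow> v = w) \<and>
    (\<forall>z\<in>carrier G. \<exists>v\<in>carrier G. particle_moves G S \<psi> t 0 v z)" (is "?L \<longleftrightarrow> ?R")
proof
  assume ?L
  then obtain f where f: "f permutes carrier G" "\<And>v. v \<in> carrier G \<Longrightarrow> particle_moves G S \<psi> t 0 v (f v)"
    by (auto simp: is_interchange_perm_def)
  have eq: "z = f v" if "particle_moves G S \<psi> t 0 v z" "v \<in> carrier G" for v z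
    using particle_moves_unique[OF that(1) f(2)[OF that(2)]] .
  have "v = w" if "v \<in> carrier G" "w \<in> carrier G" "particle_moves G S \<psi> t 0 v z"
      "particle_moves G S \<psi> t 0 w z" for v w z
    using that eq permutes_inj[OF f(1)] by (metis injD)
  moreover have "\<exists>v\<in>carrier G. particle_moves G S \<psi> t 0 v z" if "z \<in> carrier G" for z
    using f that permutes_image[OF f(1)] by (metis imageE)
  moreover have "\<exists>z\<in>carrier G. particle_moves G S \<psi> t 0 v z" if "v \<in> carrier G" for v
    using f(2)[OF that] particle_moves_carrier that by blast
  ultimately show ?R by blast
next
  assume R: ?R
  then obtain f where f: "\<And>v. v \<in> carrier G \<Longrightarrow> f v \<in> carrier G \<and> particle_moves G S \<psi> t 0 v (f v)"
    by metis
  define f' where "f' v = (if v \<in> carrier G then f v else v)" for v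
  have "inj_on f (carrier G)" using R f by (intro inj_onI) metis
  moreover have "f ` carrier G = carrier G"
  proof
    show "carrier G \<subseteq> f ` carrier G"
    proof
      fix z assume "z \<in> carrier G"
      then obtain v where "v \<in> carrier G" "particle_moves G S \<psi> t 0 v z" using R by blast
      then show "z \<in> f ` carrier G" using f particle_moves_unique by blast
    qed
  qed (use f in blast)
  ultimately have "bij_betw f (carrier G) (carrier G)" by (simp add: bij_betw_def)
  then have "bij_betw f' (carrier G) (carrier G)"
    by (rule bij_betw_cong[THEN iffD1, rotated]) (simp add: f'_def)
  then have "f' permutes carrier G" by (rule bij_imp_permutes) (simp add: f'_def)
  then have "is_interchange_perm G S t \<psi> f'" using f by (simp add: is_interchange_perm_def f'_def)
  then show ?L by blast
qed

lemma interchange_perm_eq_iff: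
  assumes "v \<in> carrier G"
  shows "interchange_perm G S t \<psi> v = z \<longleftrightarrow>
    (if \<exists>f. is_interchange_perm G S t \<psi> f then particle_moves G S \<psi> t 0 v z else z = v)"
proof (cases "\<exists>f. is_interchange_perm G S t \<psi> f")
  case True
  then obtain f where f: "is_interchange_perm G S t \<psi> f" ..
  have "particle_moves G S \<psi> t 0 v (f v)" using f assms by (simp add: is_interchange_perm_def)
  then show ?thesis using True interchange_perm_eq[OF f] particle_moves_unique by metis
next
  case False
  then show ?thesis using interchange_perm_id[of t \<psi>] by auto
qed

end

end

section \<open>The process on the product space\<close>

locale interchange_process = cayley_graph G S + poisson_law \<nu>
  for G :: "('a, 'b) monoid_scheme" (structure) and S and \<nu> +
  fixes \<beta> :: real
  assumes \<beta>: "0 < \<beta>"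
begin

sublocale clocks: product_prob_space "\<lambda>_. \<nu>" E
  by unfold_locales

abbreviation \<mu> :: "('a set \<Rightarrow> real set) measure" where "\<mu> \<equiv> Pi\<^sub>M E (\<lambda>_. \<nu>)"

abbreviation \<pi> :: "('a set \<Rightarrow> real set) \<Rightarrow> 'a \<Rightarrow> 'a" where "\<pi> \<equiv> interchange_perm G S \<beta>"

lemma sets_clocks: "sets \<mu> = sets (clock_space G S)"
  unfolding clock_space_def by (intro sets_PiM_cong refl sets_law)

lemma space_clocks: "space \<mu> = space (clock_space G S)"
  by (rule sets_eq_imp_space_eq[OF sets_clocks])

lemma clocks_ring_times: "\<psi> \<in> space \<mu> \<Longrightarrow> e \<in> E \<Longrightarrow> \<psi> e \<in> ring_times"
  by (auto simp: space_PiM space_law)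

lemma clocks_extensional: "\<psi> \<in> space \<mu> \<Longrightarrow> \<psi> \<in> extensional E"
  by (auto simp: space_PiM PiE_iff)

lemma pred_card_ring:
  assumes "e \<in> E" "0 \<le> s"
  shows "Measurable.pred \<mu> (\<lambda>\<psi>. card (\<psi> e \<inter> {s<..q}) = k)"
proof -
  have [measurable]: "(\<lambda>\<psi>. card (\<psi> e \<inter> {s<..q})) \<in> \<mu> \<rightarrow>\<^sub>M count_space UNIV"
    using measurable_compose[OF measurable_component_singleton[OF assms(1)]
        measurable_law[OF measurable_card_Ioc[OF assms(2)]]] .
  show ?thesis by measurable
qed

lemma pred_moves_via:
  "0 \<le> s \<Longrightarrow> Measurable.pred \<mu> (\<lambda>\<psi>. moves_via n \<beta> \<psi> s x z)"
proof (induction n arbitrary: s x)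
  case 0
  show ?case
    unfolding moves_via.simps
    by (intro pred_intros countable_edges pred_card_ring 0)
next
  case (Suc n)
  have Q0: "0 \<le> q" if "q \<in> checkpoints \<beta>" for q
    using that \<beta> by (auto simp: checkpoints_def)
  have "Measurable.pred \<mu> (\<lambda>\<psi>. {x, y} \<in> E \<and>
     (\<forall>e\<in>E. x \<in> e \<longrightarrow> card (\<psi> e \<inter> {s<..q}) = (if e = {x, y} then 1 else 0)) \<and>
     (\<forall>e\<in>E. y \<in> e \<longrightarrow> (\<forall>r\<in>checkpoints \<beta>. s \<le> r \<and> card (\<psi> {x, y} \<inter> {r<..q}) = 0 \<longrightarrow>
        card (\<psi> e \<inter> {r<..q}) = 0)) \<and>
     moves_via n \<beta> \<psi> q y z)" if q: "q \<in> checkpoints \<beta>" for q y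
  \<comment> \<open>The clock of {x, y} is a coordinate only if this set is an edge; otherwise the
    condition is constantly false.\<close>
  proof (cases "{x, y} \<in> E")
    case True
    show ?thesis
      by (intro pred_intros countable_edges
          countable_checkpoints pred_card_ring Suc True Q0 q)
  qed simp
  then show ?case
    unfolding moves_via.simps
    by (intro pred_Bex_countable countable_carrier countable_checkpoints)
      (rule pred_intros_logic(3)[OF pred_const], rule pred_intros_logic(3)[OF pred_const])
qed

lemma pred_particle_moves: "Measurable.pred \<mu> (\<lambda>\<psi>. particle_moves G S \<psi> \<beta> 0 x z)"
proof -
  have "Measurable.pred \<mu> (\<lambda>\<psi>. \<exists>n. moves_via n \<beta> \<psi> 0 x z)"
    by (intro pred_intros_countable pred_moves_via) simp
  moreover have "particle_moves G S \<psi> \<beta> 0 x z \<longleftrightarrow> (\<exists>n. moves_via n \<beta> \<psi> 0 x z)" if "\<psi> \<in> space \<mu>" for \<psi>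
    using particle_moves_iff_moves_via[of \<psi> \<beta>] clocks_ring_times[OF that] \<beta> by simp
  ultimately show ?thesis by (simp cong: measurable_cong)
qed

lemma pred_interchange_perm:
  assumes "v \<in> carrier G"
  shows "Measurable.pred \<mu> (\<lambda>\<psi>. \<pi> \<psi> v = z)"
proof -
  let ?W = "\<lambda>\<psi>. (\<forall>v\<in>carrier G. \<exists>z\<in>carrier G. particle_moves G S \<psi> \<beta> 0 v z) \<and>
    (\<forall>v\<in>carrier G. \<forall>w\<in>carrier G. \<forall>z\<in>carrier G.
       particle_moves G S \<psi> \<beta> 0 v z \<and> particle_moves G S \<psi> \<beta> 0 w z \<longrightarrow> v = w) \<and>
    (\<forall>z\<in>carrier G. \<exists>v\<in>carrier G. particle_moves G S \<psi> \<beta> 0 v z)"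
  have [measurable]: "Measurable.pred \<mu> ?W"
    by (intro pred_intros countable_carrier pred_particle_moves)
  note [measurable] = pred_particle_moves
  have "Measurable.pred \<mu> (\<lambda>\<psi>. if ?W \<psi> then particle_moves G S \<psi> \<beta> 0 v z else z = v)"
    by measurable
  moreover have "\<pi> \<psi> v = z \<longleftrightarrow> (if ?W \<psi> then particle_moves G S \<psi> \<beta> 0 v z else z = v)"
    if "\<psi> \<in> space \<mu>" for \<psi>
    using interchange_perm_eq_iff[of \<psi> v \<beta> z] exists_interchange_perm_iff[of \<psi> \<beta>]
      clocks_ring_times[OF that] assms by presburger
  ultimately show ?thesis by (simp cong: measurable_cong)
qed

lemma perm_carrier [simp]: "\<pi> \<psi> v \<in> carrier G \<longleftrightarrow> v \<in> carrier G"
  using interchange_perm_permutes permutes_in_image by metis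

lemma perm_power_carrier [simp]: "(\<pi> \<psi> ^^ n) v \<in> carrier G \<longleftrightarrow> v \<in> carrier G"
  by (induction n) auto

lemma perm_bij: "bij (\<pi> \<psi>)"
  using interchange_perm_permutes permutes_bij by blast

lemma inv_perm_permutes: "inv_into UNIV (\<pi> \<psi>) permutes carrier G"
  using interchange_perm_permutes permutes_inv by blast

lemma inv_perm_carrier [simp]: "inv_into UNIV (\<pi> \<psi>) v \<in> carrier G \<longleftrightarrow> v \<in> carrier G"
  using inv_perm_permutes permutes_in_image by metis

lemma inv_perm_power_carrier [simp]: "(inv_into UNIV (\<pi> \<psi>) ^^ n) v \<in> carrier G \<longleftrightarrow> v \<in> carrier G"
  by (induction n) auto

lemma pred_perm_power:
  assumes "v \<in> carrier G"
  shows "Measurable.pred \<mu> (\<lambda>\<psi>. (\<pi> \<psi> ^^ n) v = z)"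
proof (induction n arbitrary: z)
  case (Suc n)
  have "(\<pi> \<psi> ^^ Suc n) v = z \<longleftrightarrow> (\<exists>w\<in>carrier G. (\<pi> \<psi> ^^ n) v = w \<and> \<pi> \<psi> w = z)" for \<psi>
    using assms by auto
  moreover have "Measurable.pred \<mu> (\<lambda>\<psi>. \<exists>w\<in>carrier G. (\<pi> \<psi> ^^ n) v = w \<and> \<pi> \<psi> w = z)"
    by (intro pred_intros countable_carrier Suc pred_interchange_perm)
  ultimately show ?case by presburger
qed simp

text \<open>Exchanging source and target reduces measurability and equivariance of the past to those
  of the future.\<close>

lemma inv_perm_power_eq_iff: "(inv_into UNIV (\<pi> \<psi>) ^^ n) v = z \<longleftrightarrow> (\<pi> \<psi> ^^ n) z = v"
proof -
  have "inv_into UNIV (\<pi> \<psi>) ^^ n = inv_into UNIV (\<pi> \<psi> ^^ n)" by (rule inv_fn[OF perm_bij, symmetric])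
  moreover have "bij (\<pi> \<psi> ^^ n)" using perm_bij by (rule bij_fn)
  ultimately show ?thesis by (metis bij_inv_eq_iff)
qed

lemma pred_inv_perm_power:
  assumes "v \<in> carrier G"
  shows "Measurable.pred \<mu> (\<lambda>\<psi>. (inv_into UNIV (\<pi> \<psi>) ^^ n) v = z)"
proof (cases "z \<in> carrier G")
  case True
  then show ?thesis
    unfolding inv_perm_power_eq_iff by (rule pred_perm_power)
next
  case False
  then have "(inv_into UNIV (\<pi> \<psi>) ^^ n) v \<noteq> z" for \<psi> using assms by auto
  then show ?thesis by simp
qed

end

section \<open>Indistinguishability\<close>

lemma funpow_bij_cycle:
  assumes f: "bij f" and n: "0 < n" "(f ^^ n) v = v"
  shows "finite (perm_cycle f v)"
proof -
  have fwd: "(f ^^ k) v \<in> (\<lambda>i. (f ^^ i) v) ` {..<n}" for k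
    using funpow_mod_eq[OF n(2), of k] n(1) by (intro image_eqI[of _ _ "k mod n"]) auto
  have mult: "(f ^^ (n * k)) v = v" for k
    using funpow_mod_eq[OF n(2), of "n * k"] by simp
  \<comment> \<open>A return after n steps turns backward iterates into forward ones: k further
    steps complete the exponent n k - k to a multiple of n.\<close>
  have "(inv_into UNIV f ^^ k) v = (f ^^ (n * k - k)) v" for k
  proof -
    have "(f ^^ k) ((f ^^ (n * k - k)) v) = (f ^^ (k + (n * k - k))) v" by (simp add: funpow_add)
    also have "k + (n * k - k) = n * k" using n(1) by (cases n) auto
    finally have "(f ^^ k) ((f ^^ (n * k - k)) v) = v" using mult by simp
    then have "inv_into UNIV (f ^^ k) v = (f ^^ (n * k - k)) v"
      using bij_fn[OF f] by (metis bij_inv_eq_iff)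
    then show ?thesis by (simp add: inv_fn[OF f])
  qed
  then have "perm_cycle f v \<subseteq> (\<lambda>i. (f ^^ i) v) ` {..<n}"
    using fwd by (auto simp: perm_cycle_def)
  then show ?thesis by (rule finite_subset) simp
qed

lemma inj_funpow_orbit:
  assumes f: "bij f" and no: "\<And>n. (f ^^ Suc n) v \<noteq> v"
  shows "inj (\<lambda>n. (f ^^ n) v)"
proof (rule linorder_injI)
  fix i j :: nat assume ij: "i < j"
  show "(f ^^ i) v \<noteq> (f ^^ j) v"
  proof
    assume "(f ^^ i) v = (f ^^ j) v"
    also have "j = i + Suc (j - Suc i)" using ij by simp
    finally have "(f ^^ i) v = (f ^^ i) ((f ^^ Suc (j - Suc i)) v)" by (simp only: funpow_add o_apply)
    then have "v = (f ^^ Suc (j - Suc i)) v" using bij_fn[OF f] by (metis bij_betw_imp_inj_on injD)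
    then show False using no by metis
  qed
qed

text \<open>The absence of a return is a countable condition on forward iterates, which suits
  measurability and equivariance.\<close>

lemma infinite_perm_cycle_iff:
  assumes f: "bij f"
  shows "infinite (perm_cycle f v) \<longleftrightarrow> (\<forall>n. (f ^^ Suc n) v \<noteq> v)"
proof
  assume "infinite (perm_cycle f v)"
  then show "\<forall>n. (f ^^ Suc n) v \<noteq> v" using funpow_bij_cycle[OF f] by (metis zero_less_Suc)
next
  assume no: "\<forall>n. (f ^^ Suc n) v \<noteq> v"
  have "infinite (range (\<lambda>n. (f ^^ n) v))"
    using inj_funpow_orbit[OF f] no by (intro range_inj_infinite) blast
  then show "infinite (perm_cycle f v)" by (simp add: perm_cycle_def)
qed

lemma infinite_perm_cycle_inv:
  assumes f: "bij f" and inf: "infinite (perm_cycle f v)"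
  shows "(inv_into UNIV f ^^ Suc n) v \<noteq> v"
proof
  assume "(inv_into UNIV f ^^ Suc n) v = v"
  then have "inv_into UNIV (f ^^ Suc n) v = v" by (simp only: inv_fn[OF f])
  then have "(f ^^ Suc n) v = v" using bij_fn[OF f] by (metis bij_inv_eq_iff)
  then show False using inf infinite_perm_cycle_iff[OF f] by blast
qed

text \<open>The transposition alters \<open>f\<close> only at the preimages of \<open>z\<close> and
  \<open>y\<close>. After its start the forward orbit of \<open>y\<close> meets neither point and is
  kept, while the predecessor of \<open>z\<close> becomes that of \<open>y\<close>. The exponent
  \<open>Suc n\<close> matters: with exponent 0 the two sides would be \<open>y\<close> and
  \<open>z\<close>.\<close>

lemma transposed_cycle:
  fixes f :: "'x \<Rightarrow> 'x" and y z :: 'x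
  defines "f' \<equiv> Transposition.transpose z y \<circ> f"
  assumes f: "bij f" and y: "\<And>n. (f ^^ Suc n) y \<noteq> y" and zy: "\<And>n. (f ^^ n) y \<noteq> z"
    and z: "\<And>n. (inv_into UNIV f ^^ Suc n) z \<noteq> z"
  shows "(f' ^^ n) y = (f ^^ n) y"
    and "(inv_into UNIV f' ^^ Suc n) y = (inv_into UNIV f ^^ Suc n) z"
proof -
  show "(f' ^^ n) y = (f ^^ n) y"
  proof (induction n)
    case (Suc n)
    have "(f' ^^ Suc n) y = f' ((f' ^^ n) y)" by simp
    also have "\<dots> = Transposition.transpose z y ((f ^^ Suc n) y)"
      unfolding Suc by (simp add: f'_def)
    also have "\<dots> = (f ^^ Suc n) y"
      using y[of n] zy[of "Suc n"] by (intro transpose_apply_other)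
    finally show ?case .
  qed simp
  have inv: "inv_into UNIV f' x = inv_into UNIV f (Transposition.transpose z y x)" for x
    unfolding f'_def using f by (simp add: o_inv_distrib)
  have zn: "(inv_into UNIV f ^^ n) z \<noteq> y" for n
  proof
    assume "(inv_into UNIV f ^^ n) z = y"
    then have "inv_into UNIV (f ^^ n) z = y" by (simp add: inv_fn[OF f])
    then have "(f ^^ n) y = z" using bij_fn[OF f] by (metis bij_inv_eq_iff)
    then show False using zy by blast
  qed
  show "(inv_into UNIV f' ^^ Suc n) y = (inv_into UNIV f ^^ Suc n) z"
  proof (induction n)
    case 0
    show ?case by (simp add: inv)
  next
    case (Suc n)
    have "(inv_into UNIV f' ^^ Suc (Suc n)) y = inv_into UNIV f' ((inv_into UNIV f' ^^ Suc n) y)"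
      by simp
    also have "\<dots> = inv_into UNIV f (Transposition.transpose z y ((inv_into UNIV f ^^ Suc n) z))"
      unfolding Suc inv ..
    also have "Transposition.transpose z y ((inv_into UNIV f ^^ Suc n) z) = (inv_into UNIV f ^^ Suc n) z"
      using z[of n] zn[of "Suc n"] by (intro transpose_apply_other)
    finally show ?case by simp
  qed
qed

text \<open>The tail unions decrease to the empty set, since a point of all of them would lie in
  infinitely many \<open>B n\<close>.\<close>

lemma (in finite_measure) measure_infinitely_often_zero:
  fixes B :: "nat \<Rightarrow> 'a set"
  assumes B: "\<And>n. B n \<in> sets M" and fin: "\<And>x. finite {n. x \<in> B n}"
  shows "(\<lambda>n. measure M (B n)) \<longlonglongrightarrow> 0"
proof (rule tendsto_sandwich[OF _ _ tendsto_const])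
  have "(\<lambda>n. measure M (\<Union>k\<in>{n..}. B k)) \<longlonglongrightarrow> measure M (\<Inter>n. \<Union>k\<in>{n..}. B k)"
    using B by (intro finite_Lim_measure_decseq) (auto simp: decseq_def, force)
  moreover have "(\<Inter>n. \<Union>k\<in>{n..}. B k) = {}"
  proof (rule equals0I)
    fix x assume "x \<in> (\<Inter>n. \<Union>k\<in>{n..}. B k)"
    then have "\<forall>n. \<exists>k\<ge>n. k \<in> {n. x \<in> B n}" by auto
    then show False using fin[of x] unfolding infinite_nat_iff_unbounded_le[symmetric] by simp
  qed
  ultimately show "(\<lambda>n. measure M (\<Union>k\<in>{n..}. B k)) \<longlonglongrightarrow> 0" by simp
  show "\<forall>\<^sub>F n in sequentially. measure M (B n) \<le> measure M (\<Union>k\<in>{n..}. B k)"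
    using B by (intro always_eventually allI finite_measure_mono) auto
qed (simp add: measure_nonneg)

section \<open>Clocks seen from a moving vertex\<close>

context interchange_process
begin

lemma clock_action_measurable:
  assumes "g \<in> carrier G"
  shows "\<theta> g \<in> \<mu> \<rightarrow>\<^sub>M \<mu>"
  unfolding clock_action_def using assms
  by (intro measurable_restrict measurable_component_singleton vertex_action_edge) auto

lemma clock_action_space: "g \<in> carrier G \<Longrightarrow> \<psi> \<in> space \<mu> \<Longrightarrow> \<theta> g \<psi> \<in> space \<mu>"
  using measurable_space[OF clock_action_measurable] .

text \<open>The action permutes the factors of a product of identical measures.\<close>

lemma distr_clock_action:
  assumes g: "g \<in> carrier G"
  shows "distr \<mu> \<mu> (\<theta> g) = \<mu>"
proof -
  have "inj_on ((`) (vertex_action G (inv g))) E"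
    using g vertex_action_image_inv(2) by (intro inj_onI) metis
  moreover have "(`) (vertex_action G (inv g)) \<in> E \<rightarrow> E"
    using g vertex_action_edge by auto
  ultimately show ?thesis
    using distr_PiM_reindex[of E "\<lambda>_. \<nu>" "(`) (vertex_action G (inv g))" E] prob_space_axioms
    by (simp add: clock_action_def[abs_def])
qed

lemma prob_clock_action:
  assumes "g \<in> carrier G" "X \<in> sets \<mu>"
  shows "measure \<mu> {\<psi> \<in> space \<mu>. \<theta> g \<psi> \<in> X} = measure \<mu> X"
proof -
  have "measure \<mu> X = measure (distr \<mu> \<mu> (\<theta> g)) X" using distr_clock_action assms by simp
  also have "\<dots> = measure \<mu> (\<theta> g -` X \<inter> space \<mu>)"
    by (intro measure_distr clock_action_measurable assms)
  also have "\<theta> g -` X \<inter> space \<mu> = {\<psi> \<in> space \<mu>. \<theta> g \<psi> \<in> X}" by auto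
  finally show ?thesis by simp
qed

lemma sets_clock_action:
  assumes "g \<in> carrier G" "X \<in> sets \<mu>"
  shows "{\<psi> \<in> space \<mu>. \<theta> g \<psi> \<in> X} \<in> sets \<mu>"
proof -
  have "\<theta> g -` X \<inter> space \<mu> \<in> sets \<mu>"
    by (rule measurable_sets[OF clock_action_measurable[OF assms(1)] assms(2)])
  moreover have "\<theta> g -` X \<inter> space \<mu> = {\<psi> \<in> space \<mu>. \<theta> g \<psi> \<in> X}" by auto
  ultimately show ?thesis by simp
qed

lemma sets_environment:
  assumes meas: "\<And>z. Measurable.pred \<mu> (\<lambda>\<psi>. h \<psi> = z)"
    and h: "\<And>\<psi>. \<psi> \<in> space \<mu> \<Longrightarrow> h \<psi> \<in> carrier G" and X: "X \<in> sets \<mu>"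
  shows "{\<psi> \<in> space \<mu>. \<theta> (h \<psi>) \<psi> \<in> X} \<in> sets \<mu>"
proof -
  have "{\<psi> \<in> space \<mu>. \<theta> (h \<psi>) \<psi> \<in> X} =
      (\<Union>x\<in>carrier G. {\<psi> \<in> space \<mu>. h \<psi> = x} \<inter> {\<psi> \<in> space \<mu>. \<theta> x \<psi> \<in> X})"
    using h by auto
  also have "\<dots> \<in> sets \<mu>"
  proof (rule sets.countable_UN'[OF countable_carrier], safe)
    fix x assume "x \<in> carrier G"
    then show "{\<psi> \<in> space \<mu>. h \<psi> = x} \<inter> {\<psi> \<in> space \<mu>. \<theta> x \<psi> \<in> X} \<in> sets \<mu>"
      using meas[unfolded pred_def, of x] sets_clock_action[OF _ X] by blast
  qed
  finally show ?thesis .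
qed

text \<open>Mass transport: summed over \<open>x\<close>, the events \<open>h \<psi> v = x\<close> are moved to the pairwise disjoint
  events \<open>h \<psi> (v \<otimes> inv x) = \<one>\<close> by \<open>\<theta> x\<close>.\<close>

lemma prob_environment:
  assumes meas: "\<And>v z. v \<in> carrier G \<Longrightarrow> Measurable.pred \<mu> (\<lambda>\<psi>. h \<psi> v = z)"
    and bij: "\<And>\<psi>. \<psi> \<in> space \<mu> \<Longrightarrow> bij_betw (h \<psi>) (carrier G) (carrier G)"
    and equiv: "\<And>g \<psi> v. g \<in> carrier G \<Longrightarrow> \<psi> \<in> space \<mu> \<Longrightarrow> v \<in> carrier G \<Longrightarrow>
      h (\<theta> g \<psi>) (vertex_action G g v) = vertex_action G g (h \<psi> v)"
    and X: "X \<in> sets \<mu>" and v: "v \<in> carrier G"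
  shows "measure \<mu> {\<psi> \<in> space \<mu>. \<theta> (h \<psi> v) \<psi> \<in> X} = measure \<mu> X"
proof -
  have hC: "h \<psi> w \<in> carrier G" if "\<psi> \<in> space \<mu>" "w \<in> carrier G" for \<psi> w
    using bij[OF that(1)] that(2) by (auto simp: bij_betw_def)
  define L where "L x = {\<psi> \<in> space \<mu>. h \<psi> v = x \<and> \<theta> x \<psi> \<in> X}" for x
  define R where "R x = {\<psi> \<in> X. h \<psi> (v \<otimes> inv x) = \<one>}" for x
  have Xsp: "X \<subseteq> space \<mu>" using X by (rule sets.sets_into_space)
  have L: "L x \<in> sets \<mu>" if "x \<in> carrier G" for x
  proof -
    have "L x = {\<psi> \<in> space \<mu>. h \<psi> v = x} \<inter> {\<psi> \<in> space \<mu>. \<theta> x \<psi> \<in> X}" by (auto simp: L_def)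
    then show ?thesis using meas[OF v, unfolded pred_def] sets_clock_action[OF that X] by auto
  qed
  have R: "R x \<in> sets \<mu>" if "x \<in> carrier G" for x
  proof -
    have "R x = {\<psi> \<in> space \<mu>. h \<psi> (v \<otimes> inv x) = \<one>} \<inter> X" using Xsp by (auto simp: R_def)
    then show ?thesis using meas[of "v \<otimes> inv x", unfolded pred_def] v that X by auto
  qed
  \<comment> \<open>The action of \<open>inv x\<close> sends \<open>v \<otimes> inv x\<close> to
    \<open>v\<close> and \<open>\<one>\<close> to \<open>x\<close>, so \<open>R x\<close> is the
    preimage of \<open>L x\<close> under a map that preserves \<mu>.\<close>
  have LR: "emeasure \<mu> (L x) = emeasure \<mu> (R x)" if x: "x \<in> carrier G" for x
  proof -
    have "\<theta> (inv x) \<psi> \<in> L x \<longleftrightarrow> \<psi> \<in> R x" if \<psi>: "\<psi> \<in> space \<mu>" for \<psi>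
    proof -
      have "\<theta> x (\<theta> (inv x) \<psi>) = \<psi>"
        using clock_action_inv[of "inv x" \<psi>] x clocks_extensional[OF \<psi>] by simp
      moreover have "vertex_action G (inv x) (v \<otimes> inv x) = v"
        using x v by (simp add: vertex_action_def m_assoc)
      then have "h (\<theta> (inv x) \<psi>) v = vertex_action G (inv x) (h \<psi> (v \<otimes> inv x))"
        using equiv[of "inv x" \<psi> "v \<otimes> inv x"] x v \<psi> by simp
      moreover have "vertex_action G (inv x) (h \<psi> (v \<otimes> inv x)) = x \<longleftrightarrow> h \<psi> (v \<otimes> inv x) = \<one>"
      proof -
        have w: "h \<psi> (v \<otimes> inv x) \<in> carrier G" using hC[OF \<psi>] x v by simp
        show ?thesis using w x by (simp add: vertex_action_def r_cancel_one)
      qed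
      ultimately show ?thesis
        using Xsp \<psi> x clock_action_space[of "inv x" \<psi>] by (auto simp: L_def R_def)
    qed
    then have "{\<psi> \<in> space \<mu>. \<theta> (inv x) \<psi> \<in> L x} = R x" using Xsp by (auto simp: R_def)
    then show ?thesis
      using prob_clock_action[of "inv x" "L x"] x L[OF x] by (simp add: clocks.P.emeasure_eq_measure)
  qed
  have "{\<psi> \<in> space \<mu>. \<theta> (h \<psi> v) \<psi> \<in> X} = (\<Union>x\<in>carrier G. L x)"
    using hC v by (auto simp: L_def)
  moreover have "disjoint_family_on L (carrier G)" by (auto simp: disjoint_family_on_def L_def)
  ultimately have "emeasure \<mu> {\<psi> \<in> space \<mu>. \<theta> (h \<psi> v) \<psi> \<in> X} =
      (\<integral>\<^sup>+x. emeasure \<mu> (L x) \<partial>count_space (carrier G))"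
    using emeasure_UN_countable[OF L countable_carrier] by simp
  also have "\<dots> = (\<integral>\<^sup>+x. emeasure \<mu> (R x) \<partial>count_space (carrier G))"
    by (intro nn_integral_cong) (simp add: LR)
  also have "\<dots> = emeasure \<mu> (\<Union>x\<in>carrier G. R x)"
  proof (rule emeasure_UN_countable[symmetric, OF R countable_carrier])
    show "disjoint_family_on R (carrier G)"
      unfolding disjoint_family_on_def
    proof (intro ballI impI)
      fix x x' assume x: "x \<in> carrier G" "x' \<in> carrier G" "x \<noteq> x'"
      show "R x \<inter> R x' = {}"
      proof (rule equals0I)
        fix \<psi> assume \<psi>: "\<psi> \<in> R x \<inter> R x'"
        then have "\<psi> \<in> space \<mu>" "h \<psi> (v \<otimes> inv x) = h \<psi> (v \<otimes> inv x')" using Xsp by (auto simp: R_def)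
        then have "v \<otimes> inv x = v \<otimes> inv x'"
          using bij[of \<psi>] x v by (auto simp: bij_betw_def dest!: inj_onD)
        then have "inv x = inv x'" using x v by simp
        then show False using x by (metis inv_inv)
      qed
    qed
  qed
  also have "(\<Union>x\<in>carrier G. R x) = X"
  proof
    show "X \<subseteq> (\<Union>x\<in>carrier G. R x)"
    proof
      fix \<psi> assume \<psi>: "\<psi> \<in> X"
      then obtain w where w: "w \<in> carrier G" "h \<psi> w = \<one>"
        using bij[of \<psi>] Xsp by (metis bij_betw_imp_surj_on imageE one_closed subsetD)
      \<comment> \<open>The witness \<open>inv w \<otimes> v\<close> is the solution x of
        \<open>v \<otimes> inv x = w\<close>.\<close>
      then have "v \<otimes> inv (inv w \<otimes> v) = w"
        using v by (simp add: inv_mult_group m_assoc[symmetric])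
      then have "\<psi> \<in> R (inv w \<otimes> v)" using w \<psi> by (simp add: R_def)
      then show "\<psi> \<in> (\<Union>x\<in>carrier G. R x)"
        by (rule UN_I[rotated]) (use w(1) v in simp)
    qed
  qed (auto simp: R_def)
  finally show ?thesis by (simp add: clocks.P.emeasure_eq_measure)
qed

lemma perm_power_equivariant:
  assumes "g \<in> carrier G" "\<psi> \<in> space \<mu>" "v \<in> carrier G"
  shows "(\<pi> (\<theta> g \<psi>) ^^ n) (vertex_action G g v) = vertex_action G g ((\<pi> \<psi> ^^ n) v)"
  using assms(3)
  by (induction n) (simp_all add: interchange_perm_clock_action assms clocks_extensional)

lemma inv_perm_power_equivariant:
  assumes "g \<in> carrier G" "\<psi> \<in> space \<mu>" "v \<in> carrier G"
  shows "(inv_into UNIV (\<pi> (\<theta> g \<psi>)) ^^ n) (vertex_action G g v) =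
    vertex_action G g ((inv_into UNIV (\<pi> \<psi>) ^^ n) v)"
  unfolding inv_perm_power_eq_iff
  using assms by (simp add: perm_power_equivariant) (metis inv_perm_power_eq_iff)

lemma permutes_power: "f permutes C \<Longrightarrow> (f ^^ n) permutes C"
  by (induction n) (auto simp: permutes_id intro: permutes_compose)

text \<open>An iterate of the permutation is an equivariant bijection of the vertices, so mass
  transport applies, with no condition on the cycle of \<open>v\<close>.\<close>

lemma prob_environment_perm_power:
  assumes "X \<in> sets \<mu>" "v \<in> carrier G"
  shows "measure \<mu> {\<psi> \<in> space \<mu>. \<theta> ((\<pi> \<psi> ^^ n) v) \<psi> \<in> X} = measure \<mu> X"
  using assms
  by (intro prob_environment pred_perm_power perm_power_equivariant permutes_imp_bij
      permutes_power interchange_perm_permutes)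

lemma prob_environment_inv_perm_power:
  assumes "X \<in> sets \<mu>" "v \<in> carrier G"
  shows "measure \<mu> {\<psi> \<in> space \<mu>. \<theta> ((inv_into UNIV (\<pi> \<psi>) ^^ n) v) \<psi> \<in> X} = measure \<mu> X"
  using assms
  by (intro prob_environment pred_inv_perm_power inv_perm_power_equivariant permutes_imp_bij
      permutes_power inv_perm_permutes)

lemma sets_environment_perm_power:
  assumes "X \<in> sets \<mu>" "v \<in> carrier G"
  shows "{\<psi> \<in> space \<mu>. \<theta> ((\<pi> \<psi> ^^ n) v) \<psi> \<in> X} \<in> sets \<mu>"
    and "{\<psi> \<in> space \<mu>. \<theta> ((inv_into UNIV (\<pi> \<psi>) ^^ n) v) \<psi> \<in> X} \<in> sets \<mu>"
  using assms by (auto intro!: sets_environment pred_perm_power pred_inv_perm_power)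

section \<open>Infinite cycles and mixing\<close>

abbreviation inf_cycle :: "('a set \<Rightarrow> real set) \<Rightarrow> 'a \<Rightarrow> bool" where
  "inf_cycle \<psi> v \<equiv> infinite (perm_cycle (\<pi> \<psi>) v)"

lemma pred_inf_cycle:
  assumes "v \<in> carrier G"
  shows "Measurable.pred \<mu> (\<lambda>\<psi>. inf_cycle \<psi> v)"
  unfolding infinite_perm_cycle_iff[OF perm_bij]
  by (intro pred_intros_countable pred_intros_logic(2) pred_perm_power assms)

lemma inf_cycle_clock_action:
  assumes "g \<in> carrier G" "\<psi> \<in> space \<mu>" "v \<in> carrier G"
  shows "inf_cycle (\<theta> g \<psi>) (vertex_action G g v) \<longleftrightarrow> inf_cycle \<psi> v"
  unfolding infinite_perm_cycle_iff[OF perm_bij]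
  using assms by (simp add: perm_power_equivariant vertex_action_inj del: funpow.simps)

lemma inf_cycle_infinite_carrier: "inf_cycle \<psi> v \<Longrightarrow> v \<in> carrier G \<Longrightarrow> infinite (carrier G)"
proof
  assume inf: "inf_cycle \<psi> v" and v: "v \<in> carrier G" and fin: "finite (carrier G)"
  have "perm_cycle (\<pi> \<psi>) v \<subseteq> carrier G" using v by (auto simp: perm_cycle_def)
  then show False using inf fin finite_subset by blast
qed

text \<open>The default \<open>id\<close> has only fixed points, so an infinite cycle shows that the
  genuine permutation exists.\<close>

lemma is_interchange_perm_inf_cycle:
  assumes "inf_cycle \<psi> v"
  shows "is_interchange_perm G S \<beta> \<psi> (\<pi> \<psi>)"
proof (rule ccontr)
  assume "\<not> is_interchange_perm G S \<beta> \<psi> (\<pi> \<psi>)"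
  then have "\<pi> \<psi> = id" using interchange_perm_eq interchange_perm_id by metis
  then have "(\<pi> \<psi> ^^ Suc 0) v = v" by simp
  then show False using assms infinite_perm_cycle_iff[OF perm_bij] by blast
qed

text \<open>Seen from \<open>v\<close>, an edge carries the clock of its image under
  \<open>inv v\<close>. These are therefore the vertices from which a cylinder event over
  \<open>F\<close> reads a clock of \<open>K\<close>.\<close>

definition meeting :: "'a set set \<Rightarrow> 'a set set \<Rightarrow> 'a set" where
  "meeting F K = {v \<in> carrier G. \<exists>e\<in>F. vertex_action G (inv v) ` e \<in> K}"

text \<open>If \<open>x\<close> is an endpoint of \<open>e\<close> and \<open>x \<otimes> v\<close>
  lies in an edge of \<open>K\<close>, then \<open>v\<close> is \<open>inv x\<close> times a vertex
  of that edge, which leaves finitely many choices.\<close>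

lemma finite_meeting:
  assumes "finite F" "F \<subseteq> E" "finite K" "K \<subseteq> E"
  shows "finite (meeting F K)"
proof (rule finite_subset)
  show "meeting F K \<subseteq> (\<Union>e\<in>F. \<Union>k\<in>K. \<Union>x\<in>e. (\<lambda>w. inv x \<otimes> w) ` k)"
  proof
    fix v assume "v \<in> meeting F K"
    then obtain e where e: "e \<in> F" "vertex_action G (inv v) ` e \<in> K" and v: "v \<in> carrier G"
      by (auto simp: meeting_def)
    have "e \<in> E" using e assms by auto
    then obtain x where x: "x \<in> e" by (auto simp: cayley_edges_def)
    then have xC: "x \<in> carrier G" using \<open>e \<in> E\<close> edge_carrier by blast
    have "vertex_action G (inv v) x = x \<otimes> v" using v by (simp add: vertex_action_def)
    then have "x \<otimes> v \<in> vertex_action G (inv v) ` e" using x by force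
    moreover have "v = inv x \<otimes> (x \<otimes> v)" using xC v by (simp add: m_assoc[symmetric])
    ultimately show "v \<in> (\<Union>e\<in>F. \<Union>k\<in>K. \<Union>x\<in>e. (\<lambda>w. inv x \<otimes> w) ` k)"
      using e x by blast
  qed
  show "finite (\<Union>e\<in>F. \<Union>k\<in>K. \<Union>x\<in>e. (\<lambda>w. inv x \<otimes> w) ` k)"
    using assms finite_edge by (intro finite_UN_I) auto
qed

text \<open>Both events are replaced by cylinders. For all but finitely many \<open>y\<close> the
  shifted second cylinder shares no clock with the first and is independent of it.\<close>

lemma mixing:
  assumes inf: "infinite (carrier G)" and X: "X \<in> sets \<mu>" "X' \<in> sets \<mu>"
    and pos: "0 < measure \<mu> X" "0 < measure \<mu> X'"
  obtains y where "y \<in> carrier G" "y \<noteq> \<one>" "0 < measure \<mu> {\<psi> \<in> X. \<theta> y \<psi> \<in> X'}"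
proof -
  \<comment> \<open>With an eighth of the product, the cylinders have joint probability at least 6
    \<eta>, of which at most 2 \<eta> is lost on the way back to the events.\<close>
  define \<eta> where "\<eta> = measure \<mu> X * measure \<mu> X' / 8"
  have \<eta>: "0 < \<eta>" using pos by (simp add: \<eta>_def)
  obtain F Y where F: "finite F" "F \<subseteq> E" "Y \<in> sets (Pi\<^sub>M F (\<lambda>_. \<nu>))"
    and Y: "measure \<mu> (sym_diff X (clocks.emb E F Y)) < \<eta>"
    by (rule clocks.cylinder_approximableE[OF clocks.cylinder_approximable_sets[OF X(1)] \<eta>])
  obtain F' Y' where F': "finite F'" "F' \<subseteq> E" "Y' \<in> sets (Pi\<^sub>M F' (\<lambda>_. \<nu>))"
    and Y': "measure \<mu> (sym_diff X' (clocks.emb E F' Y')) < \<eta>"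
    by (rule clocks.cylinder_approximableE[OF clocks.cylinder_approximable_sets[OF X(2)] \<eta>])
  let ?Z = "clocks.emb E F Y" and ?Z' = "clocks.emb E F' Y'"
  have Z: "?Z \<in> sets \<mu>" "?Z' \<in> sets \<mu>" using F F' by (auto intro: clocks.sets_emb)
  have "finite (insert \<one> (meeting F' F))" using F F' finite_meeting by simp
  then obtain y where y: "y \<in> carrier G" "y \<noteq> \<one>" "y \<notin> meeting F' F"
    using inf by (metis ex_new_if_finite finite_subset insertCI subsetI)
  \<comment> \<open>Independence of the coordinates is stated for nonempty index sets; without edges
    \<open>\<one>\<close> could not be joined to \<open>y\<close>.\<close>
  have Ene: "E \<noteq> {}"
  proof
    assume "E = {}"
    obtain L where L: "swap_path \<one> y L" using swap_path_exists y by blast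
    with \<open>E = {}\<close> have "L = []" by (cases L) (auto simp: swap_path_def)
    then have "apply_swaps [] \<one> = Transposition.transpose \<one> y \<one>" using L by (simp add: swap_path_def)
    then show False using y by simp
  qed
  define shift where "shift e = vertex_action G (inv y) ` e" for e
  have shift: "shift e \<in> E" if "e \<in> E" for e using that y vertex_action_edge by (simp add: shift_def)
  \<comment> \<open>The clocks that the shifted cylinder actually reads; \<open>Y''\<close> is
    \<open>Y'\<close> written in these coordinates.\<close>
  define F'' where "F'' = shift ` F'"
  define Y'' where "Y'' = (\<lambda>x. \<lambda>e\<in>F'. x (shift e)) -` Y' \<inter> space (Pi\<^sub>M F'' (\<lambda>_. \<nu>))"
  have F'': "F'' \<subseteq> E" "F \<inter> F'' = {}"
    using F' shift y by (auto simp: F''_def shift_def meeting_def)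
  have "(\<lambda>x. \<lambda>e\<in>F'. x (shift e)) \<in> Pi\<^sub>M F'' (\<lambda>_. \<nu>) \<rightarrow>\<^sub>M Pi\<^sub>M F' (\<lambda>_. \<nu>)"
    by (intro measurable_restrict measurable_component_singleton) (auto simp: F''_def)
  then have Y'': "Y'' \<in> sets (Pi\<^sub>M F'' (\<lambda>_. \<nu>))"
    unfolding Y''_def using F'(3) by (rule measurable_sets)
  have shifted: "{\<psi> \<in> space \<mu>. \<theta> y \<psi> \<in> ?Z'} = clocks.emb E F'' Y''"
  proof -
    have "\<theta> y \<psi> \<in> ?Z' \<longleftrightarrow> \<psi> \<in> clocks.emb E F'' Y''" if \<psi>: "\<psi> \<in> space \<mu>" for \<psi>
    proof -
      have "restrict (\<theta> y \<psi>) F' = (\<lambda>e\<in>F'. restrict \<psi> F'' (shift e))"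
        using F'(2) by (auto simp: clock_action_def shift_def F''_def fun_eq_iff)
      moreover have "restrict \<psi> F'' \<in> space (Pi\<^sub>M F'' (\<lambda>_. \<nu>))"
        using \<psi> F'' by (auto simp: space_PiM)
      ultimately show ?thesis
        using clocks.emb_restrict[OF F'(2) clock_action_space[OF y(1) \<psi>]]
          clocks.emb_restrict[OF F''(1) \<psi>] by (simp add: Y''_def)
    qed
    moreover have "clocks.emb E F'' Y'' \<subseteq> space \<mu>"
      using clocks.sets_emb[OF F''(1) Y''] by (rule sets.sets_into_space)
    ultimately show ?thesis by blast
  qed
  have "measure \<mu> (?Z \<inter> {\<psi> \<in> space \<mu>. \<theta> y \<psi> \<in> ?Z'}) = measure \<mu> ?Z * measure \<mu> ?Z'"
    using clocks.prob_emb_disjoint[OF Ene F(2) F'' F(3) Y''] prob_clock_action[OF y(1) Z(2)]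
    by (simp add: shifted)
  moreover have "measure \<mu> (?Z \<inter> {\<psi> \<in> space \<mu>. \<theta> y \<psi> \<in> ?Z'}) \<le>
      measure \<mu> {\<psi> \<in> X. \<theta> y \<psi> \<in> X'} + 2 * \<eta>"
  proof -
    have X'y: "{\<psi> \<in> space \<mu>. \<theta> y \<psi> \<in> X'} \<in> sets \<mu>" by (rule sets_clock_action[OF y(1) X(2)])
    have XX: "{\<psi> \<in> X. \<theta> y \<psi> \<in> X'} = X \<inter> {\<psi> \<in> space \<mu>. \<theta> y \<psi> \<in> X'}"
      using sets.sets_into_space[OF X(1)] by auto
    have sd: "sym_diff X' ?Z' \<in> sets \<mu>" using X Z by auto
    let ?T = "{\<psi> \<in> space \<mu>. \<theta> y \<psi> \<in> sym_diff X' ?Z'}"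
    have T: "?T \<in> sets \<mu>" by (rule sets_clock_action[OF y(1) sd])
    have XXs: "{\<psi> \<in> X. \<theta> y \<psi> \<in> X'} \<in> sets \<mu>" unfolding XX using X X'y by auto
    have "measure \<mu> (?Z \<inter> {\<psi> \<in> space \<mu>. \<theta> y \<psi> \<in> ?Z'}) \<le>
        measure \<mu> ({\<psi> \<in> X. \<theta> y \<psi> \<in> X'} \<union> sym_diff X ?Z \<union> ?T)"
      using X Z XXs T by (intro clocks.P.finite_measure_mono) auto
    also have "\<dots> \<le> measure \<mu> ({\<psi> \<in> X. \<theta> y \<psi> \<in> X'} \<union> sym_diff X ?Z) + measure \<mu> ?T"
      using X Z XXs T by (intro measure_Un_le) auto
    also have "measure \<mu> ({\<psi> \<in> X. \<theta> y \<psi> \<in> X'} \<union> sym_diff X ?Z) \<le>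
        measure \<mu> {\<psi> \<in> X. \<theta> y \<psi> \<in> X'} + measure \<mu> (sym_diff X ?Z)"
      using X Z XXs by (intro measure_Un_le) auto
    also have "measure \<mu> ?T = measure \<mu> (sym_diff X' ?Z')" by (rule prob_clock_action[OF y(1) sd])
    finally show ?thesis using Y Y' by simp
  qed
  moreover have close: "measure \<mu> X - \<eta> \<le> measure \<mu> ?Z" "measure \<mu> X' - \<eta> \<le> measure \<mu> ?Z'"
  proof -
    have *: "measure \<mu> B - \<eta> \<le> measure \<mu> B'"
      if "B \<in> sets \<mu>" "B' \<in> sets \<mu>" "measure \<mu> (sym_diff B B') < \<eta>" for B B'
    proof -
      have "measure \<mu> B \<le> measure \<mu> (B' \<union> sym_diff B B')"
        using that by (intro clocks.P.finite_measure_mono) auto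
      also have "\<dots> \<le> measure \<mu> B' + measure \<mu> (sym_diff B B')"
        using that by (intro measure_Un_le) auto
      finally show ?thesis using that(3) by simp
    qed
    show "measure \<mu> X - \<eta> \<le> measure \<mu> ?Z" "measure \<mu> X' - \<eta> \<le> measure \<mu> ?Z'"
      using * X Z Y Y' by auto
  qed
  have le1: "measure \<mu> X \<le> 1" "measure \<mu> X' \<le> 1" by simp_all
  have "measure \<mu> X * measure \<mu> X' \<le> measure \<mu> X" "measure \<mu> X * measure \<mu> X' \<le> measure \<mu> X'"
    using le1 by (simp_all add: mult_left_le mult_left_le_one_le)
  then have "\<eta> \<le> measure \<mu> X" "\<eta> \<le> measure \<mu> X'" unfolding \<eta>_def using pos by linarith+
  then have "(measure \<mu> X - \<eta>) * (measure \<mu> X' - \<eta>) \<le> measure \<mu> ?Z * measure \<mu> ?Z'"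
    using close by (intro mult_mono) auto
  moreover have "(measure \<mu> X - \<eta>) * (measure \<mu> X' - \<eta>) \<ge> 8 * \<eta> - 2 * \<eta>"
  proof -
    have "\<eta> * measure \<mu> X \<le> \<eta>" "\<eta> * measure \<mu> X' \<le> \<eta>" using \<eta> le1 by (auto intro: mult_left_le)
    moreover have "(measure \<mu> X - \<eta>) * (measure \<mu> X' - \<eta>) =
        8 * \<eta> - \<eta> * measure \<mu> X - \<eta> * measure \<mu> X' + \<eta> * \<eta>"
      by (simp add: \<eta>_def algebra_simps)
    moreover have "0 \<le> \<eta> * \<eta>" by simp
    ultimately show ?thesis by linarith
  qed
  ultimately have "0 < measure \<mu> {\<psi> \<in> X. \<theta> y \<psi> \<in> X'}" using \<eta> by linarith
  then show ?thesis using that y by blast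
qed


section \<open>Component properties under the inserted swaps\<close>

lemma component_property_iff:
  assumes "component_property G S \<beta> A" "\<psi> \<in> space \<mu>" "v \<in> carrier G"
  shows "(\<psi>, v) \<in> A \<longleftrightarrow> (\<theta> v \<psi>, \<one>) \<in> A"
proof -
  \<comment> \<open>Acting by \<open>v\<close> itself moves \<open>v\<close> to
    \<open>v \<otimes> inv v = \<one>\<close>, which turns the property of \<open>v\<close> into an
    event of the clocks seen from \<open>v\<close>.\<close>
  have "(\<theta> v \<psi>, vertex_action G v v) \<in> A \<longleftrightarrow> (\<psi>, v) \<in> A"
    using assms unfolding component_property_def space_clocks by blast
  then show ?thesis using assms by (simp add: vertex_action_def)
qed

lemma component_property_cycle:
  assumes "component_property G S \<beta> A" "\<psi> \<in> space \<mu>" "v \<in> carrier G"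
  shows "(\<psi>, (\<pi> \<psi> ^^ n) v) \<in> A \<longleftrightarrow> (\<psi>, v) \<in> A"
    and "(\<psi>, (inv_into UNIV (\<pi> \<psi>) ^^ n) v) \<in> A \<longleftrightarrow> (\<psi>, v) \<in> A"
proof -
  have *: "(\<psi>, v) \<in> A \<longleftrightarrow> (\<psi>, w) \<in> A" if "w \<in> perm_cycle (\<pi> \<psi>) v" for w
    using assms that unfolding component_property_def space_clocks by blast
  show "(\<psi>, (\<pi> \<psi> ^^ n) v) \<in> A \<longleftrightarrow> (\<psi>, v) \<in> A"
    and "(\<psi>, (inv_into UNIV (\<pi> \<psi>) ^^ n) v) \<in> A \<longleftrightarrow> (\<psi>, v) \<in> A"
    by (rule *[symmetric], simp add: perm_cycle_def)+
qed

lemma sets_component: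
  assumes "component_property G S \<beta> A" "v \<in> carrier G"
  shows "{\<psi> \<in> space \<mu>. (\<psi>, v) \<in> A} \<in> sets \<mu>"
proof -
  have "A \<in> sets (clock_space G S \<Otimes>\<^sub>M count_space (carrier G))"
    using assms by (simp add: component_property_def)
  then have "(\<lambda>\<psi>. (\<psi>, v)) -` A \<in> sets (clock_space G S)" by (rule sets_Pair2)
  moreover from this have "(\<lambda>\<psi>. (\<psi>, v)) -` A \<subseteq> space \<mu>"
    unfolding space_clocks by (rule sets.sets_into_space)
  then have "{\<psi> \<in> space \<mu>. (\<psi>, v) \<in> A} = (\<lambda>\<psi>. (\<psi>, v)) -` A" by auto
  ultimately show ?thesis using sets_clocks by simp
qed

lemma prob_ring_in_window:
  assumes K: "finite K" "K \<subseteq> E" and "0 \<le> s" "s < t"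
  shows "measure \<mu> {\<psi> \<in> space \<mu>. \<exists>e\<in>K. \<psi> e \<inter> {s..<t} \<noteq> {}} \<le> real (card K) * (t - s)"
    and "{\<psi> \<in> space \<mu>. \<exists>e\<in>K. \<psi> e \<inter> {s..<t} \<noteq> {}} \<in> sets \<mu>"
proof -
  let ?B = "{N \<in> space \<nu>. N \<inter> {s..<t} \<noteq> {}}"
  have B: "?B \<in> sets \<nu>"
  proof -
    note [measurable] = measurable_law[OF measurable_card_Ico[OF assms(3), of t]]
    have "N \<inter> {s..<t} \<noteq> {} \<longleftrightarrow> card (N \<inter> {s..<t}) \<noteq> 0" if "N \<in> space \<nu>" for N
      using that ring_times_finite_Ico[of N s t] assms(3) by (simp add: space_law card_eq_0_iff)
    then have "?B = {N \<in> space \<nu>. card (N \<inter> {s..<t}) \<noteq> 0}" by blast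
    also have "\<dots> \<in> sets \<nu>" by measurable
    finally show ?thesis .
  qed
  have eq: "{\<psi> \<in> space \<mu>. \<exists>e\<in>K. \<psi> e \<inter> {s..<t} \<noteq> {}} = (\<Union>e\<in>K. {\<psi> \<in> space \<mu>. \<psi> e \<in> ?B})"
    using K by (auto simp: space_PiM)
  have Be: "{\<psi> \<in> space \<mu>. \<psi> e \<in> ?B} \<in> sets \<mu>" if "e \<in> K" for e
    using that K B by (intro sets_Collect_single') auto
  show "{\<psi> \<in> space \<mu>. \<exists>e\<in>K. \<psi> e \<inter> {s..<t} \<noteq> {}} \<in> sets \<mu>"
    unfolding eq using K Be by (intro sets.finite_UN) auto
  have "measure \<mu> (\<Union>e\<in>K. {\<psi> \<in> space \<mu>. \<psi> e \<in> ?B}) \<le> (\<Sum>e\<in>K. measure \<mu> {\<psi> \<in> space \<mu>. \<psi> e \<in> ?B})"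
    using K Be by (intro measure_UNION_le) auto
  also have "\<dots> \<le> (\<Sum>e\<in>K. t - s)"
  proof (rule sum_mono)
    fix e assume "e \<in> K"
    then have "e \<in> E" using K by auto
    then have "measure \<mu> {\<psi> \<in> space \<mu>. \<psi> e \<in> ?B} = prob ?B"
      using clocks.emeasure_PiM_Collect_single[of e ?B] B by (simp add: measure_def)
    then show "measure \<mu> {\<psi> \<in> space \<mu>. \<psi> e \<in> ?B} \<le> t - s" using prob_ring_Ico_le assms by simp
  qed
  finally show "measure \<mu> {\<psi> \<in> space \<mu>. \<exists>e\<in>K. \<psi> e \<inter> {s..<t} \<noteq> {}} \<le> real (card K) * (t - s)"
    unfolding eq by simp
qed

text \<open>The kind of the spliced cycle is irrelevant: on the altered clocks one of the two tests
  along the cycle of \<open>y\<close> errs in either case. This has probability below 2 \<eta>,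
  while the construction yields at least 4 \<eta>.\<close>

lemma no_mixed_pair:
  assumes A: "component_property G S \<beta> A" and y: "y \<in> carrier G"
  defines "D \<equiv> {\<psi> \<in> space \<mu>. (inf_cycle \<psi> \<one> \<and> (\<psi>, \<one>) \<in> A) \<and> inf_cycle \<psi> y \<and> (\<psi>, y) \<notin> A}"
  shows "measure \<mu> D = 0"
proof (rule ccontr)
  assume "measure \<mu> D \<noteq> 0"
  then have Dpos: "0 < measure \<mu> D" by (simp add: zero_less_measure_iff)
  let ?A1 = "{\<psi> \<in> space \<mu>. (\<psi>, \<one>) \<in> A}"
  have A1: "?A1 \<in> sets \<mu>" by (rule sets_component[OF A one_closed])
  have D: "D \<in> sets \<mu>"
  proof -
    note [measurable] = pred_inf_cycle[OF y] pred_inf_cycle[OF one_closed]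
      sets_component[OF A y, folded pred_def] sets_component[OF A one_closed, folded pred_def]
    show ?thesis unfolding D_def by measurable
  qed
  obtain L where L: "swap_path \<one> y L" using swap_path_exists[OF one_closed y] by blast
  have LE: "\<And>p q. (p, q) \<in> set L \<Longrightarrow> {p, q} \<in> E" using L by (auto simp: swap_path_def)
  have Leq: "apply_swaps L = Transposition.transpose \<one> y" using L by (simp add: swap_path_def)
  define m where "m = length L"
  define K where "K = edges_touching (swap_vertices L)"
  have K: "finite K" "K \<subseteq> E"
    unfolding K_def by (intro finite_edges_touching) (auto simp: swap_vertices_def edges_touching_def)
  \<comment> \<open>The first bound keeps the window in positive times, the second makes a ring of
    \<open>K\<close> in the window at most half as likely as \<open>D\<close>.\<close>
  define \<epsilon> where "\<epsilon> = min (\<beta> / 2) (measure \<mu> D / (2 * (real (card K) + 1)))"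
  have \<epsilon>: "0 < \<epsilon>" "\<epsilon> < \<beta>" using \<beta> Dpos by (auto simp: \<epsilon>_def)
  \<comment> \<open>m + 1 cells of length \<open>\<epsilon> / (m + 1)\<close>, placed so that the
    silent last cell starts at \<beta> and the swaps happen before \<beta>.\<close>
  define c where "c i = \<beta> + \<epsilon> * (real i - real m) / (real m + 1)" for i
  have c_mono: "strict_mono c"
    using \<epsilon> by (intro strict_monoI) (simp add: c_def divide_strict_right_mono)
  have cm: "c m = \<beta>" by (simp add: c_def)
  have c0: "0 < c 0"
  proof -
    have "\<epsilon> * real m / (real m + 1) \<le> \<epsilon>" using \<epsilon> by (simp add: field_simps)
    then show ?thesis using \<epsilon> by (simp add: c_def)
  qed
  have clen: "c (Suc m) - c 0 = \<epsilon>"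
  proof -
    have "c (Suc m) - c 0 = \<epsilon> * (real m + 1) / (real m + 1)"
      unfolding c_def add_diff_cancel_left diff_divide_distrib[symmetric] by (simp add: algebra_simps)
    then show ?thesis by simp
  qed
  define H where "H k = {\<psi> \<in> space \<mu>. \<forall>e\<in>K. \<forall>i\<le>m. card (\<psi> e \<inter> {c i..<c (Suc i)}) = k e i}"
    for k :: "'a set \<Rightarrow> nat \<Rightarrow> nat"
  let ?R = "silence K (c 0) (c (Suc m))"
  define k1 :: "'a set \<Rightarrow> nat \<Rightarrow> nat" where
    "k1 e i = (if i < length L \<and> e = {fst (L ! i), snd (L ! i)} then 1 else 0)" for e i
  have Rdef: "?R = (\<lambda>\<psi>. \<lambda>e\<in>E. if e \<in> K then \<psi> e - {c 0..<c (Suc m)} else \<psi> e)"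
    by (simp add: silence_def fun_eq_iff)
  have law: "poisson_law \<nu>" by unfold_locales
  have erase: "measure \<mu> ({\<psi> \<in> space \<mu>. ?R \<psi> \<in> X} \<inter> H k) = measure \<mu> {\<psi> \<in> space \<mu>. ?R \<psi> \<in> X} * measure \<mu> (H k)"
    if "X \<in> sets \<mu>" for X k
    using prob_erase_counts(1)[OF law K c_mono less_imp_le[OF c0], of X m k] that sets_clocks
    by (simp add: H_def Rdef clock_space_def)
  have Hpos: "0 < measure \<mu> (H k)" and Hsets: "H k \<in> sets \<mu>" for k
    using prob_erase_counts(2,3)[OF law K c_mono less_imp_le[OF c0], of "{}" m k] by (simp_all add: H_def)
  have Rmeas: "?R \<in> \<mu> \<rightarrow>\<^sub>M \<mu>"
    using prob_erase_counts(4)[OF law K c_mono less_imp_le[OF c0], of "{}" m] by (simp add: Rdef)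
  define N where "N = {\<psi> \<in> space \<mu>. \<exists>e\<in>K. \<psi> e \<inter> {c 0..<c (Suc m)} \<noteq> {}}"
  have N: "N \<in> sets \<mu>" "measure \<mu> N \<le> measure \<mu> D / 2"
  proof -
    have lt: "c 0 < c (Suc m)" using c_mono by (simp add: strict_mono_less)
    show "N \<in> sets \<mu>" unfolding N_def using prob_ring_in_window(2)[OF K less_imp_le[OF c0] lt] .
    have "measure \<mu> N \<le> real (card K) * \<epsilon>"
      unfolding N_def clen[symmetric] using prob_ring_in_window(1)[OF K less_imp_le[OF c0] lt] .
    also have "\<dots> \<le> (real (card K) + 1) * (measure \<mu> D / (2 * (real (card K) + 1)))"
      using \<epsilon> by (intro mult_mono) (auto simp: \<epsilon>_def)
    also have "\<dots> = measure \<mu> D / 2"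
      by (simp add: field_simps)
    finally show "measure \<mu> N \<le> measure \<mu> D / 2" .
  qed
  define D' where "D' = D - N"
  have D': "D' \<in> sets \<mu>" using D N by (auto simp: D'_def)
  have D'pos: "0 < measure \<mu> D'"
  proof -
    have "measure \<mu> D \<le> measure \<mu> (D' \<union> N)"
      using D' N(1) by (intro clocks.P.finite_measure_mono sets.Un) (auto simp: D'_def)
    also have "\<dots> \<le> measure \<mu> D' + measure \<mu> N" using D' N by (intro measure_Un_le) auto
    finally show ?thesis using N Dpos by simp
  qed
  define p where "p = measure \<mu> D'"
  define q where "q = measure \<mu> (H k1)"
  have p: "0 < p" using D'pos by (simp add: p_def)
  have q: "0 < q" "q \<le> 1" using Hpos by (simp_all add: q_def)
  \<comment> \<open>Two test errors and \<open>near n\<close> cost at most \<open>p / 4\<close> each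
    in total, since \<open>8 * \<eta> \<le> p\<close>; this leaves \<open>p / 2\<close> for
    \<open>T\<close>, and \<open>p / 2 * q\<close> equals 4 \<eta>.\<close>
  define \<eta> where "\<eta> = p * q / 8"
  have \<eta>: "0 < \<eta>" using p q by (simp add: \<eta>_def)
  have \<eta>p: "8 * \<eta> \<le> p" using p mult_left_le[OF q(2), of p] by (simp add: \<eta>_def)
  obtain F Y where F: "finite F" "F \<subseteq> E" "Y \<in> sets (Pi\<^sub>M F (\<lambda>_. \<nu>))"
    and Y: "measure \<mu> (sym_diff ?A1 (clocks.emb E F Y)) < \<eta>"
    by (rule clocks.cylinder_approximableE[OF clocks.cylinder_approximable_sets[OF A1] \<eta>])
  let ?Z = "clocks.emb E F Y"
  let ?B = "sym_diff ?A1 ?Z"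
  have Z: "?Z \<in> sets \<mu>" using F by (auto intro: clocks.sets_emb)
  have B: "?B \<in> sets \<mu>" using A1 Z by auto
  \<comment> \<open>The vertices from which \<open>?Z\<close> reads a clock that the swaps may
    alter.\<close>
  define W where "W = meeting F K"
  have W: "finite W" unfolding W_def using finite_meeting F K by blast
  define past where "past \<psi> n v = (inv_into UNIV (\<pi> \<psi>) ^^ n) v" for \<psi> n v
  define future where "future \<psi> n v = (\<pi> \<psi> ^^ n) v" for \<psi> n v
  have pC: "past \<psi> n v \<in> carrier G" and fC: "future \<psi> n v \<in> carrier G" if "v \<in> carrier G" for \<psi> n v
    using that by (simp_all add: past_def future_def)

  text \<open>Deep in the past of the origin and in the future of \<open>y\<close> the edges near the path of
    swaps are no longer seen.\<close>
  define near where "near n = {\<psi> \<in> D'. past \<psi> n \<one> \<in> W \<or> future \<psi> n y \<in> W}" for n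
  have near_sets: "near n \<in> sets \<mu>" for n
  proof -
    have "Measurable.pred \<mu> (\<lambda>\<psi>. \<exists>w\<in>W. past \<psi> n \<one> = w)"
      unfolding past_def using W
      by (intro pred_Bex_countable countable_finite pred_inv_perm_power one_closed)
    moreover have "Measurable.pred \<mu> (\<lambda>\<psi>. \<exists>w\<in>W. future \<psi> n y = w)"
      unfolding future_def using W by (intro pred_Bex_countable countable_finite pred_perm_power y)
    ultimately have "Measurable.pred \<mu> (\<lambda>\<psi>. past \<psi> n \<one> \<in> W \<or> future \<psi> n y \<in> W)"
      using pred_intros_logic(5) by fastforce
    then have "{\<psi> \<in> space \<mu>. past \<psi> n \<one> \<in> W \<or> future \<psi> n y \<in> W} \<inter> D' \<in> sets \<mu>"
      unfolding pred_def using D' by (rule sets.Int)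
    moreover have "near n = {\<psi> \<in> space \<mu>. past \<psi> n \<one> \<in> W \<or> future \<psi> n y \<in> W} \<inter> D'"
      using sets.sets_into_space[OF D'] by (auto simp: near_def)
    ultimately show ?thesis by simp
  qed
  have "(\<lambda>n. measure \<mu> (near n)) \<longlonglongrightarrow> 0"
  proof (rule clocks.P.measure_infinitely_often_zero[OF near_sets])
    fix \<psi>
    show "finite {n. \<psi> \<in> near n}"
    proof (cases "\<psi> \<in> D'")
      case True
      then have inf: "inf_cycle \<psi> \<one>" "inf_cycle \<psi> y" by (auto simp: D'_def D_def)
      have "inj (\<lambda>n. past \<psi> n \<one>)"
        unfolding past_def
        using infinite_perm_cycle_inv[OF perm_bij inf(1)]
        by (intro inj_funpow_orbit bij_imp_bij_inv perm_bij)
      moreover have "inj (\<lambda>n. future \<psi> n y)"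
        unfolding future_def
        using infinite_perm_cycle_iff[OF perm_bij] inf(2) by (intro inj_funpow_orbit perm_bij) blast
      ultimately have "finite ((\<lambda>n. past \<psi> n \<one>) -` W \<union> (\<lambda>n. future \<psi> n y) -` W)"
        using W by (simp add: finite_vimageI)
      then show ?thesis by (rule rev_finite_subset) (auto simp: near_def)
    qed (simp add: near_def)
  qed
  then have "\<forall>\<^sub>F n in sequentially. measure \<mu> (near n) < p / 4"
    using p by (intro order_tendstoD(2)) auto
  then obtain n0 where n0: "\<And>n. n0 \<le> n \<Longrightarrow> measure \<mu> (near n) < p / 4"
    by (auto simp: eventually_sequentially)
  \<comment> \<open>A positive exponent, because only then is the past of \<open>y\<close> after the
    swaps the past of \<open>\<one>\<close> before them.\<close>
  define n where "n = Suc n0"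
  have near_n: "measure \<mu> (near n) < p / 4" using n0 by (simp add: n_def)

  \<comment> \<open>The events that the test at the n-th past or future position of \<open>v\<close>
    errs. Seen from there the clocks have law \<mu>, so both have the probability of the
    approximation error.\<close>
  define Bp where "Bp v = {\<psi> \<in> space \<mu>. \<theta> (past \<psi> n v) \<psi> \<in> ?B}" for v
  define Bf where "Bf v = {\<psi> \<in> space \<mu>. \<theta> (future \<psi> n v) \<psi> \<in> ?B}" for v
  have Bsets: "Bp v \<in> sets \<mu>" "Bf v \<in> sets \<mu>" if "v \<in> carrier G" for v
    unfolding Bp_def Bf_def past_def future_def by (intro sets_environment_perm_power B that)+
  have Bsmall: "measure \<mu> (Bp v) < \<eta>" "measure \<mu> (Bf v) < \<eta>" if "v \<in> carrier G" for v
    using Y prob_environment_inv_perm_power[OF B that, of n] prob_environment_perm_power[OF B that, of n]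
    by (simp_all add: Bp_def Bf_def past_def future_def)
  have A_iff: "(\<psi>, v) \<in> A \<longleftrightarrow> \<theta> v \<psi> \<in> ?A1" if "\<psi> \<in> space \<mu>" "v \<in> carrier G" for \<psi> v
    using component_property_iff[OF A that] clock_action_space[OF that(2,1)] by simp
  have A_past: "(\<psi>, past \<psi> n v) \<in> A \<longleftrightarrow> (\<psi>, v) \<in> A"
    and A_future: "(\<psi>, future \<psi> n v) \<in> A \<longleftrightarrow> (\<psi>, v) \<in> A"
    if "\<psi> \<in> space \<mu>" "v \<in> carrier G" for \<psi> v
    using component_property_cycle[OF A that] by (simp_all add: past_def future_def)

  \<comment> \<open>The tests answer according to the kinds of \<open>\<one>\<close> and
    \<open>y\<close>, at positions that see none of the clocks in \<open>K\<close>.\<close>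
  define T where "T = {\<psi> \<in> D'. \<theta> (past \<psi> n \<one>) \<psi> \<in> ?Z \<and> \<theta> (future \<psi> n y) \<psi> \<notin> ?Z \<and>
    past \<psi> n \<one> \<notin> W \<and> future \<psi> n y \<notin> W}"
  have T: "T \<in> sets \<mu>"
  proof -
    have "T = (D' \<inter> {\<psi> \<in> space \<mu>. \<theta> (past \<psi> n \<one>) \<psi> \<in> ?Z}) -
        {\<psi> \<in> space \<mu>. \<theta> (future \<psi> n y) \<psi> \<in> ?Z} - near n"
      using sets.sets_into_space[OF D'] by (auto simp: T_def near_def)
    moreover have "{\<psi> \<in> space \<mu>. \<theta> (past \<psi> n \<one>) \<psi> \<in> ?Z} \<in> sets \<mu>"
      "{\<psi> \<in> space \<mu>. \<theta> (future \<psi> n y) \<psi> \<in> ?Z} \<in> sets \<mu>"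
      unfolding past_def future_def by (intro sets_environment_perm_power Z y one_closed)+
    ultimately show ?thesis using D' near_sets[of n] by simp
  qed
  have "D' \<subseteq> T \<union> Bp \<one> \<union> Bf y \<union> near n"
  proof
    fix \<psi> assume \<psi>: "\<psi> \<in> D'"
    then have sp: "\<psi> \<in> space \<mu>" and AA: "(\<psi>, \<one>) \<in> A" "(\<psi>, y) \<notin> A" by (auto simp: D'_def D_def)
    have "\<theta> (past \<psi> n \<one>) \<psi> \<in> ?A1"
      using AA(1) A_past[OF sp one_closed] A_iff[OF sp pC[OF one_closed]] by blast
    moreover have "\<theta> (future \<psi> n y) \<psi> \<notin> ?A1"
      using AA(2) A_future[OF sp y] A_iff[OF sp fC[OF y]] by blast
    ultimately show "\<psi> \<in> T \<union> Bp \<one> \<union> Bf y \<union> near n"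
      using \<psi> sp by (auto simp: T_def Bp_def Bf_def near_def)
  qed
  then have "p \<le> measure \<mu> (T \<union> Bp \<one> \<union> Bf y \<union> near n)"
    unfolding p_def using T Bsets[OF y] Bsets[OF one_closed] near_sets
    by (intro clocks.P.finite_measure_mono) auto
  also have "\<dots> \<le> measure \<mu> (T \<union> Bp \<one> \<union> Bf y) + measure \<mu> (near n)"
    using T Bsets[OF y] Bsets[OF one_closed] near_sets by (intro measure_Un_le) auto
  also have "measure \<mu> (T \<union> Bp \<one> \<union> Bf y) \<le> measure \<mu> (T \<union> Bp \<one>) + measure \<mu> (Bf y)"
    using T Bsets[OF y] Bsets[OF one_closed] by (intro measure_Un_le) auto
  also have "measure \<mu> (T \<union> Bp \<one>) \<le> measure \<mu> T + measure \<mu> (Bp \<one>)"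
    using T Bsets[OF one_closed] by (intro measure_Un_le) auto
  finally have Tbig: "p / 2 \<le> measure \<mu> T"
    using Bsmall(1)[OF one_closed] Bsmall(2)[OF y] near_n \<eta>p by linarith

  have Rspace: "?R \<psi> \<in> space \<mu>" if "\<psi> \<in> space \<mu>" for \<psi>
    using measurable_space[OF Rmeas that] .
  have RT: "{\<psi> \<in> space \<mu>. ?R \<psi> \<in> T} \<in> sets \<mu>"
  proof -
    have "?R -` T \<inter> space \<mu> \<in> sets \<mu>" by (rule measurable_sets[OF Rmeas T])
    moreover have "?R -` T \<inter> space \<mu> = {\<psi> \<in> space \<mu>. ?R \<psi> \<in> T}" by auto
    ultimately show ?thesis by simp
  qed
  \<comment> \<open>Configurations of \<open>D'\<close> are silent in the window and therefore fixed
    by erasure.\<close>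
  have "T \<subseteq> {\<psi> \<in> space \<mu>. ?R \<psi> \<in> T}"
  proof
    fix \<psi> assume \<psi>: "\<psi> \<in> T"
    then have sp: "\<psi> \<in> space \<mu>" and "\<psi> \<notin> N" by (auto simp: T_def D'_def D_def)
    then have "\<psi> e \<inter> {c 0..<c (Suc m)} = {}" if "e \<in> K" for e using that by (auto simp: N_def)
    then have "?R \<psi> = \<psi>"
      unfolding silence_def using clocks_extensional[OF sp]
      by (intro extensionalityI[of _ E]) auto
    then show "\<psi> \<in> {\<psi> \<in> space \<mu>. ?R \<psi> \<in> T}" using \<psi> sp by simp
  qed
  then have "measure \<mu> T \<le> measure \<mu> {\<psi> \<in> space \<mu>. ?R \<psi> \<in> T}"
    using RT by (intro clocks.P.finite_measure_mono)
  then have "measure \<mu> T * q \<le> measure \<mu> {\<psi> \<in> space \<mu>. ?R \<psi> \<in> T} * q"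
    using q by (intro mult_right_mono) auto
  also have "\<dots> = measure \<mu> ({\<psi> \<in> space \<mu>. ?R \<psi> \<in> T} \<inter> H k1)"
    using erase[OF T, of k1] by (simp add: q_def)
  \<comment> \<open>With the prescribed rings present, both test positions lie on the cycle of
    \<open>y\<close> and have the same kind, but the answers inherited from the erased clocks
    differ.\<close>
  also have "\<dots> \<le> measure \<mu> (Bp y \<union> Bf y)"
  proof (rule clocks.P.finite_measure_mono)
    show "{\<psi> \<in> space \<mu>. ?R \<psi> \<in> T} \<inter> H k1 \<subseteq> Bp y \<union> Bf y"
    proof
      fix \<psi> assume "\<psi> \<in> {\<psi> \<in> space \<mu>. ?R \<psi> \<in> T} \<inter> H k1"
      then have sp: "\<psi> \<in> space \<mu>" and RT: "?R \<psi> \<in> T" and Hk: "\<psi> \<in> H k1" by auto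
      let ?\<phi> = "?R \<psi>"
      have \<phi>: "inf_cycle ?\<phi> \<one>" "inf_cycle ?\<phi> y" "(?\<phi>, \<one>) \<in> A" "(?\<phi>, y) \<notin> A" "?\<phi> \<in> space \<mu>"
        using RT by (auto simp: T_def D'_def D_def)
      have pat: "swap_pattern K c L \<psi>"
        using Hk by (simp add: swap_pattern_def H_def k1_def m_def)
      have "is_interchange_perm G S (c (length L)) \<psi> (apply_swaps L \<circ> \<pi> ?\<phi>)"
      proof (rule is_interchange_perm_insert_swaps)
        show "is_interchange_perm G S (c (length L))
            (silence (edges_touching (swap_vertices L)) (c 0) (c (Suc (length L))) \<psi>) (\<pi> ?\<phi>)"
          using is_interchange_perm_inf_cycle[OF \<phi>(1)] cm by (simp add: K_def m_def)
      qed (use clocks_ring_times[OF sp] LE c_mono c0 pat in \<open>simp_all add: K_def\<close>)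
      then have perm: "\<pi> \<psi> = Transposition.transpose \<one> y \<circ> \<pi> ?\<phi>"
        using interchange_perm_eq cm Leq by (simp add: m_def)
      \<comment> \<open>The orbit of \<open>y\<close> cannot reach \<open>\<one>\<close>, because
        \<open>A\<close> is constant along a cycle and separates the two vertices.\<close>
      have "(\<pi> ?\<phi> ^^ j) y \<noteq> \<one>" for j
        using component_property_cycle(1)[OF A \<phi>(5) y, of j] \<phi>(3,4) by metis
      note cyc = transposed_cycle[of "\<pi> ?\<phi>" y \<one>, OF perm_bij _ this
          infinite_perm_cycle_inv[OF perm_bij \<phi>(1)]]
      have noret: "(\<pi> ?\<phi> ^^ Suc j) y \<noteq> y" for j
        using \<phi>(2) infinite_perm_cycle_iff[OF perm_bij] by blast
      have fut: "future \<psi> n y = future ?\<phi> n y"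
        unfolding future_def perm by (rule cyc(1)[OF noret])
      have pas: "past \<psi> n y = past ?\<phi> n \<one>"
        unfolding past_def perm n_def by (rule cyc(2)[OF noret])
      \<comment> \<open>From a vertex outside \<open>W\<close> the cylinder reads only clocks that
        erasure leaves alone.\<close>
      have same: "\<theta> v \<psi> \<in> ?Z \<longleftrightarrow> \<theta> v ?\<phi> \<in> ?Z" if v: "v \<in> carrier G" "v \<notin> W" for v
      proof -
        have "restrict (\<theta> v \<psi>) F = restrict (\<theta> v ?\<phi>) F"
        proof (rule restrict_ext)
          fix e assume e: "e \<in> F"
          then have "e \<in> E" "vertex_action G (inv v) ` e \<notin> K"
            using v F by (auto simp: W_def meeting_def)
          moreover from this have "vertex_action G (inv v) ` e \<in> E"
            using v by (simp add: vertex_action_edge)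
          ultimately show "\<theta> v \<psi> e = \<theta> v ?\<phi> e" by (simp add: clock_action_def silence_def)
        qed
        then show ?thesis
          using clocks.emb_restrict[OF F(2) clock_action_space[OF v(1) sp], of Y]
            clocks.emb_restrict[OF F(2) clock_action_space[OF v(1) \<phi>(5)], of Y] by simp
      qed
      have "\<theta> (past \<psi> n y) \<psi> \<in> ?Z"
        using same[of "past \<psi> n y"] pC[OF one_closed] RT unfolding pas T_def by blast
      moreover have "\<theta> (future \<psi> n y) \<psi> \<notin> ?Z"
        using same[of "future \<psi> n y"] fC[OF y] RT unfolding fut T_def by blast
      moreover have "\<theta> (past \<psi> n y) \<psi> \<in> ?A1 \<longleftrightarrow> \<theta> (future \<psi> n y) \<psi> \<in> ?A1"
        using A_past[OF sp y] A_future[OF sp y] A_iff[OF sp pC[OF y]] A_iff[OF sp fC[OF y]] by blast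
      ultimately show "\<psi> \<in> Bp y \<union> Bf y" using sp by (auto simp: Bp_def Bf_def)
    qed
  qed (use Bsets[OF y] in auto)
  also have "\<dots> \<le> measure \<mu> (Bp y) + measure \<mu> (Bf y)"
    using Bsets[OF y] by (intro measure_Un_le)
  also have "\<dots> < 2 * \<eta>" using Bsmall[OF y] by simp
  finally have "measure \<mu> T * q < 2 * \<eta>" .
  moreover have "p / 2 * q \<le> measure \<mu> T * q" using Tbig q by (intro mult_right_mono) auto
  ultimately show False using \<eta> by (simp add: \<eta>_def)
qed

text \<open>If both kinds occurred, \<open>mixing\<close> would give a vertex \<open>y\<close> seen
  from which the clocks are of the second kind while those at \<open>\<one>\<close> are of the
  first; by invariance this is a mixed pair.\<close>

lemma infinite_cycles_indistinguishable:
  assumes A: "component_property G S \<beta> A"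
  shows "measure \<mu> {\<psi> \<in> space \<mu>. inf_cycle \<psi> \<one> \<and> (\<psi>, \<one>) \<in> A} = 0 \<or>
    measure \<mu> {\<psi> \<in> space \<mu>. inf_cycle \<psi> \<one> \<and> (\<psi>, \<one>) \<notin> A} = 0" (is "measure \<mu> ?X = 0 \<or> measure \<mu> ?X' = 0")
proof (rule ccontr)
  assume "\<not> (measure \<mu> ?X = 0 \<or> measure \<mu> ?X' = 0)"
  then have pos: "0 < measure \<mu> ?X" "0 < measure \<mu> ?X'" by (auto simp: zero_less_measure_iff)
  note [measurable] = pred_inf_cycle[OF one_closed] sets_component[OF A one_closed, folded pred_def]
  have sets: "?X \<in> sets \<mu>" "?X' \<in> sets \<mu>" by measurable
  have "?X \<noteq> {}" using pos(1) by (metis less_irrefl measure_empty)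
  then have inf: "infinite (carrier G)" using inf_cycle_infinite_carrier[OF _ one_closed] by blast
  obtain y where y: "y \<in> carrier G" "0 < measure \<mu> {\<psi> \<in> ?X. \<theta> y \<psi> \<in> ?X'}"
    using mixing[OF inf sets pos] by blast
  have "\<theta> y \<psi> \<in> ?X' \<longleftrightarrow> inf_cycle \<psi> y \<and> (\<psi>, y) \<notin> A" if \<psi>: "\<psi> \<in> space \<mu>" for \<psi>
  proof -
    have "inf_cycle (\<theta> y \<psi>) \<one> \<longleftrightarrow> inf_cycle \<psi> y"
      using inf_cycle_clock_action[OF y(1) \<psi> y(1)] y by (simp add: vertex_action_def)
    then show ?thesis
      using component_property_iff[OF A \<psi> y(1)] clock_action_space[OF y(1) \<psi>] by simp
  qed
  then have "{\<psi> \<in> ?X. \<theta> y \<psi> \<in> ?X'} = {\<psi> \<in> space \<mu>. (inf_cycle \<psi> \<one> \<and> (\<psi>, \<one>) \<in> A) \<and> inf_cycle \<psi> y \<and> (\<psi>, y) \<notin> A}"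
    by blast
  then show False using no_mixed_pair[OF A y(1)] y(2) by simp
qed

end

section \<open>From a general probability space to the product space\<close>

lemma poisson_law_distr:
  assumes "prob_space M" and N: "unit_poisson_process M N"
  shows "poisson_law (distr M ring_space N)"
proof -
  interpret prob_space M by fact
  let ?\<nu> = "distr M ring_space N"
  have N_meas: "N \<in> M \<rightarrow>\<^sub>M ring_space" using N by (simp add: unit_poisson_process_def)
  interpret D: prob_space ?\<nu> by (rule prob_space_distr[OF N_meas])
  have count: "distr ?\<nu> (count_space UNIV) (\<lambda>A. card (A \<inter> {s..<t})) =
      distr M (count_space UNIV) (\<lambda>\<omega>. card (N \<omega> \<inter> {s..<t}))" if "0 \<le> s" for s t
    using distr_distr[OF measurable_card_Ico[OF that] N_meas] by (simp add: comp_def)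
  have "D.indep_vars (\<lambda>_. count_space UNIV) (\<lambda>i A. card (A \<inter> {\<tau> i..<\<tau> (Suc i)})) UNIV"
    if \<tau>: "0 \<le> \<tau> 0" "strict_mono \<tau>" for \<tau> :: "nat \<Rightarrow> real"
  proof -
    define X where "X i A = card (A \<inter> {\<tau> i..<\<tau> (Suc i)})" for i and A :: "real set"
    have nn: "0 \<le> \<tau> i" for i using \<tau> strict_mono_less_eq[OF \<tau>(2), of 0 i] by simp
    have X: "X i \<in> ring_space \<rightarrow>\<^sub>M count_space UNIV" for i
      unfolding X_def by (rule measurable_card_Ico[OF nn])
    have XN: "(\<lambda>\<omega>. X i (N \<omega>)) \<in> M \<rightarrow>\<^sub>M count_space UNIV" for i
      by (rule measurable_compose[OF N_meas X])
    have "indep_vars (\<lambda>_. count_space UNIV) (\<lambda>i \<omega>. X i (N \<omega>)) UNIV"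
      using N \<tau> by (simp add: unit_poisson_process_def X_def)
    \<comment> \<open>Independence of the counts is an identity between their joint and marginal
      distributions, hence depends only on the law of \<open>N\<close>.\<close>
    then have "distr M (\<Pi>\<^sub>M i\<in>UNIV. count_space UNIV) (\<lambda>\<omega>. \<lambda>i\<in>UNIV. X i (N \<omega>)) =
        (\<Pi>\<^sub>M i\<in>UNIV. distr M (count_space UNIV) (\<lambda>\<omega>. X i (N \<omega>)))"
      using indep_vars_iff_distr_eq_PiM[where I = UNIV and M' = "\<lambda>_. count_space UNIV"
          and X = "\<lambda>i \<omega>. X i (N \<omega>)"] XN by simp
    moreover have "distr ?\<nu> (\<Pi>\<^sub>M i\<in>UNIV. count_space UNIV) (\<lambda>A. \<lambda>i\<in>UNIV. X i A) =
        distr M (\<Pi>\<^sub>M i\<in>UNIV. count_space UNIV) (\<lambda>\<omega>. \<lambda>i\<in>UNIV. X i (N \<omega>))"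
    proof -
      have "(\<lambda>A. \<lambda>i\<in>UNIV. X i A) \<in> ring_space \<rightarrow>\<^sub>M (\<Pi>\<^sub>M i\<in>UNIV. count_space UNIV)"
        by (intro measurable_restrict X)
      from distr_distr[OF this N_meas] show ?thesis by (simp add: comp_def)
    qed
    moreover have "distr ?\<nu> (count_space UNIV) (X i) = distr M (count_space UNIV) (\<lambda>\<omega>. X i (N \<omega>))" for i
      unfolding X_def by (rule count[OF nn])
    ultimately have "D.indep_vars (\<lambda>_. count_space UNIV) X UNIV"
      using D.indep_vars_iff_distr_eq_PiM[where I = UNIV and M' = "\<lambda>_. count_space UNIV" and X = X] X by simp
    then show ?thesis by (simp add: X_def[abs_def])
  qed
  moreover have "(\<lambda>A. A) \<in> ?\<nu> \<rightarrow>\<^sub>M ring_space" by simp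
  ultimately have "unit_poisson_process ?\<nu> (\<lambda>A. A)"
    using N count by (simp add: unit_poisson_process_def)
  then show ?thesis by unfold_locales simp_all
qed

text \<open>One clock provides \<nu>, uniqueness of the Poisson law identifies the laws of the
  others with it, and independence gives the product. An edge is required to have a clock to start
  from.\<close>

lemma distr_poisson_clocks:
  assumes M: "prob_space M" and \<psi>: "poisson_clocks M G S \<psi>" and ne: "cayley_edges G S \<noteq> {}"
  obtains \<nu> where "poisson_law \<nu>" "distr M (clock_space G S) \<psi> = (\<Pi>\<^sub>M e\<in>cayley_edges G S. \<nu>)"
proof -
  interpret prob_space M by fact
  let ?E = "cayley_edges G S"
  have meas: "\<psi> \<in> M \<rightarrow>\<^sub>M clock_space G S"
    and unit: "\<And>e. e \<in> ?E \<Longrightarrow> unit_poisson_process M (\<lambda>\<omega>. \<psi> \<omega> e)"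
    and indep: "indep_vars (\<lambda>_. ring_space) (\<lambda>e \<omega>. \<psi> \<omega> e) ?E"
    using \<psi> by (auto simp: poisson_clocks_def)
  obtain e\<^sub>0 where e\<^sub>0: "e\<^sub>0 \<in> ?E" using ne by blast
  define \<nu> where "\<nu> = distr M ring_space (\<lambda>\<omega>. \<psi> \<omega> e\<^sub>0)"
  have law: "poisson_law \<nu>" unfolding \<nu>_def by (rule poisson_law_distr[OF M unit[OF e\<^sub>0]])
  have same: "distr M ring_space (\<lambda>\<omega>. \<psi> \<omega> e) = \<nu>" if "e \<in> ?E" for e
    using poisson_law_unique[OF poisson_law_distr[OF M unit[OF that]] law] .
  have "distr M (clock_space G S) \<psi> = distr M (clock_space G S) (\<lambda>\<omega>. \<lambda>e\<in>?E. \<psi> \<omega> e)"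
  proof (rule distr_cong[OF refl refl])
    fix \<omega> assume "\<omega> \<in> space M"
    then have "\<psi> \<omega> \<in> space (clock_space G S)" using measurable_space[OF meas] by simp
    then show "\<psi> \<omega> = (\<lambda>e\<in>?E. \<psi> \<omega> e)"
      by (simp add: clock_space_def space_PiM PiE_iff extensional_restrict)
  qed
  also have "\<dots> = (\<Pi>\<^sub>M e\<in>?E. distr M ring_space (\<lambda>\<omega>. \<psi> \<omega> e))"
    unfolding clock_space_def
    using indep_vars_iff_distr_eq_PiM'[where I = ?E and M' = "\<lambda>_. ring_space"
        and X = "\<lambda>e \<omega>. \<psi> \<omega> e", OF ne] indep unit
    by (simp add: unit_poisson_process_def)
  also have "\<dots> = (\<Pi>\<^sub>M e\<in>?E. \<nu>)" by (intro PiM_cong refl same)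
  finally show ?thesis using that law by blast
qed

theorem theorem1p1:
  fixes G :: "('a, 'b) monoid_scheme" (structure)
    and S :: "'a set"
    and \<beta> :: real
    and M :: "'w measure"
    and \<psi> :: "'w \<Rightarrow> 'a set \<Rightarrow> real set"
    and A :: "(('a set \<Rightarrow> real set) \<times> 'a) set"
  assumes "group G"
    and "finite S" and "S \<subseteq> carrier G" and "generate G S = carrier G"
    and "0 < \<beta>"
    and "prob_space M"
    and "poisson_clocks M G S \<psi>"
    and "component_property G S \<beta> A"
    and "0 < \<P>(\<omega> in M. infinite (perm_cycle (interchange_perm G S \<beta> (\<psi> \<omega>)) \<one>))"
  shows "\<P>(\<omega> in M. (\<psi> \<omega>, \<one>) \<in> A \<bar> infinite (perm_cycle (interchange_perm G S \<beta> (\<psi> \<omega>)) \<one>)) \<in> {0, 1}"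
proof -
  interpret M: prob_space M by fact
  interpret cayley_graph G S
    using assms(1-4) by (intro cayley_graph.intro cayley_graph_axioms.intro)
  let ?inf = "\<lambda>\<phi>. infinite (perm_cycle (interchange_perm G S \<beta> \<phi>) \<one>)"
  have meas: "\<psi> \<in> M \<rightarrow>\<^sub>M clock_space G S" using assms(7) by (simp add: poisson_clocks_def)
  \<comment> \<open>A realization with an infinite cycle shows that there is an edge, since without
    edges every particle stays and all cycles are trivial.\<close>
  have "\<exists>\<omega>. ?inf (\<psi> \<omega>)"
  proof (rule ccontr)
    assume "\<nexists>\<omega>. ?inf (\<psi> \<omega>)"
    then have empty: "{\<omega> \<in> space M. ?inf (\<psi> \<omega>)} = {}" by simp
    show False using assms(9) unfolding empty by simp
  qed
  then obtain \<omega> where "?inf (\<psi> \<omega>)" ..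
  moreover have "perm_cycle (interchange_perm G S \<beta> (\<psi> \<omega>)) \<one> = {\<one>}"
    if "E = {}"
  proof -
    have "particle_moves G S (\<psi> \<omega>) \<beta> 0 v v" for v
      using assms(5) that by (intro particle_moves.stay) auto
    then have "is_interchange_perm G S \<beta> (\<psi> \<omega>) id" by (simp add: is_interchange_perm_def permutes_id)
    then show ?thesis using interchange_perm_eq by (simp add: perm_cycle_def)
  qed
  ultimately have ne: "E \<noteq> {}" by auto
  obtain \<nu> where law: "poisson_law \<nu>" and distr: "distr M (clock_space G S) \<psi> = (\<Pi>\<^sub>M e\<in>E. \<nu>)"
    using distr_poisson_clocks[OF assms(6,7) ne] by blast
  interpret poisson_law \<nu> by fact
  interpret interchange_process G S \<nu> \<beta> by unfold_locales fact
  have pull: "measure M {\<omega> \<in> space M. P (\<psi> \<omega>)} = measure \<mu> {\<phi> \<in> space \<mu>. P \<phi>}"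
    if "{\<phi> \<in> space \<mu>. P \<phi>} \<in> sets \<mu>" for P
  proof -
    have "measure \<mu> {\<phi> \<in> space \<mu>. P \<phi>} = measure M (\<psi> -` {\<phi> \<in> space \<mu>. P \<phi>} \<inter> space M)"
      unfolding distr[symmetric] using that sets_clocks space_clocks meas
      by (intro measure_distr) auto
    also have "\<psi> -` {\<phi> \<in> space \<mu>. P \<phi>} \<inter> space M = {\<omega> \<in> space M. P (\<psi> \<omega>)}"
      using measurable_space[OF meas] space_clocks by auto
    finally show ?thesis by simp
  qed
  note [measurable] = pred_inf_cycle[OF one_closed]
    sets_component[OF assms(8) one_closed, folded pred_def]
  have 1: "measure M {\<omega> \<in> space M. (\<psi> \<omega>, \<one>) \<in> A \<and> ?inf (\<psi> \<omega>)} =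
      measure \<mu> {\<phi> \<in> space \<mu>. inf_cycle \<phi> \<one> \<and> (\<phi>, \<one>) \<in> A}"
    by (subst pull) (measurable, simp add: conj_commute)
  have 2: "measure M {\<omega> \<in> space M. ?inf (\<psi> \<omega>)} = measure \<mu> {\<phi> \<in> space \<mu>. inf_cycle \<phi> \<one>}"
    by (rule pull) measurable
  have "{\<phi> \<in> space \<mu>. inf_cycle \<phi> \<one>} = {\<phi> \<in> space \<mu>. inf_cycle \<phi> \<one> \<and> (\<phi>, \<one>) \<in> A} \<union>
      {\<phi> \<in> space \<mu>. inf_cycle \<phi> \<one> \<and> (\<phi>, \<one>) \<notin> A}" by blast
  moreover have "measure \<mu> ({\<phi> \<in> space \<mu>. inf_cycle \<phi> \<one> \<and> (\<phi>, \<one>) \<in> A} \<union>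
        {\<phi> \<in> space \<mu>. inf_cycle \<phi> \<one> \<and> (\<phi>, \<one>) \<notin> A}) =
      measure \<mu> {\<phi> \<in> space \<mu>. inf_cycle \<phi> \<one> \<and> (\<phi>, \<one>) \<in> A} +
      measure \<mu> {\<phi> \<in> space \<mu>. inf_cycle \<phi> \<one> \<and> (\<phi>, \<one>) \<notin> A}"
    by (rule clocks.P.finite_measure_Union) (measurable, auto)
  \<comment> \<open>One of the two summands vanishes; the conditional probability is 0 if it is the
    first and 1 if it is the second.\<close>
  ultimately show ?thesis
    using infinite_cycles_indistinguishable[OF assms(8)] assms(9)
    unfolding cond_prob_def 1 2 by auto
qed

end
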